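(* Let $r>0$, $d\ge 1$, and let $\gamma=(\gamma_j)_{j\in\mathbb Z}$, $\alpha=(\alpha_j)_{j\in\mathbb Z}$, $\omega=(\omega_j)_{j\in\mathbb Z}$ be strictly positive symmetric sequences with $\gamma_0=\omega_0=\alpha_0=1$, $\gamma_j\ge 1$ for all $j\in\mathbb Z$, $(\omega_n/\gamma_n)_{n\in\mathbb N_0}$ and $(\alpha_n)_{n\in\mathbb N_0}$ both non-increasing, and $\sum_{j\in\mathbb Z}\alpha_j<\infty$. For $n\in\mathbb N$ put $$\Psi_n=\min_{k\in\mathbb N_0}\max\Big\{\frac{\omega_k}{\gamma_k},\sum_{0\le|j|\le k}\frac{\omega_j}{n\alpha_j}\Big\},\qquad k_n^*=\operatorname*{arg\,min}_{k\in\mathbb N_0}\max\Big\{\frac{\omega_k}{\gamma_k},\sum_{0\le|j|\le k}\frac{\omega_j}{n\alpha_j}\Big\}.$$ Assume further that (i) $\Gamma:=\sum_{j\in\mathbb Z}\gamma_j^{-1}<\infty$, and (ii) $0<\eta^{-1}=\inf_{n\in\mathbb N}\Psi_n^{-1}\cdot\min\Big\{\frac{\omega_{k_n^*}}{\gamma_{k_n^*}},\sum_{0\le|j|\le k_n^*}\frac{\omega_j}{n\alpha_j}\Big\}$ for some $1\le\eta<\infty$. Then, for any $n\in\mathbb N$ (and any auxiliary sample size $m\in\mathbb N$), $$\inf_{\widetilde\lambda}\ \sup_{\lambda\in\Lambda_\gamma^r}\ \sup_{f\in\mathcal F_\alpha^d}\mathbb E\big[\|\widetilde\lambda-\lambda\|_\omega^2\big]\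 \ge\ \frac{\zeta r}{16\eta}\cdot\Psi_n,$$ where $\zeta=\min\{\frac{1}{2\Gamma d\eta},\frac{2\delta}{d\sqrt r}\}$ with $\delta=\frac12-\frac{1}{2\sqrt2}$, and the infimum is taken over all estimators $\widetilde\lambda$ of $\lambda$ based on the observations $N_1,\dots,N_n$ and $Y_1,\dots,Y_m$ described in the context.
   Context: Notation. $\mathbb L^2=\mathbb L^2([0,1),dx)$; $\mathbf e_j(t)=\exp(2\pi i j t)$; for $g\in\mathbb L^2$, $[g]_j=\int_0^1 g(t)\mathbf e_j(-t)\,dt$. A sequence $(a_j)_{j\in\mathbb Z}$ is symmetric if $a_{-j}=a_j$. For a strictly positive symmetric sequence $\omega$, $\|g\|_\omega^2=\sum_{j\in\mathbb Z}\omega_j|[g]_j|^2$ (similarly $\|\cdot\|_\gamma$). Observation model. $\lambda\in\mathbb L^2$ is a non-negative intensity function and $f\in\mathbb L^2$ a probability density on $[0,1)$, both unknown. Let $\widetilde N_i=\sum_j\delta_{x_{ij}}$, $i=1,\dots,n$, be independent Poisson point processes on $[0,1)$ with intensity function $\lambda$ (with respect to Lebesgue measure), and let $\epsilon_{ij}$ be i.i.d. with density $f$, independent of the $\widetilde N_i$. One observes $N_i=\sum_j\delta_{y_{ij}}$, $i=1,\dots,n$, where $y_{ij}=x_{ij}+\epsilon_{ij}-\lfloor x_{ij}+\epsilon_{ij}\rfloor$, so that $N_1,\dots,N_n$ are i.i.d. Poisson point processes on $[0,1)$ with intensity function the circular convolution $\ell(t)=(\lambda\star f)(t)=\int_0^1\lambda((t-\epsilon)-\lfloor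 t-\epsilon\rfloor)f(\epsilon)\,d\epsilon$. In addition, one observes an i.i.d. sample $Y_1,\dots,Y_m$ with density $f$, independent of $N_1,\dots,N_n$. $\mathbb E$ denotes expectation under the law of the observations given by $(\lambda,f)$. Classes. $\Lambda_\gamma^r=\{\lambda\in\mathbb L^2:\lambda\ge0,\ \sum_{j\in\mathbb Z}\gamma_j|[\lambda]_j|^2\le r\}$ and $\mathcal F_\alpha^d=\{f\in\mathbb L^2: f\ge0,\ [f]_0=1,\ d^{-1}\le|[f]_j|^2/\alpha_j\le d\ \text{for all } j\in\mathbb Z\}$. *)

theory Defs
  imports "HOL-Probability.Probability"
begin

section \<open>Fourier coefficients and function classes on \<open>[0,1)\<close>\<close>

text \<open>Only the values of a function on \<open>[0,1)\<close> are relevant below.\<close>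

definition L2 :: "(real \<Rightarrow> complex) set" where
  "L2 = {g. set_borel_measurable lborel {0..<1} g \<and>
            set_integrable lborel {0..<1} (\<lambda>t. (cmod (g t))\<^sup>2)}"

definition basis_fun :: "int \<Rightarrow> real \<Rightarrow> complex" where
  "basis_fun j t = exp (2 * of_real pi * \<i> * of_int j * of_real t)"

definition fourier_coeff :: "(real \<Rightarrow> complex) \<Rightarrow> int \<Rightarrow> complex" where
  "fourier_coeff g j = (LINT t:{0..<1}|lborel. g t * basis_fun j (- t))"

text \<open>Squared weighted norm; it takes values in \<open>[0,\<infinity>]\<close>.\<close>

definition wnorm2 :: "(int \<Rightarrow> real) \<Rightarrow> (real \<Rightarrow> complex) \<Rightarrow> ennreal" where
  "wnorm2 w g = (\<Sum>\<^sub>\<infinity>j. ennreal (w j * (cmod (fourier_coeff g j))\<^sup>2))"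

definition intensity_class :: "(int \<Rightarrow> real) \<Rightarrow> real \<Rightarrow> (real \<Rightarrow> real) set" where
  "intensity_class \<gamma> r =
     {lam. (\<lambda>t. complex_of_real (lam t)) \<in> L2 \<and>
           (AE t\<in>{0..<1} in lborel. 0 \<le> lam t) \<and>
           wnorm2 \<gamma> (\<lambda>t. complex_of_real (lam t)) \<le> ennreal r}"

definition density_class :: "(int \<Rightarrow> real) \<Rightarrow> real \<Rightarrow> (real \<Rightarrow> real) set" where
  "density_class \<alpha> d =
     {f. (\<lambda>t. complex_of_real (f t)) \<in> L2 \<and>
         (AE t\<in>{0..<1} in lborel. 0 \<le> f t) \<and>
         fourier_coeff (\<lambda>t. complex_of_real (f t)) 0 = 1 \<and>
         (\<forall>j. inverse d \<le> (cmod (fourier_coeff (\<lambda>t. complex_of_real (f t)) j))\<^sup>2 / \<alpha> j \<and>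
              (cmod (fourier_coeff (\<lambda>t. complex_of_real (f t)) j))\<^sup>2 / \<alpha> j \<le> d)}"

definition symmetric_seq :: "(int \<Rightarrow> real) \<Rightarrow> bool" where
  "symmetric_seq a \<longleftrightarrow> (\<forall>j. a (- j) = a j)"

section \<open>Poisson point processes on \<open>[0,1)\<close>\<close>

text \<open>Square integrable intensities have finite total mass, so a realisation is a finite point
  measure \<open>\<Sum>\<^sub>j \<delta>\<^bsub>x j\<^esub>\<close>. It is encoded as the multiset of its atoms; the sigma-algebra on
  configurations is generated by the counts \<open>N \<mapsto> N(B)\<close>.\<close>

definition count_in :: "real multiset \<Rightarrow> real set \<Rightarrow> nat" where
  "count_in N B = size (filter_mset (\<lambda>x. x \<in> B) N)"

definition config_space :: "real multiset measure" where
  "config_space = sigma {N. set_mset N \<subseteq> {0..<1}}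
     {{N. set_mset N \<subseteq> {0..<1} \<and> count_in N B = k} | B k. B \<in> sets borel \<and> B \<subseteq> {0..<1}}"

definition point_config :: "nat \<Rightarrow> (nat \<Rightarrow> real) \<Rightarrow> real multiset" where
  "point_config k x = image_mset x (mset_set {..<k})"

text \<open>The Poisson probabilities are written out because the library constant \<open>poisson_pmf\<close> is
  unspecified at rate \<open>0\<close>, which must be allowed here.\<close>

definition poisson_process ::
    "'w measure \<Rightarrow> (real \<Rightarrow> real) \<Rightarrow> ('w \<Rightarrow> real multiset) \<Rightarrow> bool" where
  "poisson_process M lam N \<longleftrightarrow>
     N \<in> measurable M config_space \<and>
     (\<forall>B k. B \<in> sets borel \<and> B \<subseteq> {0..<1} \<longrightarrow>
        measure M {w \<in> space M. count_in (N w) B = k} =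
          (LINT t:B|lborel. lam t) ^ k / fact k * exp (- (LINT t:B|lborel. lam t))) \<and>
     (\<forall>(B :: nat \<Rightarrow> real set) p.
        (\<forall>i<p. B i \<in> sets borel \<and> B i \<subseteq> {0..<1}) \<and> disjoint_family_on B {..<p} \<longrightarrow>
        prob_space.indep_vars M (\<lambda>_. count_space UNIV) (\<lambda>i w. count_in (N w) (B i)) {..<p})"

section \<open>The observation model\<close>

text \<open>Independence of two random elements; the library's \<open>indep_var\<close> requires both to take values
  in the same type.\<close>

definition indep_elements ::
    "'w measure \<Rightarrow> 'a measure \<Rightarrow> ('w \<Rightarrow> 'a) \<Rightarrow> 'b measure \<Rightarrow> ('w \<Rightarrow> 'b) \<Rightarrow> bool" where
  "indep_elements M A X B Z \<longleftrightarrow>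
     X \<in> measurable M A \<and> Z \<in> measurable M B \<and>
     prob_space.indep_set M {X -` S \<inter> space M | S. S \<in> sets A} {Z -` S \<inter> space M | S. S \<in> sets B}"

text \<open>The \<open>i\<close>-th hidden process has the \<open>K i\<close> atoms \<open>x i j\<close>, \<open>j < K i\<close>; the values \<open>x i j\<close> with
  \<open>j \<ge> K i\<close> are irrelevant. Indices start at \<open>0\<close>. The function \<open>frac y = y - \<lfloor>y\<rfloor>\<close> is the
  library's fractional part.\<close>

definition hidden_process ::
    "(nat \<Rightarrow> 'w \<Rightarrow> nat) \<Rightarrow> (nat \<Rightarrow> nat \<Rightarrow> 'w \<Rightarrow> real) \<Rightarrow> nat \<Rightarrow> 'w \<Rightarrow> real multiset" where
  "hidden_process K x i w = point_config (K i w) (\<lambda>j. x i j w)"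

definition observed_process ::
    "(nat \<Rightarrow> 'w \<Rightarrow> nat) \<Rightarrow> (nat \<Rightarrow> nat \<Rightarrow> 'w \<Rightarrow> real) \<Rightarrow> (nat \<Rightarrow> nat \<Rightarrow> 'w \<Rightarrow> real) \<Rightarrow>
     nat \<Rightarrow> 'w \<Rightarrow> real multiset" where
  "observed_process K x eps i w = point_config (K i w) (\<lambda>j. frac (x i j w + eps i j w))"

text \<open>The errors are independent of the hidden points, numbering included: independence of
  the point measures alone would not exclude a numbering of the atoms chosen after seeing the
  errors.\<close>

locale poisson_deconvolution = prob_space M
  for M :: "'w measure" +
  fixes lam f :: "real \<Rightarrow> real"
    and n m :: nat
    and K :: "nat \<Rightarrow> 'w \<Rightarrow> nat"
    and x eps :: "nat \<Rightarrow> nat \<Rightarrow> 'w \<Rightarrow> real"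
    and Y :: "nat \<Rightarrow> 'w \<Rightarrow> real"
  assumes hidden_poisson: "\<And>i. i < n \<Longrightarrow> poisson_process M lam (hidden_process K x i)"
    and hidden_indep: "indep_vars (\<lambda>_. config_space) (hidden_process K x) {..<n}"
    and eps_density: "\<And>i j. i < n \<Longrightarrow>
          distributed M lborel (eps i j) (\<lambda>t. ennreal (indicator {0..<1} t * f t))"
    and eps_indep: "indep_vars (\<lambda>_. borel) (\<lambda>(i, j). eps i j) ({..<n} \<times> UNIV)"
    and points_eps_indep:
          "indep_elements M
             (PiM {..<n} (\<lambda>_. count_space UNIV \<Otimes>\<^sub>M PiM UNIV (\<lambda>_. borel)))
             (\<lambda>w. \<lambda>i\<in>{..<n}. (K i w, \<lambda>j. x i j w))
             (PiM ({..<n} \<times> UNIV) (\<lambda>_. borel))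
             (\<lambda>w. \<lambda>(i, j)\<in>{..<n} \<times> UNIV. eps i j w)"
    and Y_density: "\<And>k. k < m \<Longrightarrow>
          distributed M lborel (Y k) (\<lambda>t. ennreal (indicator {0..<1} t * f t))"
    and Y_indep: "indep_vars (\<lambda>_. borel) Y {..<m}"
    and observed_Y_indep:
          "indep_elements M
             (PiM {..<n} (\<lambda>_. config_space)) (\<lambda>w. \<lambda>i\<in>{..<n}. observed_process K x eps i w)
             (PiM {..<m} (\<lambda>_. borel)) (\<lambda>w. \<lambda>k\<in>{..<m}. Y k w)"

type_synonym obs = "(nat \<Rightarrow> real multiset) \<times> (nat \<Rightarrow> real)"

definition obs_space :: "nat \<Rightarrow> nat \<Rightarrow> obs measure" where
  "obs_space n m = PiM {..<n} (\<lambda>_. config_space) \<Otimes>\<^sub>M PiM {..<m} (\<lambda>_. borel)"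

definition observation ::
    "nat \<Rightarrow> nat \<Rightarrow> (nat \<Rightarrow> 'w \<Rightarrow> nat) \<Rightarrow> (nat \<Rightarrow> nat \<Rightarrow> 'w \<Rightarrow> real) \<Rightarrow>
     (nat \<Rightarrow> nat \<Rightarrow> 'w \<Rightarrow> real) \<Rightarrow> (nat \<Rightarrow> 'w \<Rightarrow> real) \<Rightarrow> 'w \<Rightarrow> obs" where
  "observation n m K x eps Y w =
     (\<lambda>i\<in>{..<n}. observed_process K x eps i w, \<lambda>k\<in>{..<m}. Y k w)"

text \<open>Estimators are the measurable maps from the observation space to \<open>L2\<close>. As \<open>L2\<close> is
  separable with orthonormal basis \<open>basis_fun\<close>, its Borel sigma-algebra is generated by the
  Fourier coefficients. Complex values are allowed.\<close>

definition estimators :: "nat \<Rightarrow> nat \<Rightarrow> (obs \<Rightarrow> real \<Rightarrow> complex) set" where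
  "estimators n m =
     {T. (\<forall>z \<in> space (obs_space n m). T z \<in> L2) \<and>
         (\<forall>j. (\<lambda>z. fourier_coeff (T z) j) \<in> borel_measurable (obs_space n m))}"

section \<open>The rate\<close>

definition variance_term :: "(int \<Rightarrow> real) \<Rightarrow> (int \<Rightarrow> real) \<Rightarrow> nat \<Rightarrow> nat \<Rightarrow> real" where
  "variance_term \<omega> \<alpha> n k = (\<Sum>j\<in>{- int k..int k}. \<omega> j / (real n * \<alpha> j))"

definition rate_objective ::
    "(int \<Rightarrow> real) \<Rightarrow> (int \<Rightarrow> real) \<Rightarrow> (int \<Rightarrow> real) \<Rightarrow> nat \<Rightarrow> nat \<Rightarrow> real" where
  "rate_objective \<omega> \<gamma> \<alpha> n k = max (\<omega> (int k) / \<gamma> (int k)) (variance_term \<omega> \<alpha> n k)"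

text \<open>The infimum is attained under the assumptions in force, so it is a minimum.\<close>

definition Psi :: "(int \<Rightarrow> real) \<Rightarrow> (int \<Rightarrow> real) \<Rightarrow> (int \<Rightarrow> real) \<Rightarrow> nat \<Rightarrow> real" where
  "Psi \<omega> \<gamma> \<alpha> n = (INF k. rate_objective \<omega> \<gamma> \<alpha> n k)"

end

(*
Assouad's method over the hypercube of intensities sqrt r / 2 + s * (sum over |j| <= k of
+-alpha_j^(-1/2) e_j), with s^2 = zeta r / (4 n), k = k*_n, and one fixed error density f. Summability
of 1/gamma keeps these intensities above delta sqrt r. Flipping the sign at j moves the observed
intensity by at most 8 s^2 d in squared L2 norm, the factor 1/alpha_j being cancelled by |[f]_j|^2, so
the Hellinger affinity of the two laws of (N_1, ..., N_n) is at least exp(-1/2).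

The laws are handled through their generating functionals E[prod_i prod_{y in N_i} psi_i(y)]. For a
Poisson process with intensity lambda the functional is exp(int (psi - 1) lambda). Averaging over the
errors replaces psi by its convolution against f, whose adjoint turns lambda into the circular
convolution of lambda and f. The functionals determine the law, which identifies the likelihood ratio
of two hypotheses and the expectation of its square root.
*)
theory Submission
  imports Defs
begin

section \<open>Configurations and multiplicative functionals\<close>

text \<open>The obstacle is the law of the observations: the hidden points carry an arbitrary
  numbering, independent of the errors, and only counts generate the sigma-algebra. With functionals
  the likelihood ratio need not be derived, only checked, since it is itself a product over points;
  so is its square root, which makes the affinity one more value of the functional. The constants
  come from three demands on s: membership in the class, a positive lower bound, and closeness of
  neighbours. Assumption (ii) bounds the variance term at k*_n by \<eta> times omega/gamma there,
  hence the sum of gamma_j/alpha_j over |j| <= k by n \<eta>. With Cauchy-Schwarz, the first entry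
  of \<zeta> settles the first two demands through s^2 n \<eta> \<Gamma> <= r/8. The second entry
  sets n times the squared distance against the lower bound \<delta> sqrt r. Assumption (ii) is used
  once more to compare Psi_n with the variance term, which produces the 1/\<eta> of the
  bound.\<close>

lemma space_config_space: "space config_space = {N. set_mset N \<subseteq> {0..<1}}"
  unfolding config_space_def by (rule space_measure_of) auto

lemma sets_config_space:
  "sets config_space = sigma_sets {N. set_mset N \<subseteq> {0..<1}}
     {{N. set_mset N \<subseteq> {0..<1} \<and> count_in N B = k} | B k. B \<in> sets borel \<and> B \<subseteq> {0..<1}}"
  unfolding config_space_def by (rule sets_measure_of) auto

lemma measurable_count_in:
  assumes "B \<in> sets borel" "B \<subseteq> {0..<1}"
  shows "(\<lambda>N. count_in N B) \<in> measurable config_space (count_space UNIV)"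
proof (rule measurableI; (simp; fail)?)
  fix A :: "nat set"
  have *: "(\<lambda>N. count_in N B) -` {k} \<inter> space config_space \<in> sets config_space" for k
  proof -
    have "(\<lambda>N. count_in N B) -` {k} \<inter> space config_space
        = {N. set_mset N \<subseteq> {0..<1} \<and> count_in N B = k}"
      by (auto simp: space_config_space)
    also have "\<dots> \<in> sets config_space"
      unfolding sets_config_space using assms by (intro sigma_sets.Basic) blast
    finally show ?thesis .
  qed
  have "(\<lambda>N. count_in N B) -` A \<inter> space config_space
      = (\<Union>k\<in>A. (\<lambda>N. count_in N B) -` {k} \<inter> space config_space)"
    by auto
  also have "\<dots> \<in> sets config_space"
    using * by (intro sets.countable_UN'') auto
  finally show "(\<lambda>N. count_in N B) -` A \<inter> space config_space \<in> sets config_space" .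
qed

text \<open>The expectation of this product is the probability generating functional of a point
  process; points are counted with multiplicity.\<close>

definition point_prod :: "(real \<Rightarrow> real) \<Rightarrow> real multiset \<Rightarrow> real" where
  "point_prod \<phi> N = (\<Prod>x\<in>#N. \<phi> x)"

lemma point_prod_simps [simp]:
  "point_prod \<phi> {#} = 1" "point_prod \<phi> (add_mset x N) = \<phi> x * point_prod \<phi> N"
  by (simp_all add: point_prod_def)

lemma point_prod_mult: "point_prod \<phi> N * point_prod \<psi> N = point_prod (\<lambda>x. \<phi> x * \<psi> x) N"
  by (simp add: point_prod_def prod_mset.distrib)

lemma point_prod_nonneg: "(\<And>x. 0 \<le> \<phi> x) \<Longrightarrow> 0 \<le> point_prod \<phi> N"
  by (induction N) auto

lemma point_prod_mono:
  "(\<And>x. 0 \<le> \<phi> x) \<Longrightarrow> (\<And>x. \<phi> x \<le> \<psi> x) \<Longrightarrow> point_prod \<phi> N \<le> point_prod \<psi> N"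
proof (induction N)
  case (add x N)
  moreover have "0 \<le> \<psi> x" using add.prems order_trans by blast
  ultimately show ?case by (auto intro!: mult_mono point_prod_nonneg)
qed simp

lemma point_prod_le_1:
  "(\<And>x. 0 \<le> \<phi> x) \<Longrightarrow> (\<And>x. \<phi> x \<le> 1) \<Longrightarrow> point_prod \<phi> N \<le> 1"
  by (induction N) (auto intro!: mult_le_one point_prod_nonneg)

lemma point_prod_const: "point_prod (\<lambda>_. c) N = c ^ size N"
  by (simp add: point_prod_def)

lemma point_prod_point_config: "point_prod \<phi> (point_config k x) = (\<Prod>j<k. \<phi> (x j))"
  by (simp add: point_prod_def point_config_def prod_unfold_prod_mset image_mset.compositionality o_def)

lemma tendsto_point_prod:
  "(\<And>x. (\<lambda>p. \<phi> p x) \<longlonglongrightarrow> \<psi> x) \<Longrightarrow> (\<lambda>p. point_prod (\<phi> p) N) \<longlonglongrightarrow> point_prod \<psi> N"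
  by (induction N) (auto intro!: tendsto_intros)

text \<open>A test function with finitely many values groups the points by level sets, so the
  product depends on the configuration only through counts, the quantities that the sigma-algebra
  and the Poisson property control.\<close>

lemma point_prod_step:
  fixes h :: "real \<Rightarrow> nat"
  assumes "set_mset N \<subseteq> {0..<1}" "\<And>x. x \<in># N \<Longrightarrow> h x < q"
  shows "point_prod (\<lambda>x. c (h x)) N = (\<Prod>i<q. c i ^ count_in N {x\<in>{0..<1}. h x = i})"
  using assms
proof (induction N)
  case empty then show ?case by (simp add: count_in_def)
next
  case (add y N)
  have "count_in (add_mset y N) {x\<in>{0..<1}. h x = i}
      = (if i = h y then 1 else 0) + count_in N {x\<in>{0..<1}. h x = i}" for i
    using add.prems by (auto simp: count_in_def)
  then have "(\<Prod>i<q. c i ^ count_in (add_mset y N) {x\<in>{0..<1}. h x = i})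
      = (\<Prod>i<q. (if i = h y then c i else 1) * c i ^ count_in N {x\<in>{0..<1}. h x = i})"
    by (intro prod.cong) (auto simp: power_add)
  also have "\<dots> = c (h y) * (\<Prod>i<q. c i ^ count_in N {x\<in>{0..<1}. h x = i})"
    using add.prems by (simp add: prod.distrib prod.delta)
  finally show ?case using add by simp
qed

section \<open>Dyadic approximation of test functions from below\<close>

definition dyadic_index :: "(real \<Rightarrow> real) \<Rightarrow> nat \<Rightarrow> real \<Rightarrow> nat" where
  "dyadic_index \<phi> p x = nat \<lfloor>2 ^ p * \<phi> x\<rfloor>"

lemma measurable_dyadic_index [measurable]:
  "\<phi> \<in> borel_measurable borel \<Longrightarrow> dyadic_index \<phi> p \<in> measurable borel (count_space UNIV)"
  unfolding dyadic_index_def by measurable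

lemma dyadic_index_less:
  assumes "0 \<le> \<phi> x" "\<phi> x \<le> C"
  shows "dyadic_index \<phi> p x < Suc (nat \<lfloor>2 ^ p * C\<rfloor>)"
  unfolding dyadic_index_def using assms by (auto simp: less_Suc_eq_le intro!: nat_mono floor_mono)

lemma dyadic_bounds:
  assumes "0 \<le> \<phi> x"
  shows "real (dyadic_index \<phi> p x) / 2 ^ p \<le> \<phi> x"
    and "\<phi> x - 1 / 2 ^ p \<le> real (dyadic_index \<phi> p x) / 2 ^ p"
proof -
  have *: "real (dyadic_index \<phi> p x) = of_int \<lfloor>2 ^ p * \<phi> x\<rfloor>"
    using assms by (simp add: dyadic_index_def)
  have "of_int \<lfloor>2 ^ p * \<phi> x\<rfloor> \<le> 2 ^ p * \<phi> x" by linarith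
  then show "real (dyadic_index \<phi> p x) / 2 ^ p \<le> \<phi> x" by (simp add: * field_simps)
  have "2 ^ p * \<phi> x - 1 \<le> of_int \<lfloor>2 ^ p * \<phi> x\<rfloor>" by linarith
  then have "(2 ^ p * \<phi> x - 1) / 2 ^ p \<le> of_int \<lfloor>2 ^ p * \<phi> x\<rfloor> / 2 ^ p"
    by (intro divide_right_mono) auto
  then show "\<phi> x - 1 / 2 ^ p \<le> real (dyadic_index \<phi> p x) / 2 ^ p"
    by (simp add: * diff_divide_distrib)
qed

lemma dyadic_tendsto:
  assumes "0 \<le> \<phi> x"
  shows "(\<lambda>p. real (dyadic_index \<phi> p x) / 2 ^ p) \<longlonglongrightarrow> \<phi> x"
proof (rule tendsto_sandwich)
  have "(\<lambda>p. (1/2) ^ p :: real) \<longlonglongrightarrow> 0" by (rule LIMSEQ_realpow_zero) auto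
  then have "(\<lambda>p. \<phi> x - 1 / 2 ^ p) \<longlonglongrightarrow> \<phi> x - 0"
    by (intro tendsto_diff) (auto simp: power_one_over)
  then show "(\<lambda>p. \<phi> x - 1 / 2 ^ p) \<longlonglongrightarrow> \<phi> x" by simp
qed (use dyadic_bounds[of \<phi> x, OF assms] in auto)

lemma measurable_point_prod_step:
  fixes h :: "real \<Rightarrow> nat"
  assumes [measurable]: "h \<in> measurable borel (count_space UNIV)" and "\<And>x. h x < q"
  shows "point_prod (\<lambda>x. c (h x)) \<in> borel_measurable config_space"
proof -
  have "(\<lambda>N. \<Prod>i<q. c i ^ count_in N {x\<in>{0..<1}. h x = i}) \<in> borel_measurable config_space"
  proof (intro borel_measurable_prod)
    fix i assume "i \<in> {..<q}"
    have "{x\<in>{0..<1::real}. h x = i} = {x\<in>space borel. 0 \<le> x \<and> x < 1 \<and> h x = i}" by auto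
    also have "\<dots> \<in> sets borel" by measurable
    finally have "(\<lambda>N. count_in N {x\<in>{0..<1}. h x = i}) \<in> measurable config_space (count_space UNIV)"
      by (intro measurable_count_in) auto
    then show "(\<lambda>N. c i ^ count_in N {x\<in>{0..<1}. h x = i}) \<in> borel_measurable config_space"
      by (rule measurable_compose) simp
  qed
  moreover have "point_prod (\<lambda>x. c (h x)) N = (\<Prod>i<q. c i ^ count_in N {x\<in>{0..<1}. h x = i})"
    if "N \<in> space config_space" for N
    using that assms(2) by (intro point_prod_step) (auto simp: space_config_space)
  ultimately show ?thesis
    by (subst measurable_cong) auto
qed

text \<open>Boundedness gives every dyadic approximation finitely many levels, hence a measurable
  product; the products converge pointwise because a configuration is finite.\<close>

lemma measurable_point_prod:
  assumes [measurable]: "\<phi> \<in> borel_measurable borel" and \<phi>: "\<And>x. 0 \<le> \<phi> x" "\<And>x. \<phi> x \<le> C"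
  shows "point_prod \<phi> \<in> borel_measurable config_space"
proof (rule borel_measurable_LIMSEQ_real)
  show "(\<lambda>p. point_prod (\<lambda>x. real (dyadic_index \<phi> p x) / 2 ^ p) N) \<longlonglongrightarrow> point_prod \<phi> N" for N
    by (intro tendsto_point_prod dyadic_tendsto \<phi>)
  show "(\<lambda>N. point_prod (\<lambda>x. real (dyadic_index \<phi> p x) / 2 ^ p) N) \<in> borel_measurable config_space" for p
    by (rule measurable_point_prod_step[where c="\<lambda>i. real i / 2 ^ p"])
      (auto intro!: dyadic_index_less \<phi>)
qed

section \<open>The generating functional of a Poisson process\<close>

lemma nn_integral_nat_valued:
  fixes g :: "nat \<Rightarrow> ennreal"
  assumes [measurable]: "X \<in> measurable M (count_space UNIV)"
  shows "(\<integral>\<^sup>+w. g (X w) \<partial>M) = (\<Sum>k. g k * emeasure M {w\<in>space M. X w = k})"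
proof -
  have "(\<integral>\<^sup>+w. g (X w) \<partial>M) = (\<integral>\<^sup>+w. (\<Sum>k. g k * indicator {w\<in>space M. X w = k} w) \<partial>M)"
  proof (rule nn_integral_cong)
    fix w assume "w \<in> space M"
    then have "(\<Sum>k. g k * indicator {w\<in>space M. X w = k} w) = (\<Sum>k\<in>{X w}. g k)"
      by (subst suminf_finite[where N="{X w}"]) (auto simp: indicator_def)
    then show "g (X w) = (\<Sum>k. g k * indicator {w\<in>space M. X w = k} w)" by simp
  qed
  also have "\<dots> = (\<Sum>k. \<integral>\<^sup>+w. g k * indicator {w\<in>space M. X w = k} w \<partial>M)"
    by (rule nn_integral_suminf) measurable
  also have "\<dots> = (\<Sum>k. g k * emeasure M {w\<in>space M. X w = k})"
    by (intro suminf_cong nn_integral_cmult_indicator) measurable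
  finally show ?thesis .
qed

context prob_space
begin

lemma poisson_generating_function:
  assumes [measurable]: "X \<in> measurable M (count_space UNIV)"
    and X: "\<And>k. measure M {w\<in>space M. X w = k} = a ^ k / fact k * exp (- a)"
    and "0 \<le> a" "0 \<le> c"
  shows "(\<integral>\<^sup>+w. ennreal (c ^ X w) \<partial>M) = ennreal (exp ((c - 1) * a))"
proof -
  have "(\<integral>\<^sup>+w. ennreal (c ^ X w) \<partial>M) = (\<Sum>k. ennreal (c ^ k) * emeasure M {w\<in>space M. X w = k})"
    by (rule nn_integral_nat_valued) measurable
  also have "\<dots> = (\<Sum>k. ennreal (((c * a) ^ k /\<^sub>R fact k) * exp (- a)))"
    using assms(3,4)
    by (intro suminf_cong) (simp add: emeasure_eq_measure X ennreal_mult'' [symmetric] field_simps)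
  also have "\<dots> = ennreal (exp (c * a) * exp (- a))"
    using assms(3,4) by (intro suminf_ennreal_eq sums_mult2 exp_converges) auto
  also have "exp (c * a) * exp (- a) = exp ((c - 1) * a)"
    by (simp add: mult_exp_exp algebra_simps)
  finally show ?thesis .
qed

lemma poisson_processD:
  assumes "poisson_process M lam N"
  shows "N \<in> measurable M config_space"
    and "\<And>B k. B \<in> sets borel \<Longrightarrow> B \<subseteq> {0..<1} \<Longrightarrow>
      measure M {w \<in> space M. count_in (N w) B = k} =
        (LINT t:B|lborel. lam t) ^ k / fact k * exp (- (LINT t:B|lborel. lam t))"
    and "\<And>(B :: nat \<Rightarrow> real set) p. (\<And>i. i < p \<Longrightarrow> B i \<in> sets borel) \<Longrightarrow>
      (\<And>i. i < p \<Longrightarrow> B i \<subseteq> {0..<1}) \<Longrightarrow> disjoint_family_on B {..<p} \<Longrightarrow>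
      indep_vars (\<lambda>_. count_space UNIV) (\<lambda>i w. count_in (N w) (B i)) {..<p}"
  using assms unfolding poisson_process_def by simp_all

text \<open>The level sets of \<open>h\<close> are disjoint, so the counts on them are independent
  and the expectation splits into one-dimensional Poisson generating functions, whose exponents add
  up to one integral.\<close>

lemma poisson_process_step:
  fixes h :: "real \<Rightarrow> nat"
  assumes N: "poisson_process M lam N"
    and lam [measurable]: "lam \<in> borel_measurable borel"
    and lam_nonneg: "\<And>t. 0 \<le> lam t"
    and lam_int: "set_integrable lborel {0..<1} lam"
    and h [measurable]: "h \<in> measurable borel (count_space UNIV)" and hq: "\<And>x. h x < q"
    and c: "\<And>i. 0 \<le> c i"
  shows "(\<integral>\<^sup>+w. ennreal (point_prod (\<lambda>x. c (h x)) (N w)) \<partial>M)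
    = ennreal (exp (LINT t:{0..<1}|lborel. (c (h t) - 1) * lam t))"
proof -
  let ?B = "\<lambda>i. {x\<in>{0..<1::real}. h x = i}"
  have B: "?B i \<in> sets borel" "?B i \<subseteq> {0..<1}" for i
  proof -
    have "?B i = {x\<in>space borel. 0 \<le> x \<and> x < 1 \<and> h x = i}" by auto
    also have "\<dots> \<in> sets borel" by measurable
    finally show "?B i \<in> sets borel" .
  qed auto
  have disj: "disjoint_family_on ?B {..<q}" by (auto simp: disjoint_family_on_def)
  have Nm: "N \<in> measurable M config_space"
    and cnt: "measure M {w \<in> space M. count_in (N w) (?B i) = k} =
          (LINT t:?B i|lborel. lam t) ^ k / fact k * exp (- (LINT t:?B i|lborel. lam t))" for i k
    using poisson_processD(1)[OF N] poisson_processD(2)[OF N B] .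
  have ind: "indep_vars (\<lambda>_. count_space UNIV) (\<lambda>i w. count_in (N w) (?B i)) {..<q}"
    by (rule poisson_processD(3)[OF N B disj])
  have cm [measurable]: "(\<lambda>w. count_in (N w) (?B i)) \<in> measurable M (count_space UNIV)" for i
    using measurable_compose[OF Nm measurable_count_in[OF B]] .
  have "(\<integral>\<^sup>+w. ennreal (point_prod (\<lambda>x. c (h x)) (N w)) \<partial>M)
      = (\<integral>\<^sup>+w. (\<Prod>i<q. ennreal (c i ^ count_in (N w) (?B i))) \<partial>M)"
  proof (rule nn_integral_cong)
    fix w assume "w \<in> space M"
    then have "set_mset (N w) \<subseteq> {0..<1}"
      using measurable_space[OF Nm] by (auto simp: space_config_space)
    then show "ennreal (point_prod (\<lambda>x. c (h x)) (N w))
        = (\<Prod>i<q. ennreal (c i ^ count_in (N w) (?B i)))"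
      using hq c by (subst point_prod_step[where q=q]) (auto simp: prod_ennreal)
  qed
  also have "\<dots> = (\<Prod>i<q. \<integral>\<^sup>+w. ennreal (c i ^ count_in (N w) (?B i)) \<partial>M)"
    by (intro indep_vars_nn_integral
        indep_vars_compose2[where Y="\<lambda>i k. ennreal (c i ^ k)", OF ind]) auto
  also have "\<dots> = (\<Prod>i<q. ennreal (exp ((c i - 1) * (LINT t:?B i|lborel. lam t))))"
    using lam_nonneg
    by (intro prod.cong refl poisson_generating_function cm cnt c)
      (auto simp: set_lebesgue_integral_def intro!: integral_nonneg)
  also have "\<dots> = ennreal (exp (\<Sum>i<q. (c i - 1) * (LINT t:?B i|lborel. lam t)))"
    by (simp add: prod_ennreal exp_sum)
  also have "(\<Sum>i<q. (c i - 1) * (LINT t:?B i|lborel. lam t))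
      = (LINT t:{0..<1}|lborel. (c (h t) - 1) * lam t)"
  proof -
    have *: "set_integrable lborel (?B i) lam" for i
      using lam_int by (rule set_integrable_subset) (use B[of i] in auto)
    have "(\<Sum>i<q. (c i - 1) * (LINT t:?B i|lborel. lam t))
        = (LINT t|lborel. (\<Sum>i<q. (c i - 1) * (indicator (?B i) t * lam t)))"
      using * by (subst Bochner_Integration.integral_sum)
        (auto simp: set_lebesgue_integral_def set_integrable_def)
    also have "\<dots> = (LINT t:{0..<1}|lborel. (c (h t) - 1) * lam t)"
      unfolding set_lebesgue_integral_def
    proof (rule Bochner_Integration.integral_cong[OF refl])
      fix t
      have "(\<Sum>i<q. (c i - 1) * (indicator (?B i) t * lam t))
          = (\<Sum>i<q. if i = h t then (c i - 1) * (indicator {0..<1} t * lam t) else 0)"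
        by (intro sum.cong) (auto simp: indicator_def)
      then show "(\<Sum>i<q. (c i - 1) * (indicator (?B i) t * lam t))
          = indicat_real {0..<1} t *\<^sub>R ((c (h t) - 1) * lam t)"
        using hq[of t] by simp
    qed
    finally show ?thesis .
  qed
  finally show ?thesis .
qed

text \<open>Dominated convergence on both sides extends the step case. The bound \<open>C\<close>
  may exceed 1, as it must for likelihood ratios.\<close>

lemma poisson_process_generating_functional:
  assumes N: "poisson_process M lam N"
    and lam [measurable]: "lam \<in> borel_measurable borel"
    and lam_nonneg: "\<And>t. 0 \<le> lam t"
    and lam_int: "set_integrable lborel {0..<1} lam"
    and \<phi> [measurable]: "\<phi> \<in> borel_measurable borel" and \<phi>_bounds: "\<And>x. 0 \<le> \<phi> x" "\<And>x. \<phi> x \<le> C"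
  shows "(\<integral>\<^sup>+w. ennreal (point_prod \<phi> (N w)) \<partial>M)
    = ennreal (exp (LINT t:{0..<1}|lborel. (\<phi> t - 1) * lam t))"
proof -
  define \<psi> where "\<psi> p x = real (dyadic_index \<phi> p x) / 2 ^ p" for p x
  have [measurable]: "\<psi> p \<in> borel_measurable borel" for p unfolding \<psi>_def by measurable
  have \<psi>: "0 \<le> \<psi> p x" "\<psi> p x \<le> \<phi> x" "(\<lambda>p. \<psi> p x) \<longlonglongrightarrow> \<phi> x" for p x
    using \<phi>_bounds by (auto simp: \<psi>_def intro!: dyadic_bounds dyadic_tendsto)
  have Nm [measurable]: "N \<in> measurable M config_space" using N by (simp add: poisson_process_def)
  have C: "0 \<le> C" using \<phi>_bounds order_trans by blast
  have step: "(\<integral>\<^sup>+w. ennreal (point_prod (\<psi> p) (N w)) \<partial>M)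
    = ennreal (exp (LINT t:{0..<1}|lborel. (\<psi> p t - 1) * lam t))" for p
    unfolding \<psi>_def
    by (rule poisson_process_step[OF N lam lam_nonneg lam_int, where c="\<lambda>i. real i / 2 ^ p"])
      (auto intro!: dyadic_index_less \<phi>_bounds)
  have mp [measurable]: "point_prod (\<psi> p) \<in> borel_measurable config_space" for p
    by (rule measurable_point_prod[where C=C]) (use \<psi> \<phi>_bounds order_trans in \<open>auto, blast\<close>)
  have mphi [measurable]: "point_prod \<phi> \<in> borel_measurable config_space"
    by (rule measurable_point_prod[where C=C]) (use \<phi>_bounds in auto)
  have mC [measurable]: "point_prod (\<lambda>_. C) \<in> borel_measurable config_space"
    by (rule measurable_point_prod[where C=C]) (use C in auto)
  \<comment> \<open>The dominating variable is \<open>C\<close> to the number of points; the step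
    case with a single level shows that its expectation is finite.\<close>
  have finC: "(\<integral>\<^sup>+w. ennreal (point_prod (\<lambda>_. C) (N w)) \<partial>M) < \<infinity>"
  proof -
    have "(\<integral>\<^sup>+w. ennreal (point_prod (\<lambda>x. (\<lambda>_. C) ((\<lambda>_. 0) x)) (N w)) \<partial>M)
      = ennreal (exp (LINT t:{0..<1}|lborel. ((\<lambda>_. C) ((\<lambda>_. 0::nat) t) - 1) * lam t))"
      by (rule poisson_process_step[OF N lam lam_nonneg lam_int, where q=1]) (use C in auto)
    then show ?thesis by simp
  qed
  have "(\<lambda>p. \<integral>\<^sup>+w. ennreal (point_prod (\<psi> p) (N w)) \<partial>M)
      \<longlonglongrightarrow> (\<integral>\<^sup>+w. ennreal (point_prod \<phi> (N w)) \<partial>M)"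
  proof (rule nn_integral_dominated_convergence[OF _ _ _ _ finC])
    show "AE w in M. ennreal (point_prod (\<psi> p) (N w)) \<le> ennreal (point_prod (\<lambda>_. C) (N w))" for p
      by (intro AE_I2 ennreal_leI point_prod_mono) (use \<psi> \<phi>_bounds order_trans in \<open>auto, blast\<close>)
    show "AE w in M. (\<lambda>p. ennreal (point_prod (\<psi> p) (N w))) \<longlonglongrightarrow> ennreal (point_prod \<phi> (N w))"
      by (intro AE_I2 tendsto_ennrealI tendsto_point_prod \<psi>)
  qed auto
  moreover have "(\<lambda>p. \<integral>\<^sup>+w. ennreal (point_prod (\<psi> p) (N w)) \<partial>M)
      \<longlonglongrightarrow> ennreal (exp (LINT t:{0..<1}|lborel. (\<phi> t - 1) * lam t))"
    unfolding step set_lebesgue_integral_def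
  proof (intro tendsto_ennrealI tendsto_exp, rule integral_dominated_convergence)
    show "integrable lborel (\<lambda>t. (C + 1) * (indicator {0..<1} t * lam t))"
      using lam_int by (simp add: set_integrable_def)
    show "AE t in lborel. (\<lambda>p. indicat_real {0..<1} t *\<^sub>R ((\<psi> p t - 1) * lam t))
        \<longlonglongrightarrow> indicat_real {0..<1} t *\<^sub>R ((\<phi> t - 1) * lam t)"
      by (intro AE_I2 tendsto_intros \<psi>)
    show "AE t in lborel. norm (indicat_real {0..<1} t *\<^sub>R ((\<psi> p t - 1) * lam t))
        \<le> (C + 1) * (indicator {0..<1} t * lam t)" for p
    proof (rule AE_I2)
      fix t
      have "\<bar>\<psi> p t - 1\<bar> \<le> C + 1"
        using \<psi>(1)[of p t] \<psi>(2)[of p t] \<phi>_bounds(2)[of t] C by linarith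
      then show "norm (indicat_real {0..<1} t *\<^sub>R ((\<psi> p t - 1) * lam t))
        \<le> (C + 1) * (indicator {0..<1} t * lam t)"
        using lam_nonneg[of t] by (auto simp: indicator_def abs_mult intro: mult_right_mono)
    qed
  qed measurable
  ultimately show ?thesis by (rule LIMSEQ_unique)
qed

end

section \<open>The generating functional of the observed processes\<close>

lemma borel_measurable_frac [measurable (raw)]:
  fixes g :: "'a \<Rightarrow> real"
  assumes [measurable]: "g \<in> borel_measurable M"
  shows "(\<lambda>w. frac (g w)) \<in> borel_measurable M"
  unfolding frac_def by measurable

context prob_space
begin

text \<open>Both marginals are finite, so the product formula on rectangles determines the joint
  law.\<close>

lemma indep_elements_distr:
  assumes "indep_elements M A X B Z"
  shows "distr M (A \<Otimes>\<^sub>M B) (\<lambda>w. (X w, Z w)) = distr M A X \<Otimes>\<^sub>M distr M B Z"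
proof -
  have X [measurable]: "X \<in> measurable M A" and Z [measurable]: "Z \<in> measurable M B"
    and ind: "indep_set {X -` S \<inter> space M | S. S \<in> sets A} {Z -` S \<inter> space M | S. S \<in> sets B}"
    using assms unfolding indep_elements_def by auto
  interpret X: prob_space "distr M A X" by (rule prob_space_distr) fact
  interpret Z: prob_space "distr M B Z" by (rule prob_space_distr) fact
  show ?thesis
  proof (rule pair_measure_eqI[symmetric])
    show "sigma_finite_measure (distr M A X)" "sigma_finite_measure (distr M B Z)" by unfold_locales
    show "sets (distr M A X \<Otimes>\<^sub>M distr M B Z) = sets (distr M (A \<Otimes>\<^sub>M B) (\<lambda>w. (X w, Z w)))"
      by (simp cong: sets_pair_measure_cong)
    fix S T assume "S \<in> sets (distr M A X)" "T \<in> sets (distr M B Z)"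
    then have [measurable]: "S \<in> sets A" "T \<in> sets B" by auto
    have "prob ((X -` S \<inter> space M) \<inter> (Z -` T \<inter> space M)) = prob (X -` S \<inter> space M) * prob (Z -` T \<inter> space M)"
      by (rule indep_setD[OF ind]) auto
    moreover have "(X -` S \<inter> space M) \<inter> (Z -` T \<inter> space M) = (\<lambda>w. (X w, Z w)) -` (S \<times> T) \<inter> space M"
      by auto
    ultimately show "emeasure (distr M A X) S * emeasure (distr M B Z) T
        = emeasure (distr M (A \<Otimes>\<^sub>M B) (\<lambda>w. (X w, Z w))) (S \<times> T)"
      by (simp add: emeasure_distr emeasure_eq_measure ennreal_mult)
  qed
qed

text \<open>The inner integral runs over a second sample point \<open>v\<close> that enters through
  \<open>Z\<close> alone, so \<open>X w\<close> is frozen while \<open>Z\<close> is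
  averaged.\<close>

lemma indep_elements_nn_integral:
  assumes ind: "indep_elements M A X B Z" and [measurable]: "G \<in> borel_measurable (A \<Otimes>\<^sub>M B)"
  shows "(\<integral>\<^sup>+w. G (X w, Z w) \<partial>M) = (\<integral>\<^sup>+w. (\<integral>\<^sup>+v. G (X w, Z v) \<partial>M) \<partial>M)"
proof -
  have X [measurable]: "X \<in> measurable M A" and Z [measurable]: "Z \<in> measurable M B"
    using ind unfolding indep_elements_def by auto
  interpret Z: prob_space "distr M B Z" by (rule prob_space_distr) fact
  have "(\<integral>\<^sup>+w. G (X w, Z w) \<partial>M) = (\<integral>\<^sup>+p. G p \<partial>(distr M A X \<Otimes>\<^sub>M distr M B Z))"
    unfolding indep_elements_distr[OF ind, symmetric] by (subst nn_integral_distr) auto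
  also have "\<dots> = (\<integral>\<^sup>+a. \<integral>\<^sup>+b. G (a, b) \<partial>distr M B Z \<partial>distr M A X)"
  proof (rule Z.nn_integral_fst[symmetric])
    show "G \<in> borel_measurable (distr M A X \<Otimes>\<^sub>M distr M B Z)"
      using assms(2) by (simp cong: measurable_cong_sets sets_pair_measure_cong)
  qed
  also have "\<dots> = (\<integral>\<^sup>+w. \<integral>\<^sup>+b. G (X w, b) \<partial>distr M B Z \<partial>M)"
    by (subst nn_integral_distr) (auto intro!: Z.borel_measurable_nn_integral)
  also have "\<dots> = (\<integral>\<^sup>+w. (\<integral>\<^sup>+v. G (X w, Z v) \<partial>M) \<partial>M)"
    by (intro nn_integral_cong) (subst nn_integral_distr, auto)
  finally show ?thesis .
qed

end

section \<open>Rotation invariance of the circle\<close>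

lemma nn_integral_periodic:
  fixes g :: "real \<Rightarrow> ennreal"
  assumes [measurable]: "g \<in> borel_measurable borel" and per: "\<And>x. g (x + 1) = g x"
  shows "(\<integral>\<^sup>+x. indicator {0..<1} x * g (x + e) \<partial>lborel) = (\<integral>\<^sup>+x. indicator {0..<1} x * g x \<partial>lborel)"
proof -
  have per_int: "g (x + of_int k) = g x" for x k
  proof (induction k rule: int_induct[where k=0])
    case (step1 i) then show ?case using per[of "x + of_int i"] by (simp add: add.assoc)
  next
    case (step2 i) then show ?case using per[of "x + of_int i - 1"] by (simp add: algebra_simps)
  qed simp
  \<comment> \<open>Only the fractional part of the shift matters; the window from \<theta> to
    \<theta> + 1 is cut at 1 and its right piece moved back by one period.\<close>
  define \<theta> where "\<theta> = frac e"
  have \<theta>: "0 \<le> \<theta>" "\<theta> < 1" by (simp_all add: \<theta>_def frac_lt_1)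
  have shift: "(\<integral>\<^sup>+x. u (x + c) \<partial>lborel) = (\<integral>\<^sup>+x. u x \<partial>lborel)"
    if [measurable]: "u \<in> borel_measurable borel" for u :: "real \<Rightarrow> ennreal" and c
    by (subst (2) nn_integral_real_affine[where c=1 and t=c]) (auto simp: add.commute)
  have "(\<integral>\<^sup>+x. indicator {0..<1} x * g (x + e) \<partial>lborel) = (\<integral>\<^sup>+x. indicator {\<theta>..<\<theta>+1} (x + \<theta>) * g (x + \<theta>) \<partial>lborel)"
  proof (rule nn_integral_cong)
    fix x
    have "g (x + e) = g (x + \<theta>)"
      using per_int[of "x + \<theta>" "\<lfloor>e\<rfloor>"] by (simp add: \<theta>_def frac_def)
    then show "indicator {0..<1} x * g (x + e) = indicator {\<theta>..<\<theta>+1} (x + \<theta>) * g (x + \<theta>)"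
      by (simp add: indicator_def)
  qed
  also have "\<dots> = (\<integral>\<^sup>+x. indicator {\<theta>..<\<theta>+1} x * g x \<partial>lborel)"
    by (rule shift[of "\<lambda>x. indicator {\<theta>..<\<theta>+1} x * g x"]) measurable
  also have "\<dots> = (\<integral>\<^sup>+x. indicator {\<theta>..<1} x * g x + indicator {1..<\<theta>+1} x * g x \<partial>lborel)"
    using \<theta> by (intro nn_integral_cong) (auto simp: indicator_def)
  also have "\<dots> = (\<integral>\<^sup>+x. indicator {\<theta>..<1} x * g x \<partial>lborel) + (\<integral>\<^sup>+x. indicator {1..<\<theta>+1} x * g x \<partial>lborel)"
    by (intro nn_integral_add) measurable
  also have "(\<integral>\<^sup>+x. indicator {1..<\<theta>+1} x * g x \<partial>lborel) = (\<integral>\<^sup>+x. indicator {1..<\<theta>+1} (x + 1) * g (x + 1) \<partial>lborel)"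
    by (rule shift[of "\<lambda>x. indicator {1..<\<theta>+1} x * g x", symmetric]) measurable
  also have "\<dots> = (\<integral>\<^sup>+x. indicator {0..<\<theta>} x * g x \<partial>lborel)"
    by (intro nn_integral_cong) (auto simp: indicator_def per)
  also have "(\<integral>\<^sup>+x. indicator {\<theta>..<1} x * g x \<partial>lborel) + \<dots>
      = (\<integral>\<^sup>+x. indicator {\<theta>..<1} x * g x + indicator {0..<\<theta>} x * g x \<partial>lborel)"
    by (intro nn_integral_add[symmetric]) measurable
  also have "\<dots> = (\<integral>\<^sup>+x. indicator {0..<1} x * g x \<partial>lborel)"
    using \<theta> by (intro nn_integral_cong) (auto simp: indicator_def)
  finally show ?thesis .
qed

lemma bounded_set_integrable_banach:
  fixes g :: "real \<Rightarrow> 'b :: {banach, second_countable_topology}"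
  assumes [measurable]: "g \<in> borel_measurable borel" and "\<And>x. norm (g x) \<le> C"
  shows "set_integrable lborel {0..<1::real} g"
  unfolding set_integrable_def
proof (rule Bochner_Integration.integrable_bound)
  show "integrable lborel (\<lambda>x. C * indicator {0..<1::real} x)"
    by (intro integrable_mult_right integrable_real_indicator) auto
  show "AE x in lborel. norm (indicat_real {0..<1} x *\<^sub>R g x) \<le> norm (C * indicat_real {0..<1} x)"
    using assms(2) by (intro AE_I2) (auto simp: indicator_def intro: order_trans[OF assms(2) abs_ge_self])
qed measurable

lemma bounded_set_integrable:
  assumes "g \<in> borel_measurable borel" and "\<And>x. \<bar>g x\<bar> \<le> (C::real)"
  shows "set_integrable lborel {0..<1::real} g"
  using assms by (intro bounded_set_integrable_banach[where C=C]) auto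

text \<open>The error density of the model is constrained only almost everywhere on the unit
  interval; a version of it, non-negative everywhere on the line, will instantiate this
  locale.\<close>

locale real_density =
  fixes f :: "real \<Rightarrow> real"
  assumes f_measurable [measurable]: "f \<in> borel_measurable borel"
    and f_nonneg: "0 \<le> f e"
    and f_total: "(\<integral>\<^sup>+e. ennreal (f e) \<partial>lborel) = 1"
begin

text \<open>The expectation of \<psi> at the displaced point, the true point \<open>x\<close> being
  given.\<close>

definition blur :: "(real \<Rightarrow> real) \<Rightarrow> real \<Rightarrow> real" where
  "blur \<psi> x = (LINT e|lborel. f e * \<psi> (frac (x + e)))"

text \<open>For \<open>lam\<close> of period 1 and a density vanishing off the unit interval this is
  the circular convolution: periodicity replaces the fractional part.\<close>

definition convolved :: "(real \<Rightarrow> real) \<Rightarrow> real \<Rightarrow> real" where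
  "convolved lam t = (LINT e|lborel. f e * lam (t - e))"

lemma f_integrable: "integrable lborel f"
  using f_total f_nonneg by (subst integrable_iff_bounded) auto

lemma f_integral: "(LINT e|lborel. f e) = 1"
  using f_total f_nonneg by (subst integral_eq_nn_integral) auto

lemma f_mult_integrable:
  fixes g :: "real \<Rightarrow> 'b :: {real_normed_algebra, banach, second_countable_topology}"
  assumes [measurable]: "g \<in> borel_measurable borel" and "\<And>x. norm (g x) \<le> C"
  shows "integrable lborel (\<lambda>e. f e *\<^sub>R g e)"
proof (rule Bochner_Integration.integrable_bound)
  show "integrable lborel (\<lambda>e. C * f e)" using f_integrable by simp
  have "0 \<le> C" using assms(2)[of 0] norm_ge_zero order_trans by blast
  then show "AE e in lborel. norm (f e *\<^sub>R g e) \<le> norm (C * f e)"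
    using assms(2) f_nonneg by (intro AE_I2) (auto intro!: mult_left_mono simp: mult.commute[of C])
qed measurable

lemma f_average_bounds:
  assumes [measurable]: "g \<in> borel_measurable borel" and g: "\<And>x. c \<le> g x" "\<And>x. g x \<le> C"
  shows "c \<le> (LINT e|lborel. f e * g e)" "(LINT e|lborel. f e * g e) \<le> C"
    and "integrable lborel (\<lambda>e. f e * g e)"
proof -
  have "norm (g x) \<le> \<bar>c\<bar> + \<bar>C\<bar>" for x using g[of x] by auto
  from f_mult_integrable[OF assms(1) this]
  show *: "integrable lborel (\<lambda>e. f e * g e)" by simp
  have "(LINT e|lborel. f e * c) \<le> (LINT e|lborel. f e * g e)"
    using * f_integrable f_nonneg g by (intro integral_mono) (auto intro!: mult_left_mono)
  then show "c \<le> (LINT e|lborel. f e * g e)" by (simp add: f_integral)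
  have "(LINT e|lborel. f e * g e) \<le> (LINT e|lborel. f e * C)"
    using * f_integrable f_nonneg g by (intro integral_mono) (auto intro!: mult_left_mono)
  then show "(LINT e|lborel. f e * g e) \<le> C" by (simp add: f_integral)
qed

lemma blur_measurable [measurable]:
  assumes [measurable]: "\<psi> \<in> borel_measurable borel"
  shows "blur \<psi> \<in> borel_measurable borel"
  unfolding blur_def by measurable

lemma convolved_measurable [measurable]:
  assumes [measurable]: "\<psi> \<in> borel_measurable borel"
  shows "convolved \<psi> \<in> borel_measurable borel"
  unfolding convolved_def by measurable

lemma blur_bounds:
  assumes [measurable]: "\<psi> \<in> borel_measurable borel" and "\<And>x. c \<le> \<psi> x" "\<And>x. \<psi> x \<le> C"
  shows "c \<le> blur \<psi> x" "blur \<psi> x \<le> C"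
  unfolding blur_def using assms by (auto intro!: f_average_bounds)

lemma convolved_bounds:
  assumes [measurable]: "lam \<in> borel_measurable borel" and "\<And>x. c \<le> lam x" "\<And>x. lam x \<le> C"
  shows "c \<le> convolved lam x" "convolved lam x \<le> C"
  unfolding convolved_def using assms by (auto intro!: f_average_bounds)

lemma ennreal_blur:
  assumes [measurable]: "\<psi> \<in> borel_measurable borel" and \<psi>: "\<And>x. 0 \<le> \<psi> x" "\<And>x. \<psi> x \<le> C"
  shows "ennreal (blur \<psi> x) = (\<integral>\<^sup>+e. ennreal (f e) * ennreal (\<psi> (frac (x + e))) \<partial>lborel)"
proof -
  have "ennreal (blur \<psi> x) = (\<integral>\<^sup>+e. ennreal (f e * \<psi> (frac (x + e))) \<partial>lborel)"
    unfolding blur_def using f_nonneg \<psi>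
    by (intro nn_integral_eq_integral[symmetric] f_average_bounds(3)) (auto intro!: AE_I2)
  then show ?thesis using f_nonneg \<psi> by (simp add: ennreal_mult)
qed

lemma ennreal_convolved:
  assumes [measurable]: "lam \<in> borel_measurable borel" and lam: "\<And>x. 0 \<le> lam x" "\<And>x. lam x \<le> C"
  shows "ennreal (convolved lam t) = (\<integral>\<^sup>+e. ennreal (f e) * ennreal (lam (t - e)) \<partial>lborel)"
proof -
  have "ennreal (convolved lam t) = (\<integral>\<^sup>+e. ennreal (f e * lam (t - e)) \<partial>lborel)"
    unfolding convolved_def using f_nonneg lam
    by (intro nn_integral_eq_integral[symmetric] f_average_bounds(3)) (auto intro!: AE_I2)
  then show ?thesis using f_nonneg lam by (simp add: ennreal_mult)
qed

text \<open>After exchanging the integrals, for a fixed error \<open>e\<close> the integrand at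
  \<open>t\<close> is the 1-periodic function
  \<open>\<lambda>y. \<psi> (frac y) * lam (y - e)\<close> taken at \<open>t + e\<close>; rotation
  invariance removes the shift. This is where the period of \<open>lam\<close> enters.\<close>

lemma blur_adjoint_nn:
  assumes [measurable]: "\<psi> \<in> borel_measurable borel" and \<psi>: "\<And>x. 0 \<le> \<psi> x" "\<And>x. \<psi> x \<le> C"
    and [measurable]: "lam \<in> borel_measurable borel" and lam: "\<And>x. 0 \<le> lam x" "\<And>x. lam x \<le> L"
    and per: "\<And>x. lam (x + 1) = lam x"
  shows "(\<integral>\<^sup>+t. indicator {0..<1} t * ennreal (blur \<psi> t * lam t) \<partial>lborel)
    = (\<integral>\<^sup>+t. indicator {0..<1} t * ennreal (\<psi> t * convolved lam t) \<partial>lborel)"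
proof -
  have b: "0 \<le> blur \<psi> t" "0 \<le> convolved lam t" for t
    using blur_bounds[of \<psi> 0 C] convolved_bounds[of lam 0 L] \<psi> lam by auto
  have "(\<integral>\<^sup>+t. indicator {0..<1} t * ennreal (blur \<psi> t * lam t) \<partial>lborel)
      = (\<integral>\<^sup>+t. \<integral>\<^sup>+e. ennreal (f e) * (indicator {0..<1} t * (ennreal (\<psi> (frac (t + e))) * ennreal (lam t))) \<partial>lborel \<partial>lborel)"
    using b lam
    by (intro nn_integral_cong)
      (simp add: ennreal_mult ennreal_blur[OF _ \<psi>] nn_integral_multc[symmetric] nn_integral_cmult[symmetric] mult_ac)
  also have "\<dots> = (\<integral>\<^sup>+e. \<integral>\<^sup>+t. ennreal (f e) * (indicator {0..<1} t * (ennreal (\<psi> (frac (t + e))) * ennreal (lam t))) \<partial>lborel \<partial>lborel)"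
    by (rule lborel_pair.Fubini') measurable
  also have "\<dots> = (\<integral>\<^sup>+e. \<integral>\<^sup>+t. ennreal (f e) * (indicator {0..<1} t * (ennreal (\<psi> t) * ennreal (lam (t - e)))) \<partial>lborel \<partial>lborel)"
  proof (rule nn_integral_cong)
    fix e
    have "(\<integral>\<^sup>+t. indicator {0..<1} t * (ennreal (\<psi> (frac (t + e))) * ennreal (lam t)) \<partial>lborel)
       = (\<integral>\<^sup>+t. indicator {0..<1} t * (\<lambda>y. ennreal (\<psi> (frac y)) * ennreal (lam (y - e))) (t + e) \<partial>lborel)"
      by simp
    also have "\<dots> = (\<integral>\<^sup>+t. indicator {0..<1} t * (\<lambda>y. ennreal (\<psi> (frac y)) * ennreal (lam (y - e))) t \<partial>lborel)"
    proof (rule nn_integral_periodic)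
      fix y :: real
      have "frac (y + 1) = frac y" by (simp add: frac_def)
      moreover have "lam (y + 1 - e) = lam (y - e)" using per[of "y - e"] by (simp add: algebra_simps)
      ultimately show "ennreal (\<psi> (frac (y + 1))) * ennreal (lam (y + 1 - e)) = ennreal (\<psi> (frac y)) * ennreal (lam (y - e))"
        by simp
    qed measurable
    also have "\<dots> = (\<integral>\<^sup>+t. indicator {0..<1} t * (ennreal (\<psi> t) * ennreal (lam (t - e))) \<partial>lborel)"
      by (intro nn_integral_cong) (auto simp: indicator_def frac_eq[THEN iffD2])
    finally show "(\<integral>\<^sup>+t. ennreal (f e) * (indicator {0..<1} t * (ennreal (\<psi> (frac (t + e))) * ennreal (lam t))) \<partial>lborel)
        = (\<integral>\<^sup>+t. ennreal (f e) * (indicator {0..<1} t * (ennreal (\<psi> t) * ennreal (lam (t - e)))) \<partial>lborel)"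
      by (simp add: nn_integral_cmult)
  qed
  also have "\<dots> = (\<integral>\<^sup>+t. \<integral>\<^sup>+e. ennreal (f e) * (indicator {0..<1} t * (ennreal (\<psi> t) * ennreal (lam (t - e)))) \<partial>lborel \<partial>lborel)"
    by (rule lborel_pair.Fubini') measurable
  also have "\<dots> = (\<integral>\<^sup>+t. indicator {0..<1} t * ennreal (\<psi> t * convolved lam t) \<partial>lborel)"
    using b \<psi>
    by (intro nn_integral_cong)
      (simp add: ennreal_mult ennreal_convolved[OF _ lam] nn_integral_multc[symmetric] nn_integral_cmult[symmetric] mult_ac)
  finally show ?thesis .
qed

lemma blur_adjoint:
  assumes [measurable]: "\<psi> \<in> borel_measurable borel" and \<psi>: "\<And>x. 0 \<le> \<psi> x" "\<And>x. \<psi> x \<le> C"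
    and [measurable]: "lam \<in> borel_measurable borel" and lam: "\<And>x. 0 \<le> lam x" "\<And>x. lam x \<le> L"
    and per: "\<And>x. lam (x + 1) = lam x"
  shows "(LINT t:{0..<1}|lborel. blur \<psi> t * lam t) = (LINT t:{0..<1}|lborel. \<psi> t * convolved lam t)"
proof -
  have b: "0 \<le> blur \<psi> t" "0 \<le> convolved lam t" for t
    using blur_bounds[of \<psi> 0 C] convolved_bounds[of lam 0 L] \<psi> lam by auto
  have adj: "(\<integral>\<^sup>+t. indicator {0..<1} t * ennreal (blur \<psi> t * lam t) \<partial>lborel)
    = (\<integral>\<^sup>+t. indicator {0..<1} t * ennreal (\<psi> t * convolved lam t) \<partial>lborel)"
    by (rule blur_adjoint_nn[where C=C and L=L]) (use assms in auto)
  have e: "ennreal (indicat_real {0..<1} t *\<^sub>R u) = indicator {0..<1} t * ennreal u" for t u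
    by (simp add: indicator_def)
  show ?thesis
    unfolding set_lebesgue_integral_def
    using b \<psi> lam
    by (subst (1 2) integral_eq_nn_integral)
      (auto intro!: AE_I2 arg_cong[where f=enn2real] scaleR_nonneg_nonneg simp: e adj simp del: scaleR_conv_of_real real_scaleR_def)
qed

text \<open>The exponent of a Poisson functional contains \<psi> - 1. The constant 1 is its own blur
  because the density has mass 1, so the subtracted term transforms by the same adjoint
  identity.\<close>

lemma blur_adjoint_minus_one:
  assumes [measurable]: "\<psi> \<in> borel_measurable borel" and \<psi>: "\<And>x. 0 \<le> \<psi> x" "\<And>x. \<psi> x \<le> C"
    and [measurable]: "lam \<in> borel_measurable borel" and lam: "\<And>x. 0 \<le> lam x" "\<And>x. lam x \<le> L"
    and per: "\<And>x. lam (x + 1) = lam x"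
  shows "(LINT t:{0..<1}|lborel. (blur \<psi> t - 1) * lam t) = (LINT t:{0..<1}|lborel. (\<psi> t - 1) * convolved lam t)"
proof -
  have one: "blur (\<lambda>_. 1) t = 1" for t by (simp add: blur_def f_integral)
  have b: "0 \<le> blur \<psi> t" "blur \<psi> t \<le> C" "0 \<le> convolved lam t" "convolved lam t \<le> L" for t
    using blur_bounds[of \<psi> 0 C] convolved_bounds[of lam 0 L] \<psi> lam by auto
  have L: "0 \<le> L" "0 \<le> C" using lam \<psi> order_trans by blast+
  have "(LINT t:{0..<1}|lborel. (blur \<psi> t - 1) * lam t)
      = (LINT t:{0..<1}|lborel. blur \<psi> t * lam t) - (LINT t:{0..<1}|lborel. blur (\<lambda>_. 1) t * lam t)"
    unfolding one left_diff_distrib using b lam \<psi> L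
    by (intro set_integral_diff bounded_set_integrable[where C="C * L"] bounded_set_integrable[where C="1 * L"])
      (auto simp: abs_mult intro!: mult_mono)
  also have "\<dots> = (LINT t:{0..<1}|lborel. \<psi> t * convolved lam t) - (LINT t:{0..<1}|lborel. 1 * convolved lam t)"
    using assms by (subst (1 2) blur_adjoint[where L=L]) auto
  also have "\<dots> = (LINT t:{0..<1}|lborel. (\<psi> t - 1) * convolved lam t)"
    unfolding left_diff_distrib using b lam \<psi> L
    by (intro set_integral_diff(2)[symmetric] bounded_set_integrable[where C="C * L"] bounded_set_integrable[where C="1 * L"])
      (auto simp: abs_mult intro!: mult_mono)
  finally show ?thesis .
qed

end

section \<open>Averaging over the errors\<close>

lemma borel_measurable_prod_of_random_length:
  fixes F :: "nat \<Rightarrow> 'a \<Rightarrow> ennreal"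
  assumes "\<And>j. F j \<in> borel_measurable M" and "k \<in> measurable M (count_space UNIV)"
  shows "(\<lambda>p. \<Prod>j<k p. F j p) \<in> borel_measurable M"
  using measurable_compose_countable[where f="\<lambda>q p. \<Prod>j<q. F j p" and g=k and M=M and N=borel] assms
  by auto

text \<open>With the numbered points frozen, finitely many independent errors remain and each factor
  averages to a blur. The averaged product no longer sees the numbering, so it is a functional of
  the hidden configuration alone.\<close>

lemma (in poisson_deconvolution) observed_generating_functional:
  fixes g :: "real \<Rightarrow> real" and \<psi> :: "nat \<Rightarrow> real \<Rightarrow> real"
  assumes g: "real_density g" and g_eq: "AE t in lborel. ennreal (indicator {0..<1} t * f t) = ennreal (g t)"
    and lam [measurable]: "lam \<in> borel_measurable borel" and lam_bounds: "\<And>x. 0 \<le> lam x" "\<And>x. lam x \<le> L"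
    and per: "\<And>x. lam (x + 1) = lam x"
    and \<psi> [measurable]: "\<And>i. \<psi> i \<in> borel_measurable borel"
    and \<psi>_bounds: "\<And>i x. 0 \<le> \<psi> i x" "\<And>i x. \<psi> i x \<le> C"
  shows "(\<integral>\<^sup>+w. ennreal (\<Prod>i<n. point_prod (\<psi> i) (observed_process K x eps i w)) \<partial>M)
    = ennreal (\<Prod>i<n. exp (LINT t:{0..<1}|lborel. (\<psi> i t - 1) * real_density.convolved g lam t))"
proof -
  interpret g: real_density g by fact
  let ?A = "PiM {..<n} (\<lambda>_. count_space UNIV \<Otimes>\<^sub>M PiM UNIV (\<lambda>_. borel)) :: (nat \<Rightarrow> nat \<times> (nat \<Rightarrow> real)) measure"
  let ?B = "PiM ({..<n} \<times> UNIV) (\<lambda>_. borel) :: (nat \<times> nat \<Rightarrow> real) measure"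
  let ?X = "\<lambda>w. \<lambda>i\<in>{..<n}. (K i w, \<lambda>j. x i j w)"
  let ?Z = "\<lambda>w. \<lambda>(i, j)\<in>{..<n} \<times> UNIV. eps i j w"
  define F where "F i j p = ennreal (\<psi> i (frac (snd (fst p i) j + snd p (i, j))))"
    for i j and p :: "(nat \<Rightarrow> nat \<times> (nat \<Rightarrow> real)) \<times> (nat \<times> nat \<Rightarrow> real)"
  \<comment> \<open>The number of factors is itself random; measurability follows by splitting
    according to the countably many values of the length.\<close>
  define G where "G p = (\<Prod>i<n. \<Prod>j<fst (fst p i). F i j p)"
    for p :: "(nat \<Rightarrow> nat \<times> (nat \<Rightarrow> real)) \<times> (nat \<times> nat \<Rightarrow> real)"
  have G [measurable]: "G \<in> borel_measurable (?A \<Otimes>\<^sub>M ?B)"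
    unfolding G_def
  proof (intro borel_measurable_prod_ennreal)
    fix i assume i: "i \<in> {..<n}"
    have a: "(\<lambda>p. fst p i) \<in> measurable (?A \<Otimes>\<^sub>M ?B) (count_space UNIV \<Otimes>\<^sub>M PiM UNIV (\<lambda>_. borel))"
      by (rule measurable_compose[OF measurable_fst measurable_component_singleton[OF i]])
    have b: "(\<lambda>p. snd (fst p i) j) \<in> borel_measurable (?A \<Otimes>\<^sub>M ?B)" for j
      by (rule measurable_compose[OF measurable_compose[OF a measurable_snd] measurable_component_singleton]) simp
    have c: "(\<lambda>p. snd p (i, j)) \<in> borel_measurable (?A \<Otimes>\<^sub>M ?B)" for j
      by (rule measurable_compose[OF measurable_snd measurable_component_singleton]) (use i in simp)
    show "(\<lambda>p. \<Prod>j<fst (fst p i). F i j p) \<in> borel_measurable (?A \<Otimes>\<^sub>M ?B)"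
      unfolding F_def
      by (intro borel_measurable_prod_of_random_length measurable_compose[OF a measurable_fst]
          measurable_compose[OF borel_measurable_add[OF b c], where g="\<lambda>y. ennreal (\<psi> i (frac y))"]) measurable
  qed
  have eps_law: "(\<integral>\<^sup>+v. ennreal (\<psi> i (frac (y + eps i j v))) \<partial>M) = ennreal (g.blur (\<psi> i) y)"
    if "i < n" for i j y
  proof -
    have "distributed M lborel (eps i j) (\<lambda>t. ennreal (g t))"
      using eps_density[OF that, of j] g_eq
      by (subst distributed_cong_density[symmetric, where f="\<lambda>t. ennreal (indicator {0..<1} t * f t)"])
        (auto dest: distributed_borel_measurable)
    from distributed_nn_integral[OF this, of "\<lambda>e. ennreal (\<psi> i (frac (y + e)))"]
    show ?thesis by (subst g.ennreal_blur[OF \<psi> \<psi>_bounds]) simp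
  qed
  have inner: "(\<integral>\<^sup>+v. G (a, ?Z v) \<partial>M) = (\<Prod>i<n. \<Prod>j<fst (a i). ennreal (g.blur (\<psi> i) (snd (a i) j)))" for a
  proof -
    \<comment> \<open>For frozen points \<open>a\<close> only the errors attached to actual atoms
      occur, a finite set of index pairs.\<close>
    let ?I = "Sigma {..<n} (\<lambda>i. {..<fst (a i)})"
    have fin: "finite ?I" by auto
    have "(\<integral>\<^sup>+v. G (a, ?Z v) \<partial>M)
        = (\<integral>\<^sup>+v. (\<Prod>p\<in>?I. ennreal (\<psi> (fst p) (frac (snd (a (fst p)) (snd p) + (\<lambda>(i, j). eps i j) p v)))) \<partial>M)"
      unfolding G_def F_def by (subst prod.Sigma) (auto intro!: nn_integral_cong prod.cong)
    also have "\<dots> = (\<Prod>p\<in>?I. \<integral>\<^sup>+v. ennreal (\<psi> (fst p) (frac (snd (a (fst p)) (snd p) + (\<lambda>(i, j). eps i j) p v))) \<partial>M)"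
    proof (intro indep_vars_nn_integral fin)
      have "indep_vars (\<lambda>_. borel) (\<lambda>(i, j). eps i j) ?I"
        by (rule indep_vars_subset[OF eps_indep]) auto
      then show "indep_vars (\<lambda>_. borel) (\<lambda>p v. ennreal (\<psi> (fst p) (frac (snd (a (fst p)) (snd p) + (\<lambda>(i, j). eps i j) p v)))) ?I"
        by (rule indep_vars_compose2[where Y="\<lambda>p e. ennreal (\<psi> (fst p) (frac (snd (a (fst p)) (snd p) + e)))"]) measurable
    qed auto
    also have "\<dots> = (\<Prod>p\<in>?I. ennreal (g.blur (\<psi> (fst p)) (snd (a (fst p)) (snd p))))"
      by (intro prod.cong refl) (auto simp: eps_law split: prod.split)
    also have "\<dots> = (\<Prod>i<n. \<Prod>j<fst (a i). ennreal (g.blur (\<psi> i) (snd (a i) j)))"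
      by (subst prod.Sigma) (auto intro!: prod.cong)
    finally show ?thesis .
  qed
  have blur_b: "0 \<le> g.blur (\<psi> i) y" "g.blur (\<psi> i) y \<le> C" for i y
    using g.blur_bounds[of "\<psi> i" 0 C] \<psi>_bounds by auto
  have "(\<integral>\<^sup>+w. ennreal (\<Prod>i<n. point_prod (\<psi> i) (observed_process K x eps i w)) \<partial>M)
      = (\<integral>\<^sup>+w. G (?X w, ?Z w) \<partial>M)"
    unfolding G_def F_def using \<psi>_bounds
    by (intro nn_integral_cong)
      (auto simp: observed_process_def point_prod_point_config prod_ennreal prod_nonneg intro!: prod.cong)
  also have "\<dots> = (\<integral>\<^sup>+w. (\<integral>\<^sup>+v. G (?X w, ?Z v) \<partial>M) \<partial>M)"
    by (rule indep_elements_nn_integral[OF points_eps_indep G])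
  also have "\<dots> = (\<integral>\<^sup>+w. (\<Prod>i<n. ennreal (point_prod (g.blur (\<psi> i)) (hidden_process K x i w))) \<partial>M)"
    unfolding inner using blur_b
    by (intro nn_integral_cong prod.cong) (auto simp: hidden_process_def point_prod_point_config prod_ennreal)
  also have "\<dots> = (\<Prod>i<n. \<integral>\<^sup>+w. ennreal (point_prod (g.blur (\<psi> i)) (hidden_process K x i w)) \<partial>M)"
  proof (intro indep_vars_nn_integral)
    have [measurable]: "point_prod (g.blur (\<psi> i)) \<in> borel_measurable config_space" for i
      by (rule measurable_point_prod[where C=C]) (use blur_b in auto)
    show "indep_vars (\<lambda>_. borel) (\<lambda>i w. ennreal (point_prod (g.blur (\<psi> i)) (hidden_process K x i w))) {..<n}"
      by (rule indep_vars_compose2[OF hidden_indep, where Y="\<lambda>i N. ennreal (point_prod (g.blur (\<psi> i)) N)"]) measurable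
  qed auto
  also have "\<dots> = (\<Prod>i<n. ennreal (exp (LINT t:{0..<1}|lborel. (g.blur (\<psi> i) t - 1) * lam t)))"
  proof (intro prod.cong refl)
    fix i assume "i \<in> {..<n}"
    then show "(\<integral>\<^sup>+w. ennreal (point_prod (g.blur (\<psi> i)) (hidden_process K x i w)) \<partial>M)
        = ennreal (exp (LINT t:{0..<1}|lborel. (g.blur (\<psi> i) t - 1) * lam t))"
      using lam_bounds blur_b
      by (intro poisson_process_generating_functional[where C=C] hidden_poisson bounded_set_integrable[where C=L]) auto
  qed
  also have "\<dots> = ennreal (\<Prod>i<n. exp (LINT t:{0..<1}|lborel. (\<psi> i t - 1) * g.convolved lam t))"
    using assms by (subst prod_ennreal) (auto simp: g.blur_adjoint_minus_one[where C=C and L=L])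
  finally show ?thesis .
qed

section \<open>The generating functional determines the law\<close>

lemma measurable_prod_point_prod:
  fixes n :: nat
  assumes "\<And>i. i < n \<Longrightarrow> \<psi> i \<in> borel_measurable borel" "\<And>i x. i < n \<Longrightarrow> 0 \<le> \<psi> i x" "\<And>i x. i < n \<Longrightarrow> \<psi> i x \<le> C"
  shows "(\<lambda>p. \<Prod>i<n. point_prod (\<psi> i) (p i)) \<in> borel_measurable (PiM {..<n} (\<lambda>_. config_space))"
proof (intro borel_measurable_prod)
  fix i assume i: "i \<in> {..<n}"
  then have "point_prod (\<psi> i) \<in> borel_measurable config_space"
    using assms by (intro measurable_point_prod[where C=C]) auto
  with measurable_component_singleton[OF i]
  show "(\<lambda>p. point_prod (\<psi> i) (p i)) \<in> borel_measurable (PiM {..<n} (\<lambda>_. config_space))"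
    by (rule measurable_compose)
qed

text \<open>Strong induction on the index: once the earlier differences vanish, dividing by
  \<open>s ^ k\<close> and letting \<open>s\<close> decrease to 0 isolates the next one, so values
  on the positive side of 0 suffice. Boundedness of the coefficients gives convergence for
  \<open>\<bar>s\<bar> < 1\<close>.\<close>

lemma power_series_coeffs_unique:
  fixes a b :: "nat \<Rightarrow> real"
  assumes a: "\<And>k. 0 \<le> a k" "\<And>k. a k \<le> C" and b: "\<And>k. 0 \<le> b k" "\<And>k. b k \<le> C"
    and eq: "\<And>s. 0 < s \<Longrightarrow> s < 1 \<Longrightarrow>
      (\<Sum>k. ennreal (s ^ k) * ennreal (a k)) = (\<Sum>k. ennreal (s ^ k) * ennreal (b k))"
  shows "a k = b k"
proof -
  have summ: "summable (\<lambda>k. u k * s ^ k)" if u: "\<And>k. \<bar>u k\<bar> \<le> D" and s: "\<bar>s\<bar> < 1"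
    for u :: "nat \<Rightarrow> real" and s D :: real
  proof (rule summable_comparison_test')
    show "summable (\<lambda>k. D * \<bar>s\<bar> ^ k)" using s by (intro summable_mult summable_geometric) auto
    show "norm (u k * s ^ k) \<le> D * \<bar>s\<bar> ^ k" for k
      using u[of k] by (auto simp: abs_mult power_abs intro!: mult_right_mono)
  qed
  define D where "D k = a k - b k" for k
  have D_bd: "\<bar>D k\<bar> \<le> C" for k using a[of k] b[of k] by (auto simp: D_def)
  have D0: "(\<Sum>k. D k * s ^ k) = 0" if s: "0 < s" "s < 1" for s
  proof -
    have sa: "summable (\<lambda>k. a k * s ^ k)" and sb: "summable (\<lambda>k. b k * s ^ k)"
      using a b s by (auto intro!: summ[where D=C])
    have "(\<Sum>k. ennreal (s ^ k) * ennreal (u k)) = ennreal (\<Sum>k. u k * s ^ k)"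
      if "\<And>k. 0 \<le> u k" "summable (\<lambda>k. u k * s ^ k)" for u :: "nat \<Rightarrow> real"
    proof -
      have "(\<Sum>k. ennreal (s ^ k) * ennreal (u k)) = (\<Sum>k. ennreal (u k * s ^ k))"
        using that s by (intro suminf_cong) (simp add: ennreal_mult mult.commute)
      then show ?thesis using that s by (simp add: suminf_ennreal2)
    qed
    then have "ennreal (\<Sum>k. a k * s ^ k) = ennreal (\<Sum>k. b k * s ^ k)"
      using eq[OF s] sa sb a b by simp
    then have "(\<Sum>k. a k * s ^ k) = (\<Sum>k. b k * s ^ k)"
      using s a b sa sb by (subst (asm) ennreal_inj) (auto intro!: suminf_nonneg)
    then show ?thesis using suminf_diff[OF sa sb] by (simp add: D_def left_diff_distrib)
  qed
  have "D k = 0"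
  proof (induction k rule: less_induct)
    case (less k)
    define u where "u s = (\<Sum>j. D (j + k) * s ^ j)" for s
    have summ_k: "summable (\<lambda>j. D (j + k) * s ^ j)" if "\<bar>s\<bar> < 1" for s
      using that D_bd by (intro summ[where D=C]) auto
    have u0: "u s = 0" if s: "0 < s" "s < 1" for s
    proof -
      have "(\<Sum>j. D j * s ^ j) = (\<Sum>j. D (j + k) * s ^ (j + k)) + (\<Sum>j<k. D j * s ^ j)"
        using s D_bd by (intro suminf_split_initial_segment summ[where D=C]) auto
      also have "(\<Sum>j<k. D j * s ^ j) = 0" using less by simp
      also have "(\<Sum>j. D (j + k) * s ^ (j + k)) = u s * s ^ k"
        using suminf_mult2[OF summ_k, of s "s ^ k"] s by (simp add: u_def power_add mult_ac)
      finally show ?thesis using D0[OF s] s by simp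
    qed
    have "(u \<longlongrightarrow> D (0 + k)) (at 0)"
      by (rule powser_limit_0[where s=1]) (auto simp: u_def intro!: summable_sums summ_k)
    then have "(u \<longlongrightarrow> D k) (at_right 0)" by (simp add: filterlim_at_split)
    moreover have "(u \<longlongrightarrow> 0) (at_right 0)"
    proof (rule tendsto_eventually)
      show "\<forall>\<^sub>F s in at_right 0. u s = 0"
        unfolding eventually_at_right_field by (intro exI[of _ 1]) (auto simp: u0)
    qed
    ultimately show ?case by (rule tendsto_unique[rotated]) simp
  qed
  then show ?thesis by (simp add: D_def)
qed

lemma point_prod_mark:
  "point_prod (\<lambda>x. \<phi> x * (if x \<in> B then s else 1)) N = s ^ count_in N B * point_prod \<phi> N"
  by (induction N) (auto simp: count_in_def)

text \<open>A list of constraints makes the intersection of two cylinders an append and lets an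
  induction add one count at a time.\<close>

definition count_cylinder :: "nat \<Rightarrow> (nat \<times> real set \<times> nat) list \<Rightarrow> (nat \<Rightarrow> real multiset) set" where
  "count_cylinder n L = {p \<in> space (PiM {..<n} (\<lambda>_. config_space)). \<forall>(i, B, k) \<in> set L. count_in (p i) B = k}"

definition count_constraints :: "nat \<Rightarrow> (nat \<times> real set \<times> nat) list \<Rightarrow> bool" where
  "count_constraints n L \<longleftrightarrow> (\<forall>(i, B, k) \<in> set L. i < n \<and> B \<in> sets borel \<and> B \<subseteq> {0..<1})"

lemma measurable_count_coordinate:
  assumes "i < n" "B \<in> sets borel" "B \<subseteq> {0..<1}"
  shows "(\<lambda>p. count_in (p i) B) \<in> measurable (PiM {..<n} (\<lambda>_. config_space)) (count_space UNIV)"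
  using measurable_compose[OF measurable_component_singleton[of i "{..<n}" "\<lambda>_. config_space"]
      measurable_count_in[OF assms(2,3)]] assms(1) by simp

lemma count_cylinder_Cons:
  "count_cylinder n ((i, B, k) # L)
    = count_cylinder n L \<inter> {p \<in> space (PiM {..<n} (\<lambda>_. config_space)). count_in (p i) B = k}"
  by (auto simp: count_cylinder_def)

lemma count_cylinder_sets:
  "count_constraints n L \<Longrightarrow> count_cylinder n L \<in> sets (PiM {..<n} (\<lambda>_. config_space))"
proof (induction L)
  case Nil then show ?case by (simp add: count_cylinder_def)
next
  case (Cons c L)
  obtain i B k where c: "c = (i, B, k)" by (cases c)
  have [measurable]: "(\<lambda>p. count_in (p i) B) \<in> measurable (PiM {..<n} (\<lambda>_. config_space)) (count_space UNIV)"
    using Cons.prems by (intro measurable_count_coordinate) (auto simp: c count_constraints_def)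
  have "{p \<in> space (PiM {..<n} (\<lambda>_. config_space)). count_in (p i) B = k} \<in> sets (PiM {..<n} (\<lambda>_. config_space))"
    by measurable
  then show ?case using Cons by (auto simp: c count_cylinder_Cons count_constraints_def)
qed

text \<open>For the inclusion from left to right, the identity is measurable from the cylinder
  sigma-algebra: a count event in one coordinate pulls back to a cylinder with a single
  constraint.\<close>

lemma sets_config_product:
  "sets (PiM {..<n} (\<lambda>_. config_space))
    = sigma_sets (space (PiM {..<n} (\<lambda>_. config_space))) {count_cylinder n L | L. count_constraints n L}"
    (is "sets ?A = sigma_sets ?\<Omega> ?E")
proof
  have E: "?E \<subseteq> sets ?A" using count_cylinder_sets by auto
  then show "sigma_sets ?\<Omega> ?E \<subseteq> sets ?A" by (rule sets.sigma_sets_subset)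
  let ?S = "sigma ?\<Omega> ?E"
  have EP: "?E \<subseteq> Pow ?\<Omega>" using E sets.space_closed by blast
  have spS: "space ?S = ?\<Omega>" by (rule space_measure_of[OF EP])
  have setS: "sets ?S = sigma_sets ?\<Omega> ?E" by (rule sets_measure_of[OF EP])
  have "(\<lambda>p. p) \<in> measurable ?S ?A"
  proof (rule measurable_PiM_single')
    show "(\<lambda>p. p i) \<in> measurable ?S config_space" if i: "i \<in> {..<n}" for i
    proof -
      have coord: "set_mset (p i) \<subseteq> {0..<1}" if "p \<in> ?\<Omega>" for p
        using measurable_space[OF measurable_component_singleton[OF i, of "\<lambda>_. config_space"] that]
        by (simp add: space_config_space)
      have "(\<lambda>p. p i) \<in> measurable ?S (sigma {N. set_mset N \<subseteq> {0..<1}}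
        {{N. set_mset N \<subseteq> {0..<1} \<and> count_in N B = k} |B k. B \<in> sets borel \<and> B \<subseteq> {0..<1}})"
      proof (rule measurable_measure_of)
        show "(\<lambda>p. p i) \<in> space ?S \<rightarrow> {N. set_mset N \<subseteq> {0..<1}}"
          unfolding spS using coord by blast
        fix y assume "y \<in> {{N. set_mset N \<subseteq> {0..<1} \<and> count_in N B = k} |B k. B \<in> sets borel \<and> B \<subseteq> {0..<1}}"
        then obtain B k where B: "B \<in> sets borel" "B \<subseteq> {0..<1}"
          and y: "y = {N. set_mset N \<subseteq> {0..<1} \<and> count_in N B = k}" by auto
        have "count_cylinder n [(i, B, k)] = {p \<in> ?\<Omega>. count_in (p i) B = k}"
          by (simp add: count_cylinder_def)
        then have "(\<lambda>p. p i) -` y \<inter> space ?S = count_cylinder n [(i, B, k)]"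
          unfolding spS y using coord by blast
        also have "\<dots> \<in> sets ?S"
          unfolding setS using i B
          by (intro sigma_sets.Basic CollectI exI[of _ "[(i, B, k)]"]) (auto simp: count_constraints_def)
        finally show "(\<lambda>p. p i) -` y \<inter> space ?S \<in> sets ?S" .
      qed auto
      then show ?thesis by (fold config_space_def)
    qed
    show "(\<lambda>p. p) \<in> space ?S \<rightarrow> (\<Pi>\<^sub>E i\<in>{..<n}. space config_space)"
      unfolding spS by (auto simp: space_PiM)
  qed
  then show "sets ?A \<subseteq> sigma_sets ?\<Omega> ?E"
    unfolding setS[symmetric]
  proof (intro subsetI)
    fix S assume S: "S \<in> sets ?A" and "(\<lambda>p. p) \<in> measurable ?S ?A"
    from measurable_sets[OF this(2) S] show "S \<in> sets ?S"
      using sets.sets_into_space[OF S] by (simp add: spS Int_absorb2)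
  qed
qed

text \<open>Multiplying a test function by \<open>s\<close> on \<open>B\<close> multiplies the functional by \<open>s ^ N(B)\<close>; the
  coefficients of the resulting power series in \<open>s\<close> add one constraint on a count to the cylinder.\<close>

lemma generating_functional_on_cylinders:
  fixes n :: nat
  assumes \<mu>: "finite_measure \<mu>" "sets \<mu> = sets (PiM {..<n} (\<lambda>_. config_space))"
    and \<nu>: "finite_measure \<nu>" "sets \<nu> = sets (PiM {..<n} (\<lambda>_. config_space))"
    and eq: "\<And>\<psi>. (\<And>i. \<psi> i \<in> borel_measurable borel) \<Longrightarrow> (\<And>i x. 0 \<le> \<psi> i x) \<Longrightarrow> (\<And>i x. \<psi> i x \<le> 1) \<Longrightarrow>
      (\<integral>\<^sup>+p. ennreal (\<Prod>i<n. point_prod (\<psi> i) (p i)) \<partial>\<mu>) = (\<integral>\<^sup>+p. ennreal (\<Prod>i<n. point_prod (\<psi> i) (p i)) \<partial>\<nu>)"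
    and L: "count_constraints n L"
    and \<psi>: "\<And>i. \<psi> i \<in> borel_measurable borel" "\<And>i x. 0 \<le> \<psi> i x" "\<And>i x. \<psi> i x \<le> 1"
  shows "(\<integral>\<^sup>+p. ennreal (\<Prod>i<n. point_prod (\<psi> i) (p i)) * indicator (count_cylinder n L) p \<partial>\<mu>)
    = (\<integral>\<^sup>+p. ennreal (\<Prod>i<n. point_prod (\<psi> i) (p i)) * indicator (count_cylinder n L) p \<partial>\<nu>)"
  using L \<psi>
\<comment> \<open>\<psi> stays arbitrary because the induction hypothesis is applied to a marked
  test function; \<open>0 < s\<close> and \<open>s < 1\<close> keep that function between 0 and
  1.\<close>
proof (induction L arbitrary: \<psi>)
  case Nil
  have "indicator (count_cylinder n []) p = (1::ennreal)" if "p \<in> space \<mu> \<or> p \<in> space \<nu>" for p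
    using that sets_eq_imp_space_eq[OF \<mu>(2)] sets_eq_imp_space_eq[OF \<nu>(2)] by (auto simp: count_cylinder_def)
  then have "(\<integral>\<^sup>+p. ennreal (\<Prod>i<n. point_prod (\<psi> i) (p i)) * indicator (count_cylinder n []) p \<partial>\<kappa>)
      = (\<integral>\<^sup>+p. ennreal (\<Prod>i<n. point_prod (\<psi> i) (p i)) \<partial>\<kappa>)" if "\<kappa> = \<mu> \<or> \<kappa> = \<nu>" for \<kappa>
    using that by (intro nn_integral_cong) auto
  then show ?case using eq[OF Nil(2-4)] by simp
next
  case (Cons c L)
  obtain i B k where c: "c = (i, B, k)" by (cases c)
  have i: "i < n" and B [measurable]: "B \<in> sets borel" and B01: "B \<subseteq> {0..<1}" and L: "count_constraints n L"
    using Cons.prems(1) by (auto simp: c count_constraints_def)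
  let ?A = "PiM {..<n} (\<lambda>_. config_space)"
  let ?\<Phi> = "\<lambda>\<psi> p. ennreal (\<Prod>i<n. point_prod (\<psi> i) (p i)) * indicator (count_cylinder n L) p"
  have [measurable]: "(\<lambda>p. \<Prod>i<n. point_prod (\<psi> i) (p i)) \<in> borel_measurable ?A"
    using Cons.prems by (intro measurable_prod_point_prod[where C=1]) auto
  have [measurable]: "count_cylinder n L \<in> sets ?A" by (rule count_cylinder_sets[OF L])
  have cm [measurable]: "(\<lambda>p. count_in (p i) B) \<in> measurable ?A (count_space UNIV)"
    by (rule measurable_count_coordinate[OF i B B01])
  define a where "a \<kappa> j = (\<integral>\<^sup>+p. ?\<Phi> \<psi> p * indicator {p \<in> space ?A. count_in (p i) B = j} p \<partial>\<kappa>)" for \<kappa> j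
  have prod_le: "(\<Prod>i<n. point_prod (\<psi> i) (p i)) \<le> 1" for p
    using Cons.prems by (intro prod_le_1) (auto intro: point_prod_le_1 point_prod_nonneg)
  have series: "(\<integral>\<^sup>+p. ?\<Phi> (\<psi>(i := \<lambda>x. \<psi> i x * (if x \<in> B then s else 1))) p \<partial>\<kappa>) = (\<Sum>j. ennreal (s ^ j) * a \<kappa> j)"
    if \<kappa>: "\<kappa> = \<mu> \<or> \<kappa> = \<nu>" and s: "0 < s" "s < 1" for \<kappa> s
  proof -
    have sets_\<kappa> [measurable_cong]: "sets \<kappa> = sets ?A" using \<kappa> \<mu> \<nu> by auto
    have sp: "space \<kappa> = space ?A" by (rule sets_eq_imp_space_eq[OF sets_\<kappa>])
    have "(\<Prod>l<n. point_prod ((\<psi>(i := \<lambda>x. \<psi> i x * (if x \<in> B then s else 1))) l) (p l))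
        = s ^ count_in (p i) B * (\<Prod>l<n. point_prod (\<psi> l) (p l))" for p
    proof -
      have "(\<Prod>l<n. point_prod ((\<psi>(i := \<lambda>x. \<psi> i x * (if x \<in> B then s else 1))) l) (p l))
          = (\<Prod>l<n. (if l = i then s ^ count_in (p i) B else 1) * point_prod (\<psi> l) (p l))"
        by (intro prod.cong) (auto simp: point_prod_mark)
      then show ?thesis using i by (simp add: prod.distrib prod.delta)
    qed
    then have "(\<integral>\<^sup>+p. ?\<Phi> (\<psi>(i := \<lambda>x. \<psi> i x * (if x \<in> B then s else 1))) p \<partial>\<kappa>)
        = (\<integral>\<^sup>+p. ?\<Phi> \<psi> p * ennreal (s ^ count_in (p i) B) \<partial>\<kappa>)"
      using s Cons.prems by (intro nn_integral_cong)
        (simp add: ennreal_mult prod_nonneg point_prod_nonneg mult_ac del: fun_upd_apply)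
    also have "\<dots> = (\<integral>\<^sup>+p. ennreal (s ^ count_in (p i) B) \<partial>density \<kappa> (?\<Phi> \<psi>))"
      by (subst nn_integral_density) auto
    also have "\<dots> = (\<Sum>j. ennreal (s ^ j) * emeasure (density \<kappa> (?\<Phi> \<psi>)) {p \<in> space (density \<kappa> (?\<Phi> \<psi>)). count_in (p i) B = j})"
      by (rule nn_integral_nat_valued) measurable
    also have "\<dots> = (\<Sum>j. ennreal (s ^ j) * a \<kappa> j)"
      unfolding a_def by (intro suminf_cong arg_cong2[where f="(*)"] refl, subst emeasure_density) (auto simp: sp)
    finally show ?thesis .
  qed
  \<comment> \<open>The products are at most 1, so the total mass bounds every coefficient, as
    uniqueness of power series requires.\<close>
  have a_le: "a \<kappa> j \<le> emeasure \<kappa> (space \<kappa>)" for \<kappa> j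
  proof -
    have "a \<kappa> j \<le> (\<integral>\<^sup>+p. 1 \<partial>\<kappa>)"
      unfolding a_def using prod_le by (intro nn_integral_mono) (auto simp: indicator_def)
    then show ?thesis by simp
  qed
  have fin: "emeasure \<mu> (space \<mu>) < \<infinity>" "emeasure \<nu> (space \<nu>) < \<infinity>"
    using finite_measure.emeasure_finite[OF \<mu>(1)] finite_measure.emeasure_finite[OF \<nu>(1)]
    by (auto simp: less_top)
  have a_fin: "a \<mu> j < \<infinity>" "a \<nu> j < \<infinity>" for j
    using a_le[of \<mu> j] a_le[of \<nu> j] fin le_less_trans by blast+
  define C where "C = max (enn2real (emeasure \<mu> (space \<mu>))) (enn2real (emeasure \<nu> (space \<nu>)))"
  have "enn2real (a \<mu> k) = enn2real (a \<nu> k)"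
  proof (rule power_series_coeffs_unique[where C=C])
    show "enn2real (a \<mu> j) \<le> C" "enn2real (a \<nu> j) \<le> C" for j
      using enn2real_mono[OF a_le[of \<mu> j]] enn2real_mono[OF a_le[of \<nu> j]] fin by (auto simp: C_def)
    fix s :: real assume s: "0 < s" "s < 1"
    have "(\<integral>\<^sup>+p. ?\<Phi> (\<psi>(i := \<lambda>x. \<psi> i x * (if x \<in> B then s else 1))) p \<partial>\<mu>)
        = (\<integral>\<^sup>+p. ?\<Phi> (\<psi>(i := \<lambda>x. \<psi> i x * (if x \<in> B then s else 1))) p \<partial>\<nu>)"
    proof (rule Cons.IH[OF L])
      fix l
      have [measurable]: "\<psi> l \<in> borel_measurable borel" "\<psi> i \<in> borel_measurable borel" using Cons.prems by auto
      show "(\<psi>(i := \<lambda>x. \<psi> i x * (if x \<in> B then s else 1))) l \<in> borel_measurable borel"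
        by (cases "l = i") auto
      fix x
      show "0 \<le> (\<psi>(i := \<lambda>x. \<psi> i x * (if x \<in> B then s else 1))) l x"
        using s Cons.prems by auto
      show "(\<psi>(i := \<lambda>x. \<psi> i x * (if x \<in> B then s else 1))) l x \<le> 1"
        using s Cons.prems by (auto intro!: mult_le_one)
    qed
    then show "(\<Sum>j. ennreal (s ^ j) * ennreal (enn2real (a \<mu> j))) = (\<Sum>j. ennreal (s ^ j) * ennreal (enn2real (a \<nu> j)))"
      using series[OF _ s] a_fin by simp
  qed auto
  then have "a \<mu> k = a \<nu> k" using a_fin by (metis ennreal_enn2real infinity_ennreal_def)
  then show ?case
    unfolding a_def c count_cylinder_Cons by (simp add: indicator_inter_arith mult.assoc)
qed

text \<open>Cylinders are stable under intersection and generate the product sigma-algebra; on them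
  the measures agree by taking the constant test function 1.\<close>

lemma measure_eqI_generating_functional:
  fixes n :: nat
  assumes \<mu>: "finite_measure \<mu>" "sets \<mu> = sets (PiM {..<n} (\<lambda>_. config_space))"
    and \<nu>: "finite_measure \<nu>" "sets \<nu> = sets (PiM {..<n} (\<lambda>_. config_space))"
    and eq: "\<And>\<psi>. (\<And>i. \<psi> i \<in> borel_measurable borel) \<Longrightarrow> (\<And>i x. 0 \<le> \<psi> i x) \<Longrightarrow> (\<And>i x. \<psi> i x \<le> 1) \<Longrightarrow>
      (\<integral>\<^sup>+p. ennreal (\<Prod>i<n. point_prod (\<psi> i) (p i)) \<partial>\<mu>) = (\<integral>\<^sup>+p. ennreal (\<Prod>i<n. point_prod (\<psi> i) (p i)) \<partial>\<nu>)"
  shows "\<mu> = \<nu>"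
proof (rule measure_eqI_generator_eq)
  let ?E = "{count_cylinder n L | L. count_constraints n L}"
  let ?\<Omega> = "space (PiM {..<n} (\<lambda>_. config_space))"
  show "Int_stable ?E"
  proof (rule Int_stableI)
    fix S T assume "S \<in> ?E" "T \<in> ?E"
    then obtain L L' where "S = count_cylinder n L" "T = count_cylinder n L'" "count_constraints n L" "count_constraints n L'"
      by auto
    moreover have "count_cylinder n L \<inter> count_cylinder n L' = count_cylinder n (L @ L')"
      by (rule set_eqI) (unfold count_cylinder_def set_append ball_Un Int_iff mem_Collect_eq, argo)
    moreover have "count_constraints n (L @ L')"
      using \<open>count_constraints n L\<close> \<open>count_constraints n L'\<close>
      by (simp add: count_constraints_def ball_Un)
    ultimately show "S \<inter> T \<in> ?E" by auto
  qed
  show "?E \<subseteq> Pow ?\<Omega>" by (auto simp: count_cylinder_def)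
  show "sets \<mu> = sigma_sets ?\<Omega> ?E" "sets \<nu> = sigma_sets ?\<Omega> ?E"
    using \<mu> \<nu> sets_config_product by auto
  show "range (\<lambda>_::nat. ?\<Omega>) \<subseteq> ?E"
    by (auto simp: count_cylinder_def count_constraints_def intro!: exI[of _ "[]"])
  show "emeasure \<mu> ?\<Omega> \<noteq> \<infinity>" using finite_measure.emeasure_finite[OF \<mu>(1)] by simp
  fix S assume "S \<in> ?E"
  then obtain L where L: "S = count_cylinder n L" "count_constraints n L" by auto
  then have S: "S \<in> sets \<mu>" "S \<in> sets \<nu>" using count_cylinder_sets \<mu> \<nu> by auto
  have "(\<integral>\<^sup>+p. ennreal (\<Prod>i<n. point_prod ((\<lambda>_ _. 1) i) (p i)) * indicator (count_cylinder n L) p \<partial>\<mu>)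
    = (\<integral>\<^sup>+p. ennreal (\<Prod>i<n. point_prod ((\<lambda>_ _. 1) i) (p i)) * indicator (count_cylinder n L) p \<partial>\<nu>)"
  proof (rule generating_functional_on_cylinders[OF \<mu> \<nu> _ L(2)])
    fix \<psi> :: "nat \<Rightarrow> real \<Rightarrow> real"
    assume "\<And>i. \<psi> i \<in> borel_measurable borel" "\<And>i x. 0 \<le> \<psi> i x" "\<And>i x. \<psi> i x \<le> 1"
    then show "(\<integral>\<^sup>+p. ennreal (\<Prod>i<n. point_prod (\<psi> i) (p i)) \<partial>\<mu>)
      = (\<integral>\<^sup>+p. ennreal (\<Prod>i<n. point_prod (\<psi> i) (p i)) \<partial>\<nu>)" by (rule eq)
  qed auto
  then show "emeasure \<mu> S = emeasure \<nu> S"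
    using S by (simp add: point_prod_const L(1)[symmetric])
qed auto

section \<open>Two-point lower bounds\<close>

text \<open>\<open>Z\<close> stands for a likelihood ratio. Cauchy-Schwarz bounds Z a^2 + b^2 below
  by D^2 Z / (1 + Z), and by AM-GM the sum of Z / (1 + Z) and (1 + Z) / 16 is at least sqrt Z /
  2.\<close>

lemma weighted_squares_lower_bound:
  fixes a b D Z :: real
  assumes Z: "0 \<le> Z" and D: "0 \<le> D" "D \<le> a + b"
  shows "D\<^sup>2 * (sqrt Z / 2) \<le> Z * a\<^sup>2 + b\<^sup>2 + D\<^sup>2 / 16 * (Z + 1)"
proof -
  define u where "u = sqrt Z"
  have u: "Z = u\<^sup>2" using Z by (simp add: u_def)
  have pos: "0 < 1 + u\<^sup>2" by (simp add: add_pos_nonneg)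
  have "(1 + u\<^sup>2) * (u\<^sup>2 * a\<^sup>2 + b\<^sup>2) - u\<^sup>2 * (a + b)\<^sup>2 = (b - u\<^sup>2 * a)\<^sup>2"
    by (simp add: power2_eq_square algebra_simps)
  then have "u\<^sup>2 * (a + b)\<^sup>2 \<le> (1 + u\<^sup>2) * (u\<^sup>2 * a\<^sup>2 + b\<^sup>2)"
    using zero_le_power2[of "b - u\<^sup>2 * a"] by linarith
  moreover have "u\<^sup>2 * D\<^sup>2 \<le> u\<^sup>2 * (a + b)\<^sup>2"
    using D by (intro mult_left_mono power_mono) auto
  ultimately have 1: "u\<^sup>2 * D\<^sup>2 \<le> (1 + u\<^sup>2) * (u\<^sup>2 * a\<^sup>2 + b\<^sup>2)" by linarith
  have "16 * u\<^sup>2 - 8 * u * (1 + u\<^sup>2) + (1 + u\<^sup>2)\<^sup>2 = (4 * u - (1 + u\<^sup>2))\<^sup>2"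
    by (simp add: power2_eq_square algebra_simps)
  then have "8 * u * (1 + u\<^sup>2) \<le> 16 * u\<^sup>2 + (1 + u\<^sup>2)\<^sup>2"
    using zero_le_power2[of "4 * u - (1 + u\<^sup>2)"] by linarith
  then have "D\<^sup>2 * (8 * u * (1 + u\<^sup>2)) \<le> D\<^sup>2 * (16 * u\<^sup>2 + (1 + u\<^sup>2)\<^sup>2)"
    by (intro mult_left_mono) auto
  also have "\<dots> \<le> 16 * ((1 + u\<^sup>2) * (u\<^sup>2 * a\<^sup>2 + b\<^sup>2)) + D\<^sup>2 * (1 + u\<^sup>2)\<^sup>2"
    using 1 by (simp add: algebra_simps)
  finally have "(1 + u\<^sup>2) * (8 * D\<^sup>2 * u) \<le> (1 + u\<^sup>2) * (16 * (u\<^sup>2 * a\<^sup>2 + b\<^sup>2) + D\<^sup>2 * (1 + u\<^sup>2))"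
    by (simp add: power2_eq_square algebra_simps)
  then have "8 * D\<^sup>2 * u \<le> 16 * (u\<^sup>2 * a\<^sup>2 + b\<^sup>2) + D\<^sup>2 * (1 + u\<^sup>2)"
    using pos by (simp only: mult_le_cancel_left_pos)
  then show ?thesis unfolding u using Z by (simp add: u_def field_simps)
qed

text \<open>Integrated, a slack term of weight w costs 2 w D^2 and gains 2 sqrt w D^2 times the
  affinity. For affinity 1/2 the best weight is w = 1/16, which leaves D^2/4 - D^2/8.\<close>

lemma two_point_density:
  fixes Z a b :: "'p \<Rightarrow> real"
  assumes N: "prob_space N"
    and [measurable]: "Z \<in> borel_measurable N" "a \<in> borel_measurable N" "b \<in> borel_measurable N"
    and Z: "\<And>p. 0 \<le> Z p" "(\<integral>\<^sup>+p. ennreal (Z p) \<partial>N) = 1"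
    and affinity: "ennreal (1 / 2) \<le> (\<integral>\<^sup>+p. ennreal (sqrt (Z p)) \<partial>N)"
    and D: "0 \<le> D" "\<And>p. p \<in> space N \<Longrightarrow> D \<le> a p + b p"
  shows "ennreal (D\<^sup>2 / 8) \<le> (\<integral>\<^sup>+p. ennreal (Z p) * ennreal ((a p)\<^sup>2) \<partial>N) + (\<integral>\<^sup>+p. ennreal ((b p)\<^sup>2) \<partial>N)"
    (is "_ \<le> ?I")
proof -
  interpret N: prob_space N by fact
  have "ennreal (D\<^sup>2 / 4) = ennreal (D\<^sup>2 / 2) * ennreal (1 / 2)"
    by (subst ennreal_mult[symmetric]) auto
  also have "\<dots> \<le> ennreal (D\<^sup>2 / 2) * (\<integral>\<^sup>+p. ennreal (sqrt (Z p)) \<partial>N)"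
    using affinity by (rule mult_left_mono) simp
  also have "\<dots> = (\<integral>\<^sup>+p. ennreal (D\<^sup>2 / 2) * ennreal (sqrt (Z p)) \<partial>N)"
    by (rule nn_integral_cmult[symmetric]) measurable
  also have "\<dots> \<le> (\<integral>\<^sup>+p. ennreal (Z p) * ennreal ((a p)\<^sup>2) + ennreal ((b p)\<^sup>2) + ennreal (D\<^sup>2 / 16) * (ennreal (Z p) + 1) \<partial>N)"
  proof (rule nn_integral_mono)
    fix p assume "p \<in> space N"
    then have "ennreal (D\<^sup>2 * (sqrt (Z p) / 2)) \<le> ennreal (Z p * (a p)\<^sup>2 + (b p)\<^sup>2 + D\<^sup>2 / 16 * (Z p + 1))"
      using D Z by (intro ennreal_leI weighted_squares_lower_bound) auto
    moreover have "ennreal (D\<^sup>2 / 2) * ennreal (sqrt (Z p)) = ennreal (D\<^sup>2 * (sqrt (Z p) / 2))"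
      using Z(1)[of p] by (subst ennreal_mult[symmetric]) auto
    moreover have "ennreal (Z p * (a p)\<^sup>2 + (b p)\<^sup>2 + D\<^sup>2 / 16 * (Z p + 1))
      = ennreal (Z p) * ennreal ((a p)\<^sup>2) + ennreal ((b p)\<^sup>2) + ennreal (D\<^sup>2 / 16) * (ennreal (Z p) + ennreal 1)"
      using Z(1)[of p] by (simp only: ennreal_plus ennreal_mult mult_nonneg_nonneg zero_le_power2
          add_nonneg_nonneg divide_nonneg_nonneg zero_le_one zero_le_numeral)
    ultimately show "ennreal (D\<^sup>2 / 2) * ennreal (sqrt (Z p))
      \<le> ennreal (Z p) * ennreal ((a p)\<^sup>2) + ennreal ((b p)\<^sup>2) + ennreal (D\<^sup>2 / 16) * (ennreal (Z p) + 1)"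
      by simp
  qed
  also have "\<dots> = ?I + ennreal (D\<^sup>2 / 16) * ((\<integral>\<^sup>+p. ennreal (Z p) \<partial>N) + 1)"
    by (simp add: nn_integral_add nn_integral_cmult N.emeasure_space_1)
  also have "\<dots> = ?I + ennreal (D\<^sup>2 / 8)"
  proof -
    have "(\<integral>\<^sup>+p. ennreal (Z p) \<partial>N) + 1 = ennreal 2" by (simp add: Z(2))
    then have "ennreal (D\<^sup>2 / 16) * ((\<integral>\<^sup>+p. ennreal (Z p) \<partial>N) + 1) = ennreal (D\<^sup>2 / 16 * 2)"
      by (simp only: ennreal_mult'')
    then show ?thesis by simp
  qed
  finally have "ennreal (D\<^sup>2 / 8) + ennreal (D\<^sup>2 / 8) \<le> ennreal (D\<^sup>2 / 8) + ?I"
    by (simp add: ennreal_plus[symmetric] add.commute del: ennreal_plus)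
  then show ?thesis by (subst (asm) ennreal_add_left_cancel_le) auto
qed

section \<open>Likelihood ratio and Hellinger affinity of the observed processes\<close>

lemma sqrt_point_prod: "(\<And>x. 0 \<le> \<phi> x) \<Longrightarrow> sqrt (point_prod \<phi> N) = point_prod (\<lambda>x. sqrt (\<phi> x)) N"
  by (induction N) (auto simp: real_sqrt_mult)

lemma sqrt_prod: "sqrt (\<Prod>i\<in>A. u i) = (\<Prod>i\<in>A. sqrt (u i))"
  by (induction A rule: infinite_finite_induct) (auto simp: real_sqrt_mult)

text \<open>The pointwise form of the bound \<open>(\<surd>u - \<surd>v)\<^sup>2 \<le> (u - v)\<^sup>2 / (4 c)\<close>, written with the
  integrand of the logarithm of the Hellinger affinity of two Poisson processes.\<close>

lemma hellinger_integrand_bound: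
  fixes u v c :: real
  assumes "0 < c" "c \<le> u" "c \<le> v"
  shows "- ((u - v)\<^sup>2 / (8 * c)) \<le> (v - u) / 2 + (sqrt (u / v) - 1) * v"
proof -
  define A B where "A = sqrt u" and "B = sqrt v"
  have uv: "u = A\<^sup>2" "v = B\<^sup>2" "0 < A" "0 < B" using assms by (auto simp: A_def B_def)
  have s: "sqrt (u / v) * v = A * B"
    using uv(4) unfolding real_sqrt_divide A_def[symmetric] B_def[symmetric] uv(2)
    by (simp add: power2_eq_square)
  have "c \<le> A * B"
  proof -
    have "sqrt c * sqrt c \<le> A * B" using assms by (intro mult_mono) (auto simp: A_def B_def)
    then show ?thesis using assms by simp
  qed
  then have "4 * c \<le> (A + B)\<^sup>2"
    using zero_le_power2[of "A - B"] by (simp add: power2_eq_square algebra_simps)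
  then have "4 * c * (A - B)\<^sup>2 \<le> (A + B)\<^sup>2 * (A - B)\<^sup>2" by (rule mult_right_mono) simp
  also have "\<dots> = (u - v)\<^sup>2" unfolding uv by (simp add: power2_eq_square algebra_simps)
  finally have "(A - B)\<^sup>2 / 2 \<le> (u - v)\<^sup>2 / (8 * c)" using assms by (simp add: field_simps)
  moreover have "(v - u) / 2 + (sqrt (u / v) - 1) * v = - ((A - B)\<^sup>2 / 2)"
    unfolding left_diff_distrib s by (simp add: uv power2_eq_square field_simps)
  ultimately show ?thesis by linarith
qed

lemma (in poisson_deconvolution) observation_law:
  "distr M (obs_space n m) (observation n m K x eps Y)
    = distr M (PiM {..<n} (\<lambda>_. config_space)) (\<lambda>w. \<lambda>i\<in>{..<n}. observed_process K x eps i w)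
      \<Otimes>\<^sub>M distr M (PiM {..<m} (\<lambda>_. borel)) (\<lambda>w. \<lambda>k\<in>{..<m}. Y k w)"
  using indep_elements_distr[OF observed_Y_indep]
  unfolding obs_space_def observation_def[abs_def] .

lemma (in poisson_deconvolution) observation_measurable:
  "observation n m K x eps Y \<in> measurable M (obs_space n m)"
  using observed_Y_indep unfolding observation_def[abs_def] obs_space_def indep_elements_def
  by (intro measurable_Pair) auto

lemma (in poisson_deconvolution) observed_measurable:
  "(\<lambda>w. \<lambda>i\<in>{..<n}. observed_process K x eps i w) \<in> measurable M (PiM {..<n} (\<lambda>_. config_space))"
  "(\<lambda>w. \<lambda>k\<in>{..<m}. Y k w) \<in> measurable M (PiM {..<m} (\<lambda>_. borel))"
  using observed_Y_indep unfolding indep_elements_def by auto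

text \<open>The sample law depends on \<open>f\<close> alone and is therefore common to all
  hypotheses sharing that density.\<close>

lemma (in poisson_deconvolution) sample_law:
  assumes "1 \<le> m"
  shows "distr M (PiM {..<m} (\<lambda>_. borel)) (\<lambda>w. \<lambda>k\<in>{..<m}. Y k w)
    = PiM {..<m} (\<lambda>_. density lborel (\<lambda>t. ennreal (indicator {0..<1} t * f t)))"
proof -
  have rv: "Y k \<in> borel_measurable M" if "k < m" for k
    using Y_density[OF that] by (auto simp: distributed_def)
  have "distr M (PiM {..<m} (\<lambda>_. borel)) (\<lambda>w. \<lambda>k\<in>{..<m}. Y k w) = PiM {..<m} (\<lambda>k. distr M borel (Y k))"
    using Y_indep rv assms by (subst indep_vars_iff_distr_eq_PiM'[symmetric]) (auto simp: lessThan_empty_iff)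
  also have "\<dots> = PiM {..<m} (\<lambda>_. density lborel (\<lambda>t. ennreal (indicator {0..<1} t * f t)))"
  proof (rule PiM_cong)
    fix k assume "k \<in> {..<m}"
    then show "distr M borel (Y k) = density lborel (\<lambda>t. ennreal (indicator {0..<1} t * f t))"
      using Y_density[of k] distr_cong[of M M borel lborel "Y k" "Y k"] by (simp add: distributed_def)
  qed simp
  finally show ?thesis .
qed

text \<open>\<open>Z\<close> is the Poisson likelihood ratio. Reweighting by it replaces \<psi> by
  \<open>ell / ell'\<close> times \<psi> in the functional of \<open>\<mu>'\<close> and corrects the
  total mass, which yields the functional of \<open>\<mu>\<close>; uniqueness then gives the
  density.\<close>

lemma observed_law_density:
  fixes M M' :: "'w measure"
  assumes M: "poisson_deconvolution M lam f n m K x eps Y"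
    and M': "poisson_deconvolution M' lam' f n m K x eps Y"
    and g: "real_density g" and g_eq: "AE t in lborel. ennreal (indicator {0..<1} t * f t) = ennreal (g t)"
    and [measurable]: "lam \<in> borel_measurable borel" "lam' \<in> borel_measurable borel"
    and c: "0 < c"
    and lam: "\<And>x. c \<le> lam x" "\<And>x. lam x \<le> L" "\<And>x. lam (x + 1) = lam x"
    and lam': "\<And>x. c \<le> lam' x" "\<And>x. lam' x \<le> L" "\<And>x. lam' (x + 1) = lam' x"
  defines "ell \<equiv> real_density.convolved g lam" and "ell' \<equiv> real_density.convolved g lam'"
  defines "\<mu> \<equiv> distr M (PiM {..<n} (\<lambda>_. config_space)) (\<lambda>w. \<lambda>i\<in>{..<n}. observed_process K x eps i w)"
    and "\<mu>' \<equiv> distr M' (PiM {..<n} (\<lambda>_. config_space)) (\<lambda>w. \<lambda>i\<in>{..<n}. observed_process K x eps i w)"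
  defines "Z \<equiv> (\<lambda>p. \<Prod>i<n. exp ((LINT t:{0..<1}|lborel. ell' t) - (LINT t:{0..<1}|lborel. ell t))
                          * point_prod (\<lambda>t. ell t / ell' t) (p i))"
  shows "\<mu> = density \<mu>' (\<lambda>p. ennreal (Z p))"
    and "Z \<in> borel_measurable \<mu>'" "\<And>p. 0 \<le> Z p" "(\<integral>\<^sup>+p. ennreal (Z p) \<partial>\<mu>') = 1"
    and "real n * (LINT t:{0..<1}|lborel. (ell t - ell' t)\<^sup>2) \<le> 4 * c \<Longrightarrow>
      ennreal (1 / 2) \<le> (\<integral>\<^sup>+p. ennreal (sqrt (Z p)) \<partial>\<mu>')"
proof -
  interpret M: poisson_deconvolution M lam f n m K x eps Y by fact
  interpret M': poisson_deconvolution M' lam' f n m K x eps Y by fact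
  interpret g: real_density g by fact
  let ?A = "PiM {..<n} (\<lambda>_. config_space)"
  have [measurable]: "ell \<in> borel_measurable borel" "ell' \<in> borel_measurable borel"
    unfolding ell_def ell'_def by measurable
  have ell: "c \<le> ell t" "ell t \<le> L" and ell': "c \<le> ell' t" "ell' t \<le> L" for t
    using lam lam' unfolding ell_def ell'_def by (auto intro!: g.convolved_bounds)
  have pos: "0 < ell t" "0 < ell' t" for t using ell[of t] ell'[of t] c by linarith+
  have L: "0 < L" using pos(1)[of 0] ell(2)[of 0] by linarith
  define q where "q t = ell t / ell' t" for t
  have [measurable]: "q \<in> borel_measurable borel" unfolding q_def by measurable
  \<comment> \<open>The lower bound \<open>c\<close> on the intensities survives the convolution and
    keeps the ratio bounded, as the functional requires.\<close>
  have q: "0 \<le> q t" "q t \<le> L / c" for t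
    using pos[of t] ell[of t] ell'[of t] c L by (auto simp: q_def intro!: frac_le)
  define E where "E = exp ((LINT t:{0..<1}|lborel. ell' t) - (LINT t:{0..<1}|lborel. ell t))"
  have Z_def': "Z p = (\<Prod>i<n. E * point_prod q (p i))" for p
    by (simp add: Z_def E_def q_def[abs_def])
  have E: "0 < E" by (simp add: E_def)
  have sets_\<mu> [measurable_cong]: "sets \<mu> = sets ?A" "sets \<mu>' = sets ?A" by (simp_all add: \<mu>_def \<mu>'_def)
  have prob: "prob_space \<mu>" "prob_space \<mu>'"
    unfolding \<mu>_def \<mu>'_def
    by (auto intro!: M.prob_space_distr M'.prob_space_distr M.observed_measurable M'.observed_measurable)
  interpret \<mu>: prob_space \<mu> by fact
  interpret \<mu>': prob_space \<mu>' by fact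
  have pp [measurable]: "(\<lambda>p. \<Prod>i<n. point_prod (\<psi> i) (p i)) \<in> borel_measurable ?A"
    if "\<And>i. \<psi> i \<in> borel_measurable borel" "\<And>i x. 0 \<le> \<psi> i x" "\<And>i x. \<psi> i x \<le> C" for \<psi> C
    using that by (intro measurable_prod_point_prod[where C=C]) auto
  have law: "(\<integral>\<^sup>+p. ennreal (\<Prod>i<n. point_prod (\<psi> i) (p i)) \<partial>\<mu>)
      = ennreal (\<Prod>i<n. exp (LINT t:{0..<1}|lborel. (\<psi> i t - 1) * ell t))"
    if "\<And>i. \<psi> i \<in> borel_measurable borel" "\<And>i x. 0 \<le> \<psi> i x" "\<And>i x. \<psi> i x \<le> C" for \<psi> C
  proof -
    have "(\<integral>\<^sup>+p. ennreal (\<Prod>i<n. point_prod (\<psi> i) (p i)) \<partial>\<mu>)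
      = (\<integral>\<^sup>+w. ennreal (\<Prod>i<n. point_prod (\<psi> i) (observed_process K x eps i w)) \<partial>M)"
      unfolding \<mu>_def using pp[OF that] by (subst nn_integral_distr[OF M.observed_measurable(1)]) auto
    also have "\<dots> = ennreal (\<Prod>i<n. exp (LINT t:{0..<1}|lborel. (\<psi> i t - 1) * ell t))"
      unfolding ell_def using lam(1) c
      by (intro M.observed_generating_functional[OF g g_eq _ _ lam(2,3) that]) (auto intro: order_trans[of 0 c])
    finally show ?thesis .
  qed
  have law': "(\<integral>\<^sup>+p. ennreal (\<Prod>i<n. point_prod (\<psi> i) (p i)) \<partial>\<mu>')
      = ennreal (\<Prod>i<n. exp (LINT t:{0..<1}|lborel. (\<psi> i t - 1) * ell' t))"
    if "\<And>i. \<psi> i \<in> borel_measurable borel" "\<And>i x. 0 \<le> \<psi> i x" "\<And>i x. \<psi> i x \<le> C" for \<psi> C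
  proof -
    have "(\<integral>\<^sup>+p. ennreal (\<Prod>i<n. point_prod (\<psi> i) (p i)) \<partial>\<mu>')
      = (\<integral>\<^sup>+w. ennreal (\<Prod>i<n. point_prod (\<psi> i) (observed_process K x eps i w)) \<partial>M')"
      unfolding \<mu>'_def using pp[OF that] by (subst nn_integral_distr[OF M'.observed_measurable(1)]) auto
    also have "\<dots> = ennreal (\<Prod>i<n. exp (LINT t:{0..<1}|lborel. (\<psi> i t - 1) * ell' t))"
      unfolding ell'_def using lam'(1) c
      by (intro M'.observed_generating_functional[OF g g_eq _ _ lam'(2,3) that]) (auto intro: order_trans[of 0 c])
    finally show ?thesis .
  qed
  have scaled: "(\<integral>\<^sup>+p. ennreal (\<Prod>i<n. F * point_prod (\<psi> i) (p i)) \<partial>\<mu>')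
      = ennreal (\<Prod>i<n. F * exp (LINT t:{0..<1}|lborel. (\<psi> i t - 1) * ell' t))"
    if "\<And>i. \<psi> i \<in> borel_measurable borel" "\<And>i x. 0 \<le> \<psi> i x" "\<And>i x. \<psi> i x \<le> C" "0 \<le> F" for \<psi> C F
  proof -
    have "(\<integral>\<^sup>+p. ennreal (\<Prod>i<n. F * point_prod (\<psi> i) (p i)) \<partial>\<mu>')
        = (\<integral>\<^sup>+p. ennreal (F ^ n) * ennreal (\<Prod>i<n. point_prod (\<psi> i) (p i)) \<partial>\<mu>')"
      using that by (intro nn_integral_cong) (simp add: prod.distrib ennreal_mult prod_nonneg point_prod_nonneg)
    also have "\<dots> = ennreal (F ^ n) * (\<integral>\<^sup>+p. ennreal (\<Prod>i<n. point_prod (\<psi> i) (p i)) \<partial>\<mu>')"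
      using pp[OF that(1-3)] by (intro nn_integral_cmult) auto
    also have "\<dots> = ennreal (\<Prod>i<n. F * exp (LINT t:{0..<1}|lborel. (\<psi> i t - 1) * ell' t))"
      using that by (subst law'[OF that(1-3)]) (auto simp: prod.distrib ennreal_mult prod_nonneg)
    finally show ?thesis .
  qed
  have integ: "set_integrable lborel {0..<1} ell" "set_integrable lborel {0..<1} ell'"
    using ell ell' pos by (auto intro!: bounded_set_integrable[where C=L] simp: abs_of_pos)
  show Z_meas: "Z \<in> borel_measurable \<mu>'"
    unfolding Z_def' prod.distrib using pp[of "\<lambda>_. q" "L / c"] q by simp
  show Z_nonneg: "0 \<le> Z p" for p
    unfolding Z_def' using E q by (intro prod_nonneg mult_nonneg_nonneg point_prod_nonneg) auto
  have Z_law: "(\<integral>\<^sup>+p. ennreal (Z p) * ennreal (\<Prod>i<n. point_prod (\<psi> i) (p i)) \<partial>\<mu>')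
      = ennreal (\<Prod>i<n. exp (LINT t:{0..<1}|lborel. (\<psi> i t - 1) * ell t))"
    if \<psi>: "\<And>i. \<psi> i \<in> borel_measurable borel" "\<And>i x. 0 \<le> \<psi> i x" "\<And>i x. \<psi> i x \<le> 1" for \<psi>
  proof -
    note [measurable] = \<psi>(1)
    have "(\<integral>\<^sup>+p. ennreal (Z p) * ennreal (\<Prod>i<n. point_prod (\<psi> i) (p i)) \<partial>\<mu>')
        = (\<integral>\<^sup>+p. ennreal (\<Prod>i<n. E * point_prod (\<lambda>t. q t * \<psi> i t) (p i)) \<partial>\<mu>')"
      using \<psi> Z_nonneg
      by (intro nn_integral_cong)
        (simp add: ennreal_mult[symmetric] prod_nonneg point_prod_nonneg Z_def' prod.distrib[symmetric]
          point_prod_mult[symmetric] mult.assoc)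
    also have "\<dots> = ennreal (\<Prod>i<n. E * exp (LINT t:{0..<1}|lborel. (q t * \<psi> i t - 1) * ell' t))"
    proof (rule scaled[of "\<lambda>i t. q t * \<psi> i t" "L / c * 1" E])
      show "q x * \<psi> i x \<le> L / c * 1" for i x using \<psi> q c L by (intro mult_mono) auto
    qed (use \<psi> q E in auto)
    also have "(\<Prod>i<n. E * exp (LINT t:{0..<1}|lborel. (q t * \<psi> i t - 1) * ell' t))
        = (\<Prod>i<n. exp (LINT t:{0..<1}|lborel. (\<psi> i t - 1) * ell t))"
    proof (intro prod.cong refl)
      fix i
      have int\<psi>: "set_integrable lborel {0..<1} (\<lambda>t. \<psi> i t * ell t)"
      proof (rule bounded_set_integrable[where C="1 * L"])
        fix t
        show "\<bar>\<psi> i t * ell t\<bar> \<le> 1 * L"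
          unfolding abs_mult using \<psi>(2,3)[of i t] ell(2)[of t] pos(1)[of t] by (intro mult_mono) auto
      qed measurable
      \<comment> \<open>Multiplying by \<open>ell'\<close> clears the denominator of
        \<open>q\<close>; the factor \<open>E\<close> then trades the total mass of
        \<open>ell'\<close> for that of \<open>ell\<close>.\<close>
      have "(LINT t:{0..<1}|lborel. (q t * \<psi> i t - 1) * ell' t) = (LINT t:{0..<1}|lborel. \<psi> i t * ell t - ell' t)"
        using pos(2) by (intro set_lebesgue_integral_cong) (auto simp: q_def left_diff_distrib less_imp_neq[THEN not_sym])
      also have "\<dots> = (LINT t:{0..<1}|lborel. \<psi> i t * ell t) - (LINT t:{0..<1}|lborel. ell' t)"
        using int\<psi> integ by (intro set_integral_diff)
      finally have 1: "(LINT t:{0..<1}|lborel. (q t * \<psi> i t - 1) * ell' t)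
        = (LINT t:{0..<1}|lborel. \<psi> i t * ell t) - (LINT t:{0..<1}|lborel. ell' t)" .
      have 2: "(LINT t:{0..<1}|lborel. (\<psi> i t - 1) * ell t) = (LINT t:{0..<1}|lborel. \<psi> i t * ell t) - (LINT t:{0..<1}|lborel. ell t)"
        unfolding left_diff_distrib using int\<psi> integ by (subst set_integral_diff(2)) auto
      show "E * exp (LINT t:{0..<1}|lborel. (q t * \<psi> i t - 1) * ell' t) = exp (LINT t:{0..<1}|lborel. (\<psi> i t - 1) * ell t)"
        unfolding 1 2 E_def exp_add[symmetric] by simp
    qed
    finally show ?thesis .
  qed
  show Z_total: "(\<integral>\<^sup>+p. ennreal (Z p) \<partial>\<mu>') = 1"
    using Z_law[of "\<lambda>_ _. 1"] by (simp add: point_prod_const)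
  show "\<mu> = density \<mu>' (\<lambda>p. ennreal (Z p))"
  proof (rule measure_eqI_generating_functional)
    show "finite_measure \<mu>" by unfold_locales
    show "finite_measure (density \<mu>' (\<lambda>p. ennreal (Z p)))"
      using Z_meas Z_total by (intro finite_measureI) (simp add: emeasure_density)
    show "sets \<mu> = sets ?A" "sets (density \<mu>' (\<lambda>p. ennreal (Z p))) = sets ?A"
      using sets_\<mu> by auto
    fix \<psi> :: "nat \<Rightarrow> real \<Rightarrow> real"
    assume \<psi>: "\<And>i. \<psi> i \<in> borel_measurable borel" "\<And>i x. 0 \<le> \<psi> i x" "\<And>i x. \<psi> i x \<le> 1"
    have "(\<integral>\<^sup>+p. ennreal (\<Prod>i<n. point_prod (\<psi> i) (p i)) \<partial>density \<mu>' (\<lambda>p. ennreal (Z p)))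
        = (\<integral>\<^sup>+p. ennreal (Z p) * ennreal (\<Prod>i<n. point_prod (\<psi> i) (p i)) \<partial>\<mu>')"
      using Z_meas pp[OF \<psi>] by (subst nn_integral_density) auto
    then show "(\<integral>\<^sup>+p. ennreal (\<Prod>i<n. point_prod (\<psi> i) (p i)) \<partial>\<mu>)
        = (\<integral>\<^sup>+p. ennreal (\<Prod>i<n. point_prod (\<psi> i) (p i)) \<partial>density \<mu>' (\<lambda>p. ennreal (Z p)))"
      using law[OF \<psi>] Z_law[OF \<psi>] by simp
  qed
  show "ennreal (1 / 2) \<le> (\<integral>\<^sup>+p. ennreal (sqrt (Z p)) \<partial>\<mu>')"
    if close: "real n * (LINT t:{0..<1}|lborel. (ell t - ell' t)\<^sup>2) \<le> 4 * c"
  proof -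
    let ?a = "((LINT t:{0..<1}|lborel. ell' t) - (LINT t:{0..<1}|lborel. ell t)) / 2"
    let ?b = "LINT t:{0..<1}|lborel. (sqrt (q t) - 1) * ell' t"
    have sqrtE: "sqrt E = exp ?a" 
      by (rule real_sqrt_unique) (simp_all add: E_def exp_double[symmetric])
    have sq: "sqrt (q t) \<le> sqrt (L / c)" for t using q by simp
    have int_sq: "set_integrable lborel {0..<1} (\<lambda>t. (sqrt (q t) - 1) * ell' t)"
    proof (rule bounded_set_integrable[where C="(sqrt (L / c) + 1) * L"])
      fix t
      have "\<bar>sqrt (q t) - 1\<bar> \<le> sqrt (L / c) + 1" using sq[of t] real_sqrt_ge_zero[OF q(1)[of t]] by linarith
      then show "\<bar>(sqrt (q t) - 1) * ell' t\<bar> \<le> (sqrt (L / c) + 1) * L"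
        unfolding abs_mult using ell'[of t] pos[of t] L c by (intro mult_mono) (auto simp: abs_of_pos)
    qed measurable
    have int_d2: "set_integrable lborel {0..<1} (\<lambda>t. - ((ell t - ell' t)\<^sup>2 / (8 * c)))"
    proof (rule bounded_set_integrable[where C="L\<^sup>2 / (8 * c)"])
      fix t
      have "\<bar>ell t - ell' t\<bar> \<le> \<bar>L\<bar>" using ell[of t] ell'[of t] pos[of t] by linarith
      then have "(ell t - ell' t)\<^sup>2 \<le> L\<^sup>2" by (simp only: abs_le_square_iff)
      then show "\<bar>- ((ell t - ell' t)\<^sup>2 / (8 * c))\<bar> \<le> L\<^sup>2 / (8 * c)" using c by (simp add: divide_right_mono)
    qed measurable
    have int_half: "set_integrable lborel {0..<1} (\<lambda>t. (ell' t - ell t) / 2)"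
      using integ by (intro set_integrable_divide set_integral_diff) auto
    \<comment> \<open>For a single process \<open>?a + ?b\<close> is the logarithm of the affinity,
      minus half the squared distance of \<open>sqrt ell\<close> and
      \<open>sqrt ell'\<close>.\<close>
    have "?a + ?b = (LINT t:{0..<1}|lborel. (ell' t - ell t) / 2) + ?b"
      using integ by simp
    also have "\<dots> = (LINT t:{0..<1}|lborel. (ell' t - ell t) / 2 + (sqrt (q t) - 1) * ell' t)"
      using int_half int_sq by (intro set_integral_add(2)[symmetric])
    also have "\<dots> \<ge> (LINT t:{0..<1}|lborel. - ((ell t - ell' t)\<^sup>2 / (8 * c)))"
      using int_d2 int_half int_sq ell ell' c
      by (intro set_integral_mono set_integral_add(1)) (auto simp: q_def intro!: hellinger_integrand_bound)
    also have "(LINT t:{0..<1}|lborel. - ((ell t - ell' t)\<^sup>2 / (8 * c)))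
        = - ((LINT t:{0..<1}|lborel. (ell t - ell' t)\<^sup>2) / (8 * c))"
      by (simp add: set_lebesgue_integral_def)
    finally have ab: "- ((LINT t:{0..<1}|lborel. (ell t - ell' t)\<^sup>2) / (8 * c)) \<le> ?a + ?b" .
    \<comment> \<open>Against the \<open>8 * c\<close> of the pointwise bound, the closeness
      assumption makes the total exponent at least -1/2; 1 + x <= exp x then gives affinity at least
      1/2.\<close>
    have "(1 / 2 :: real) \<le> exp (- 1 / 2)" 
      using exp_ge_add_one_self[of "- 1 / 2 :: real"] by simp
    also have "\<dots> \<le> exp (real n * (?a + ?b))"
    proof -
      have "real n * (LINT t:{0..<1}|lborel. (ell t - ell' t)\<^sup>2) / (8 * c) \<le> 4 * c / (8 * c)"
        using close c by (intro divide_right_mono) auto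
      then have "- 1 / 2 \<le> real n * (- ((LINT t:{0..<1}|lborel. (ell t - ell' t)\<^sup>2) / (8 * c)))"
        using c by simp
      also have "\<dots> \<le> real n * (?a + ?b)" using ab by (intro mult_left_mono) auto
      finally show ?thesis by simp
    qed
    also have "\<dots> = (\<Prod>i<n. sqrt E * exp ?b)"
      unfolding sqrtE exp_add[symmetric] by (simp add: exp_of_nat_mult)
    finally have "ennreal (1 / 2) \<le> ennreal (\<Prod>i<n. sqrt E * exp ?b)" by (rule ennreal_leI)
    also have "\<dots> = (\<integral>\<^sup>+p. ennreal (\<Prod>i<n. sqrt E * point_prod (\<lambda>t. sqrt (q t)) (p i)) \<partial>\<mu>')"
      using q sq E by (intro scaled[of "\<lambda>_ t. sqrt (q t)" "sqrt (L / c)" "sqrt E", symmetric]) auto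
    also have "\<dots> = (\<integral>\<^sup>+p. ennreal (sqrt (Z p)) \<partial>\<mu>')"
      using q by (intro nn_integral_cong) (simp add: Z_def' sqrt_prod real_sqrt_mult sqrt_point_prod)
    finally show ?thesis .
  qed
qed

text \<open>The sample has one law \<open>\<kappa>\<close> under both measures, so it is integrated
  last and the density inequality applies for each fixed value \<open>y\<close> of it.\<close>

lemma two_point_bound:
  fixes M M' :: "'w measure"
  assumes M: "poisson_deconvolution M lam f n m K x eps Y"
    and M': "poisson_deconvolution M' lam' f n m K x eps Y"
    and m: "1 \<le> m"
    and g: "real_density g" and g_eq: "AE t in lborel. ennreal (indicator {0..<1} t * f t) = ennreal (g t)"
    and lam_meas: "lam \<in> borel_measurable borel" "lam' \<in> borel_measurable borel"
    and c: "0 < c"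
    and lam: "\<And>x. c \<le> lam x" "\<And>x. lam x \<le> L" "\<And>x. lam (x + 1) = lam x"
    and lam': "\<And>x. c \<le> lam' x" "\<And>x. lam' x \<le> L" "\<And>x. lam' (x + 1) = lam' x"
    and close: "real n * (LINT t:{0..<1}|lborel.
        (real_density.convolved g lam t - real_density.convolved g lam' t)\<^sup>2) \<le> 4 * c"
    and ab [measurable]: "a \<in> borel_measurable (obs_space n m)" "b \<in> borel_measurable (obs_space n m)"
    and D: "0 \<le> D" "\<And>z. z \<in> space (obs_space n m) \<Longrightarrow> D \<le> a z + b z"
  shows "ennreal (D\<^sup>2 / 8) \<le> (\<integral>\<^sup>+w. ennreal ((a (observation n m K x eps Y w))\<^sup>2) \<partial>M)
      + (\<integral>\<^sup>+w. ennreal ((b (observation n m K x eps Y w))\<^sup>2) \<partial>M')"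
proof -
  interpret M: poisson_deconvolution M lam f n m K x eps Y by fact
  interpret M': poisson_deconvolution M' lam' f n m K x eps Y by fact
  let ?A = "PiM {..<n} (\<lambda>_. config_space)"
  let ?B = "PiM {..<m} (\<lambda>_. borel)"
  define \<mu> where "\<mu> = distr M ?A (\<lambda>w. \<lambda>i\<in>{..<n}. observed_process K x eps i w)"
  define \<mu>' where "\<mu>' = distr M' ?A (\<lambda>w. \<lambda>i\<in>{..<n}. observed_process K x eps i w)"
  define \<kappa> where "\<kappa> = distr M ?B (\<lambda>w. \<lambda>k\<in>{..<m}. Y k w)"
  define Z where "Z p = (\<Prod>i<n. exp ((LINT t:{0..<1}|lborel. real_density.convolved g lam' t)
      - (LINT t:{0..<1}|lborel. real_density.convolved g lam t))
      * point_prod (\<lambda>t. real_density.convolved g lam t / real_density.convolved g lam' t) (p i))" for p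
  note Z = observed_law_density(1-4)[OF M M' g g_eq lam_meas c lam lam', folded \<mu>_def \<mu>'_def Z_def]
    observed_law_density(5)[OF M M' g g_eq lam_meas c lam lam' close, folded \<mu>'_def Z_def]
  have \<kappa>': "distr M' ?B (\<lambda>w. \<lambda>k\<in>{..<m}. Y k w) = \<kappa>"
    unfolding \<kappa>_def M.sample_law[OF m] M'.sample_law[OF m] ..
  interpret \<mu>: prob_space \<mu> unfolding \<mu>_def by (rule M.prob_space_distr[OF M.observed_measurable(1)])
  interpret \<mu>': prob_space \<mu>' unfolding \<mu>'_def by (rule M'.prob_space_distr[OF M'.observed_measurable(1)])
  interpret \<kappa>: prob_space \<kappa> unfolding \<kappa>_def by (rule M.prob_space_distr[OF M.observed_measurable(2)])
  interpret P: pair_prob_space \<mu> \<kappa> ..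
  interpret P': pair_prob_space \<mu>' \<kappa> ..
  have sets [measurable_cong]: "sets \<mu> = sets ?A" "sets \<mu>' = sets ?A" "sets \<kappa> = sets ?B"
    by (simp_all add: \<mu>_def \<mu>'_def \<kappa>_def)
  have cong: "borel_measurable (obs_space n m) = borel_measurable (\<mu> \<Otimes>\<^sub>M \<kappa>)"
    "borel_measurable (obs_space n m) = borel_measurable (\<mu>' \<Otimes>\<^sub>M \<kappa>)"
    unfolding obs_space_def by (intro measurable_cong_sets sets_pair_measure_cong sets[symmetric] refl)+
  have [measurable]: "a \<in> borel_measurable (\<mu> \<Otimes>\<^sub>M \<kappa>)" "a \<in> borel_measurable (\<mu>' \<Otimes>\<^sub>M \<kappa>)"
    "b \<in> borel_measurable (\<mu>' \<Otimes>\<^sub>M \<kappa>)"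
    using ab[unfolded cong(1)] ab[unfolded cong(2)] by auto
  have "(\<integral>\<^sup>+w. ennreal ((a (observation n m K x eps Y w))\<^sup>2) \<partial>M) = (\<integral>\<^sup>+z. ennreal ((a z)\<^sup>2) \<partial>(\<mu> \<Otimes>\<^sub>M \<kappa>))"
    unfolding \<mu>_def \<kappa>_def M.observation_law[symmetric]
    by (subst nn_integral_distr[OF M.observation_measurable]) auto
  also have "\<dots> = (\<integral>\<^sup>+y. \<integral>\<^sup>+p. ennreal ((a (p, y))\<^sup>2) \<partial>\<mu> \<partial>\<kappa>)"
    by (rule P.nn_integral_snd[symmetric]) measurable
  also have "\<dots> = (\<integral>\<^sup>+y. \<integral>\<^sup>+p. ennreal (Z p) * ennreal ((a (p, y))\<^sup>2) \<partial>\<mu>' \<partial>\<kappa>)"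
    unfolding Z(1) using Z(2) by (intro nn_integral_cong nn_integral_density) auto
  finally have Ea: "(\<integral>\<^sup>+w. ennreal ((a (observation n m K x eps Y w))\<^sup>2) \<partial>M)
    = (\<integral>\<^sup>+y. \<integral>\<^sup>+p. ennreal (Z p) * ennreal ((a (p, y))\<^sup>2) \<partial>\<mu>' \<partial>\<kappa>)" .
  have "(\<integral>\<^sup>+w. ennreal ((b (observation n m K x eps Y w))\<^sup>2) \<partial>M') = (\<integral>\<^sup>+z. ennreal ((b z)\<^sup>2) \<partial>(\<mu>' \<Otimes>\<^sub>M \<kappa>))"
    unfolding \<mu>'_def \<kappa>'[symmetric] M'.observation_law[symmetric]
    by (subst nn_integral_distr[OF M'.observation_measurable]) auto
  also have "\<dots> = (\<integral>\<^sup>+y. \<integral>\<^sup>+p. ennreal ((b (p, y))\<^sup>2) \<partial>\<mu>' \<partial>\<kappa>)"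
    by (rule P'.nn_integral_snd[symmetric]) measurable
  finally have Eb: "(\<integral>\<^sup>+w. ennreal ((b (observation n m K x eps Y w))\<^sup>2) \<partial>M')
    = (\<integral>\<^sup>+y. \<integral>\<^sup>+p. ennreal ((b (p, y))\<^sup>2) \<partial>\<mu>' \<partial>\<kappa>)" .
  have [measurable]: "Z \<in> borel_measurable \<mu>'" by (rule Z(2))
  have "ennreal (D\<^sup>2 / 8) = (\<integral>\<^sup>+y. ennreal (D\<^sup>2 / 8) \<partial>\<kappa>)" by (simp add: \<kappa>.emeasure_space_1)
  also have "\<dots> \<le> (\<integral>\<^sup>+y. (\<integral>\<^sup>+p. ennreal (Z p) * ennreal ((a (p, y))\<^sup>2) \<partial>\<mu>') + (\<integral>\<^sup>+p. ennreal ((b (p, y))\<^sup>2) \<partial>\<mu>') \<partial>\<kappa>)"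
  proof (rule nn_integral_mono)
    fix y assume y: "y \<in> space \<kappa>"
    then have [measurable]: "(\<lambda>p. a (p, y)) \<in> borel_measurable \<mu>'" "(\<lambda>p. b (p, y)) \<in> borel_measurable \<mu>'"
      by measurable
    show "ennreal (D\<^sup>2 / 8) \<le> (\<integral>\<^sup>+p. ennreal (Z p) * ennreal ((a (p, y))\<^sup>2) \<partial>\<mu>') + (\<integral>\<^sup>+p. ennreal ((b (p, y))\<^sup>2) \<partial>\<mu>')"
    proof (rule two_point_density[OF \<mu>'.prob_space_axioms _ _ _ Z(3,4,5) D(1)])
      fix p assume "p \<in> space \<mu>'"
      then have "(p, y) \<in> space (obs_space n m)"
        using y sets_eq_imp_space_eq[OF sets(2)] sets_eq_imp_space_eq[OF sets(3)]
        by (auto simp: obs_space_def space_pair_measure)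
      then show "D \<le> a (p, y) + b (p, y)" by (rule D(2))
    qed measurable
  qed
  also have "\<dots> = (\<integral>\<^sup>+y. \<integral>\<^sup>+p. ennreal (Z p) * ennreal ((a (p, y))\<^sup>2) \<partial>\<mu>' \<partial>\<kappa>) + (\<integral>\<^sup>+y. \<integral>\<^sup>+p. ennreal ((b (p, y))\<^sup>2) \<partial>\<mu>' \<partial>\<kappa>)"
    by (rule nn_integral_add) measurable
  finally show ?thesis unfolding Ea Eb .
qed

section \<open>Trigonometric polynomials\<close>

lemma basis_fun_add: "basis_fun j (s + t) = basis_fun j s * basis_fun j t"
  by (simp add: basis_fun_def exp_add[symmetric] algebra_simps)

lemma basis_fun_zero [simp]: "basis_fun 0 t = 1" "basis_fun j 0 = 1"
  by (simp_all add: basis_fun_def)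

lemma basis_fun_cis: "basis_fun j t = cis (2 * pi * of_int j * t)"
  by (simp add: basis_fun_def cis_conv_exp mult_ac)

lemma norm_basis_fun [simp]: "norm (basis_fun j t) = 1"
  by (simp add: basis_fun_cis)

lemma basis_fun_one: "basis_fun j 1 = 1"
  unfolding basis_fun_cis using cis_multiple_2pi[of "of_int j"] by (simp add: mult_ac)

lemma basis_fun_periodic: "basis_fun j (t + 1) = basis_fun j t"
  by (simp add: basis_fun_add basis_fun_one)

lemma basis_fun_diff: "basis_fun i t * basis_fun j (- t) = basis_fun (i - j) t"
  by (simp add: basis_fun_cis cis_mult algebra_simps)

lemma cnj_basis_fun: "cnj (basis_fun j t) = basis_fun j (- t)"
  by (simp add: basis_fun_cis cis_cnj)

lemma borel_measurable_basis_fun [measurable]: "basis_fun j \<in> borel_measurable borel"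
  unfolding basis_fun_def by (intro borel_measurable_continuous_onI continuous_intros)

lemma integral_basis_fun: "(LINT t:{0..<1}|lborel. basis_fun j t) = (if j = 0 then 1 else 0)"
proof (cases "j = 0")
  case True
  then show ?thesis by (simp add: set_lebesgue_integral_def)
next
  case False
  let ?w = "2 * of_real pi * \<i> * of_int j :: complex"
  have w: "?w \<noteq> 0" using False by simp
  have "(LINT t:{0..<1}|lborel. basis_fun j t) = (\<integral>t. indicator {0..1} t *\<^sub>R basis_fun j t \<partial>lborel)"
    unfolding set_lebesgue_integral_def
  proof (rule integral_cong_AE)
    have "AE t in lborel. t \<noteq> (1::real)" by (rule AE_lborel_singleton)
    then show "AE t in lborel. indicat_real {0..<1} t *\<^sub>R basis_fun j t = indicat_real {0..1} t *\<^sub>R basis_fun j t"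
      by eventually_elim (auto simp: indicator_def)
  qed measurable
  also have "\<dots> = basis_fun j 1 / ?w - basis_fun j 0 / ?w"
  proof (rule integral_FTC_Icc)
    fix t :: real
    have "((\<lambda>z. exp (?w * z) / ?w) has_field_derivative exp (?w * of_real t)) (at (of_real t))"
      using w by (auto intro!: derivative_eq_intros)
    then have "((\<lambda>t. exp (?w * of_real t) / ?w) has_vector_derivative exp (?w * of_real t)) (at t within {0..1})"
      by (rule has_vector_derivative_real_field)
    then show "((\<lambda>t. basis_fun j t / ?w) has_vector_derivative basis_fun j t) (at t within {0..1})"
      by (simp add: basis_fun_def)
  next
    show "continuous_on {0..1} (basis_fun j)"
      unfolding basis_fun_def by (intro continuous_intros)
  qed simp
  finally show ?thesis using False by (simp add: basis_fun_one)
qed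

lemma fourier_coeff_trig:
  assumes "finite J"
  shows "fourier_coeff (\<lambda>t. \<Sum>i\<in>J. c i * basis_fun i t) j = (if j \<in> J then c j else 0)"
proof -
  have "fourier_coeff (\<lambda>t. \<Sum>i\<in>J. c i * basis_fun i t) j = (LINT t:{0..<1}|lborel. \<Sum>i\<in>J. c i * basis_fun (i - j) t)"
    by (simp add: fourier_coeff_def sum_distrib_right mult.assoc basis_fun_diff)
  also have "\<dots> = (\<Sum>i\<in>J. LINT t:{0..<1}|lborel. c i * basis_fun (i - j) t)"
    unfolding set_lebesgue_integral_def scaleR_sum_right
  proof (rule Bochner_Integration.integral_sum)
    fix i
    have "set_integrable lborel {0..<1::real} (\<lambda>t. c i * basis_fun (i - j) t)"
      by (rule bounded_set_integrable_banach[where C="norm (c i)"]) (auto simp: norm_mult)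
    then show "integrable lborel (\<lambda>t. indicat_real {0..<1} t *\<^sub>R (c i * basis_fun (i - j) t))"
      by (simp add: set_integrable_def)
  qed
  also have "\<dots> = (\<Sum>i\<in>J. c i * (if i = j then 1 else 0))"
    by (simp add: integral_basis_fun)
  also have "\<dots> = (if j \<in> J then c j else 0)" using assms by (simp add: sum.delta if_distrib cong: if_cong)
  finally show ?thesis .
qed

text \<open>Only the conjugate factor is expanded, so the integrals left over are Fourier
  coefficients of the polynomial itself.\<close>

lemma parseval_trig:
  assumes "finite J"
  shows "(LINT t:{0..<1}|lborel. (norm (\<Sum>i\<in>J. a i * basis_fun i t))\<^sup>2) = (\<Sum>i\<in>J. (norm (a i))\<^sup>2)"
proof -
  let ?h = "\<lambda>t. \<Sum>i\<in>J. a i * basis_fun i t"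
  have "complex_of_real (LINT t:{0..<1}|lborel. (norm (?h t))\<^sup>2)
      = (LINT t:{0..<1}|lborel. \<Sum>j\<in>J. cnj (a j) * (?h t * basis_fun j (- t)))"
    unfolding set_integral_complex_of_real[symmetric]
  proof (intro arg_cong[where f="set_lebesgue_integral lborel {0..<1}"] ext)
    fix t
    have "complex_of_real ((norm (?h t))\<^sup>2) = ?h t * cnj (?h t)" by (rule complex_norm_square)
    also have "\<dots> = (\<Sum>j\<in>J. cnj (a j) * (?h t * basis_fun j (- t)))"
      by (simp add: cnj_basis_fun sum_distrib_left mult_ac)
    finally show "complex_of_real ((norm (?h t))\<^sup>2) = (\<Sum>j\<in>J. cnj (a j) * (?h t * basis_fun j (- t)))" .
  qed
  also have "\<dots> = (\<Sum>j\<in>J. LINT t:{0..<1}|lborel. cnj (a j) * (?h t * basis_fun j (- t)))"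
    unfolding set_lebesgue_integral_def scaleR_sum_right
  proof (rule Bochner_Integration.integral_sum)
    fix j
    have "set_integrable lborel {0..<1::real} (\<lambda>t. cnj (a j) * (?h t * basis_fun j (- t)))"
    proof (rule bounded_set_integrable_banach[where C="norm (a j) * (\<Sum>i\<in>J. norm (a i))"])
      fix t
      have "norm (?h t) \<le> (\<Sum>i\<in>J. norm (a i))"
        by (rule order_trans[OF norm_sum]) (simp add: norm_mult)
      then show "norm (cnj (a j) * (?h t * basis_fun j (- t))) \<le> norm (a j) * (\<Sum>i\<in>J. norm (a i))"
        by (simp add: norm_mult mult_left_mono)
    qed measurable
    then show "integrable lborel (\<lambda>t. indicat_real {0..<1} t *\<^sub>R (cnj (a j) * (?h t * basis_fun j (- t))))"
      by (simp add: set_integrable_def)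
  qed
  also have "\<dots> = (\<Sum>j\<in>J. cnj (a j) * fourier_coeff ?h j)"
    by (simp add: fourier_coeff_def)
  also have "\<dots> = complex_of_real (\<Sum>j\<in>J. (norm (a j))\<^sup>2)"
    unfolding fourier_coeff_trig[OF assms]
    by (simp add: complex_norm_square mult.commute del: of_real_power)
  finally show ?thesis by (simp only: of_real_eq_iff)
qed

section \<open>Square-integrable functions and weighted norms\<close>

lemma L2_set_integrable:
  assumes "g \<in> L2"
  shows "set_integrable lborel {0..<1} g"
  unfolding set_integrable_def
proof (rule Bochner_Integration.integrable_bound)
  have "integrable lborel (\<lambda>x. indicat_real {0..<1::real} x + indicator {0..<1} x *\<^sub>R (cmod (g x))\<^sup>2)"
    using assms unfolding L2_def set_integrable_def
    by (intro Bochner_Integration.integrable_add integrable_real_indicator) auto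
  then show "integrable lborel (\<lambda>x. indicat_real {0..<1::real} x + indicator {0..<1} x *\<^sub>R (cmod (g x))\<^sup>2)" .
  show "(\<lambda>x. indicat_real {0..<1} x *\<^sub>R g x) \<in> borel_measurable lborel"
    using assms by (simp add: L2_def set_borel_measurable_def)
  show "AE x in lborel. norm (indicat_real {0..<1} x *\<^sub>R g x)
      \<le> norm (indicat_real {0..<1::real} x + indicator {0..<1} x *\<^sub>R (cmod (g x))\<^sup>2)"
  proof (rule AE_I2)
    fix x
    have "0 \<le> (norm (g x) - 1/2)\<^sup>2" by simp
    then have "norm (g x) \<le> 1 + (norm (g x))\<^sup>2" by (simp add: power2_eq_square algebra_simps)
    then show "norm (indicat_real {0..<1} x *\<^sub>R g x)
      \<le> norm (indicat_real {0..<1::real} x + indicator {0..<1} x *\<^sub>R (cmod (g x))\<^sup>2)"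
      by (auto simp: indicator_def)
  qed
qed

lemma L2_fourier_integrable:
  assumes "g \<in> L2"
  shows "set_integrable lborel {0..<1} (\<lambda>t. g t * basis_fun j (- t))"
  unfolding set_integrable_def
proof (rule Bochner_Integration.integrable_bound)
  show "integrable lborel (\<lambda>x. indicat_real {0..<1} x *\<^sub>R g x)"
    using L2_set_integrable[OF assms] by (simp add: set_integrable_def)
  have [measurable]: "(\<lambda>x. indicat_real {0..<1} x *\<^sub>R g x) \<in> borel_measurable lborel"
    using assms by (simp add: L2_def set_borel_measurable_def)
  have "(\<lambda>x. (indicat_real {0..<1} x *\<^sub>R g x) * basis_fun j (- x)) \<in> borel_measurable lborel"
    by measurable
  then show "(\<lambda>x. indicat_real {0..<1} x *\<^sub>R (g x * basis_fun j (- x))) \<in> borel_measurable lborel"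
    by simp
  show "AE x in lborel. norm (indicat_real {0..<1} x *\<^sub>R (g x * basis_fun j (- x))) \<le> norm (indicat_real {0..<1} x *\<^sub>R g x)"
    by (simp add: norm_mult)
qed

lemma fourier_coeff_diff:
  assumes "g \<in> L2" "h \<in> L2"
  shows "fourier_coeff (\<lambda>t. g t - h t) j = fourier_coeff g j - fourier_coeff h j"
  unfolding fourier_coeff_def left_diff_distrib
  by (intro set_integral_diff L2_fourier_integrable assms)

lemma bounded_in_L2:
  assumes [measurable]: "g \<in> borel_measurable borel" and "\<And>x. norm (g x) \<le> C"
  shows "g \<in> L2"
  unfolding L2_def
proof (intro CollectI conjI)
  show "set_borel_measurable lborel {0..<1} g" unfolding set_borel_measurable_def by measurable
  show "set_integrable lborel {0..<1} (\<lambda>t. (cmod (g t))\<^sup>2)"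
    using assms(2) by (intro bounded_set_integrable[where C="C\<^sup>2"]) (auto intro!: power_mono)
qed

lemma wnorm2_ge_sum:
  assumes "finite J"
  shows "(\<Sum>j\<in>J. ennreal (w j * (cmod (fourier_coeff g j))\<^sup>2)) \<le> wnorm2 w g"
proof -
  have "(\<Sum>\<^sub>\<infinity>j\<in>J. ennreal (w j * (cmod (fourier_coeff g j))\<^sup>2)) \<le> wnorm2 w g"
    unfolding wnorm2_def by (rule infsum_mono_neutral) (auto intro!: nonneg_summable_on_complete)
  then show ?thesis using assms by simp
qed

lemma wnorm2_eq_sum:
  assumes "finite J" "\<And>j. j \<notin> J \<Longrightarrow> fourier_coeff g j = 0"
  shows "wnorm2 w g = (\<Sum>j\<in>J. ennreal (w j * (cmod (fourier_coeff g j))\<^sup>2))"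
proof -
  have "wnorm2 w g = (\<Sum>\<^sub>\<infinity>j\<in>J. ennreal (w j * (cmod (fourier_coeff g j))\<^sup>2))"
    unfolding wnorm2_def by (rule infsum_cong_neutral) (use assms in auto)
  then show ?thesis using assms(1) by simp
qed

section \<open>Real trigonometric polynomials and their convolution\<close>

definition trig_poly :: "(int \<Rightarrow> real) \<Rightarrow> nat \<Rightarrow> real \<Rightarrow> real" where
  "trig_poly c k t = Re (\<Sum>j\<in>{- int k..int k}. of_real (c j) * basis_fun j t)"

lemma trig_poly_measurable [measurable]: "trig_poly c k \<in> borel_measurable borel"
  unfolding trig_poly_def by measurable

lemma trig_poly_periodic: "trig_poly c k (t + 1) = trig_poly c k t"
  by (simp add: trig_poly_def basis_fun_periodic)

lemma trig_poly_bound: "\<bar>trig_poly c k t\<bar> \<le> (\<Sum>j\<in>{- int k..int k}. \<bar>c j\<bar>)"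
proof -
  have "\<bar>trig_poly c k t\<bar> \<le> norm (\<Sum>j\<in>{- int k..int k}. of_real (c j) * basis_fun j t)"
    unfolding trig_poly_def by (rule abs_Re_le_cmod)
  also have "\<dots> \<le> (\<Sum>j\<in>{- int k..int k}. \<bar>c j\<bar>)"
    by (rule order_trans[OF norm_sum]) (simp add: norm_mult)
  finally show ?thesis .
qed

text \<open>The imaginary part is odd under the reflection of \<open>j\<close> to
  \<open>- j\<close>, so for even coefficients the \<open>Re\<close> in \<open>trig_poly\<close>
  discards nothing.\<close>

lemma of_real_trig_poly:
  assumes "\<And>j. c (- j) = c j"
  shows "complex_of_real (trig_poly c k t) = (\<Sum>j\<in>{- int k..int k}. of_real (c j) * basis_fun j t)"
proof -
  let ?S = "\<Sum>j\<in>{- int k..int k}. c j * sin (2 * pi * of_int j * t)"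
  have im: "Im (\<Sum>j\<in>{- int k..int k}. of_real (c j) * basis_fun j t) = ?S"
    by (simp add: basis_fun_cis)
  have "?S
      = (\<Sum>j\<in>{- int k..int k}. c (- j) * sin (2 * pi * of_int (- j) * t))"
    by (rule sum.reindex_bij_witness[of _ uminus uminus]) auto
  also have "\<dots> = - ?S"
    unfolding sum_negf[symmetric] by (intro sum.cong refl) (simp add: assms)
  finally have "?S = 0" by simp
  with im have "Im (\<Sum>j\<in>{- int k..int k}. of_real (c j) * basis_fun j t) = 0" by (rule trans)
  then show ?thesis by (simp add: trig_poly_def complex_eq_iff)
qed

lemma fourier_coeff_trig_poly:
  assumes "\<And>j. c (- j) = c j"
  shows "fourier_coeff (\<lambda>t. complex_of_real (trig_poly c k t)) j = (if j \<in> {- int k..int k} then of_real (c j) else 0)"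
  unfolding of_real_trig_poly[of c, OF assms] by (rule fourier_coeff_trig) simp

lemma trig_poly_in_L2: "(\<lambda>t. complex_of_real (trig_poly c k t)) \<in> L2"
  by (rule bounded_in_L2[where C="\<Sum>j\<in>{- int k..int k}. \<bar>c j\<bar>"]) (simp_all add: trig_poly_bound)

text \<open>The basis functions are characters, hence eigenfunctions of the convolution; the
  eigenvalue is the Fourier integral of the density, taken over the whole line.\<close>

lemma (in real_density) convolved_trig_poly:
  "convolved (trig_poly c k) t
    = Re (\<Sum>j\<in>{- int k..int k}. of_real (c j) * (LINT e|lborel. f e *\<^sub>R basis_fun j (- e)) * basis_fun j t)"
proof -
  let ?h = "\<lambda>j e. of_real (c j) * (f e *\<^sub>R basis_fun j (- e)) * basis_fun j t"
  have int: "integrable lborel (\<lambda>e. f e *\<^sub>R basis_fun j (- e))" for j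
    by (rule f_mult_integrable[where C=1]) auto
  have "convolved (trig_poly c k) t = (LINT e|lborel. Re (\<Sum>j\<in>{- int k..int k}. ?h j e))"
    unfolding convolved_def trig_poly_def
  proof (intro Bochner_Integration.integral_cong refl)
    fix e
    have "(\<Sum>j\<in>{- int k..int k}. ?h j e)
        = of_real (f e) * (\<Sum>j\<in>{- int k..int k}. of_real (c j) * basis_fun j (t - e))"
      unfolding sum_distrib_left
    proof (rule sum.cong[OF refl])
      fix j
      have "basis_fun j (t - e) = basis_fun j t * basis_fun j (- e)"
        using basis_fun_add[of j t "- e"] by simp
      then show "?h j e = of_real (f e) * (of_real (c j) * basis_fun j (t - e))"
        by (simp add: scaleR_conv_of_real mult_ac)
    qed
    then show "f e * Re (\<Sum>j\<in>{- int k..int k}. of_real (c j) * basis_fun j (t - e))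
        = Re (\<Sum>j\<in>{- int k..int k}. ?h j e)"
      by (simp del: Re_sum)
  qed
  also have "\<dots> = Re (LINT e|lborel. (\<Sum>j\<in>{- int k..int k}. ?h j e))"
    by (intro integral_Re Bochner_Integration.integrable_sum integrable_mult_left integrable_mult_right int)
  also have "(LINT e|lborel. (\<Sum>j\<in>{- int k..int k}. ?h j e))
      = (\<Sum>j\<in>{- int k..int k}. LINT e|lborel. ?h j e)"
    by (intro Bochner_Integration.integral_sum integrable_mult_left integrable_mult_right int)
  also have "\<dots> = (\<Sum>j\<in>{- int k..int k}. of_real (c j) * (LINT e|lborel. f e *\<^sub>R basis_fun j (- e)) * basis_fun j t)"
    by (intro sum.cong refl) (simp only: integral_mult_right_zero integral_mult_left_zero)
  finally show ?thesis .
qed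

text \<open>Restriction to the unit interval and truncation at 0 give the everywhere non-negative
  representative that \<open>real_density\<close> asks for.\<close>

definition density_version :: "(real \<Rightarrow> real) \<Rightarrow> real \<Rightarrow> real" where
  "density_version f t = max 0 (indicator {0..<1} t * f t)"

lemma density_version:
  assumes f: "f \<in> density_class \<alpha> d"
  shows "AE t in lborel. ennreal (indicator {0..<1} t * f t) = ennreal (density_version f t)"
    and "real_density (density_version f)"
    and "(LINT e|lborel. density_version f e *\<^sub>R basis_fun j (- e)) = fourier_coeff (\<lambda>t. complex_of_real (f t)) j"
proof -
  have L2: "(\<lambda>t. complex_of_real (f t)) \<in> L2" and pos: "AE t\<in>{0..<1} in lborel. 0 \<le> f t"
    and f0: "fourier_coeff (\<lambda>t. complex_of_real (f t)) 0 = 1"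
    using f by (auto simp: density_class_def)
  \<comment> \<open>Membership in \<open>L2\<close> yields measurability of \<open>f\<close> on the
    unit interval only.\<close>
  have "(\<lambda>t. Re (indicat_real {0..<1} t *\<^sub>R complex_of_real (f t))) \<in> borel_measurable lborel"
    by (rule measurable_compose[OF _ borel_measurable_Re])
      (use L2 in \<open>simp add: L2_def set_borel_measurable_def\<close>)
  then have m: "(\<lambda>t. indicator {0..<1} t * f t) \<in> borel_measurable borel" by simp
  then have [measurable]: "density_version f \<in> borel_measurable borel"
    unfolding density_version_def[abs_def] by measurable
  have eq: "AE t in lborel. indicator {0..<1} t * f t = density_version f t"
    using pos by eventually_elim (auto simp: density_version_def indicator_def)
  then show "AE t in lborel. ennreal (indicator {0..<1} t * f t) = ennreal (density_version f t)"
    by eventually_elim simp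
  show fc: "(LINT e|lborel. density_version f e *\<^sub>R basis_fun j (- e)) = fourier_coeff (\<lambda>t. complex_of_real (f t)) j" for j
    unfolding fourier_coeff_def set_lebesgue_integral_def
  proof (rule integral_cong_AE)
    have "(\<lambda>e. (indicator {0..<1} e * f e) *\<^sub>R basis_fun j (- e)) \<in> borel_measurable lborel"
      using m by measurable
    then show "(\<lambda>e. indicat_real {0..<1} e *\<^sub>R (complex_of_real (f e) * basis_fun j (- e))) \<in> borel_measurable lborel"
      by (simp add: scaleR_conv_of_real mult.assoc)
    show "AE e in lborel. density_version f e *\<^sub>R basis_fun j (- e)
        = indicat_real {0..<1} e *\<^sub>R (complex_of_real (f e) * basis_fun j (- e))"
      using eq by eventually_elim (auto simp: scaleR_conv_of_real indicator_def)
  qed measurable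
  have "integrable lborel (\<lambda>t. Re (indicat_real {0..<1} t *\<^sub>R complex_of_real (f t)))"
    using L2_set_integrable[OF L2] unfolding set_integrable_def by (rule integrable_Re)
  then have "integrable lborel (\<lambda>t. indicator {0..<1} t * f t)" by simp
  then have int: "integrable lborel (density_version f)"
    by (rule integrable_cong_AE_imp) (use eq in auto)
  show "real_density (density_version f)"
  proof
    show "density_version f \<in> borel_measurable borel" by measurable
    show "0 \<le> density_version f e" for e by (simp add: density_version_def)
    have "complex_of_real (LINT e|lborel. density_version f e) = 1"
      using fc[of 0] f0 by (simp add: scaleR_conv_of_real)
    then have "(LINT e|lborel. density_version f e) = 1" by (simp only: of_real_eq_1_iff)
    moreover have "AE e in lborel. 0 \<le> density_version f e" by (simp add: density_version_def)
    ultimately show "(\<integral>\<^sup>+e. ennreal (density_version f e) \<partial>lborel) = 1"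
      using nn_integral_eq_integral[OF int] by simp
  qed
qed

text \<open>The real part of a trigonometric polynomial is dominated by its modulus, so Parseval's
  identity bounds the square norm without using that the polynomial is real.\<close>

lemma convolved_trig_poly_distance:
  assumes f: "f \<in> density_class \<alpha> d" and \<alpha>: "\<And>j. 0 < \<alpha> j"
  shows "(LINT t:{0..<1}|lborel. (real_density.convolved (density_version f) (trig_poly c k) t
      - real_density.convolved (density_version f) (trig_poly c' k) t)\<^sup>2)
    \<le> (\<Sum>j\<in>{- int k..int k}. (c j - c' j)\<^sup>2 * (d * \<alpha> j))"
proof -
  interpret g: real_density "density_version f" by (rule density_version(2)[OF f])
  let ?F = "fourier_coeff (\<lambda>t. complex_of_real (f t))"
  define a where "a j = of_real (c j - c' j) * ?F j" for j
  let ?h = "\<lambda>t. \<Sum>j\<in>{- int k..int k}. a j * basis_fun j t"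
  have diff: "g.convolved (trig_poly c k) t - g.convolved (trig_poly c' k) t = Re (?h t)" for t
  proof -
    have "g.convolved (trig_poly c k) t - g.convolved (trig_poly c' k) t
        = Re ((\<Sum>j\<in>{- int k..int k}. of_real (c j) * ?F j * basis_fun j t)
          - (\<Sum>j\<in>{- int k..int k}. of_real (c' j) * ?F j * basis_fun j t))"
      unfolding g.convolved_trig_poly density_version(3)[OF f] by (rule minus_complex.sel(1)[symmetric])
    also have "(\<Sum>j\<in>{- int k..int k}. of_real (c j) * ?F j * basis_fun j t)
          - (\<Sum>j\<in>{- int k..int k}. of_real (c' j) * ?F j * basis_fun j t) = ?h t"
      unfolding sum_subtractf[symmetric] a_def by (intro sum.cong refl) (simp add: algebra_simps)
    finally show ?thesis .
  qed
  have hb: "norm (?h t) \<le> (\<Sum>j\<in>{- int k..int k}. norm (a j))" for t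
    by (rule order_trans[OF norm_sum]) (simp add: norm_mult)
  have Reh: "(Re (?h t))\<^sup>2 \<le> (norm (?h t))\<^sup>2" for t
    using power_mono[OF abs_Re_le_cmod[of "?h t"] abs_ge_zero, of 2] by (simp only: power2_abs)
  have nh: "(norm (?h t))\<^sup>2 \<le> (\<Sum>j\<in>{- int k..int k}. norm (a j))\<^sup>2" for t
    by (intro power_mono hb) simp
  have "(LINT t:{0..<1}|lborel. (Re (?h t))\<^sup>2) \<le> (LINT t:{0..<1}|lborel. (norm (?h t))\<^sup>2)"
  proof (rule set_integral_mono)
    show "set_integrable lborel {0..<1::real} (\<lambda>t. (norm (?h t))\<^sup>2)"
      by (rule bounded_set_integrable[where C="(\<Sum>j\<in>{- int k..int k}. norm (a j))\<^sup>2"])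
        (measurable, simp only: abs_of_nonneg[OF zero_le_power2] nh)
    show "set_integrable lborel {0..<1::real} (\<lambda>t. (Re (?h t))\<^sup>2)"
      by (rule bounded_set_integrable[where C="(\<Sum>j\<in>{- int k..int k}. norm (a j))\<^sup>2"])
        (measurable, simp only: abs_of_nonneg[OF zero_le_power2] order_trans[OF Reh nh])
  qed (rule Reh)
  also have "\<dots> = (\<Sum>j\<in>{- int k..int k}. (norm (a j))\<^sup>2)" by (rule parseval_trig) simp
  also have "\<dots> \<le> (\<Sum>j\<in>{- int k..int k}. (c j - c' j)\<^sup>2 * (d * \<alpha> j))"
  proof (rule sum_mono)
    fix j
    have "(cmod (?F j))\<^sup>2 / \<alpha> j \<le> d" using f by (auto simp: density_class_def)
    then have "(cmod (?F j))\<^sup>2 \<le> d * \<alpha> j" using \<alpha>[of j] by (simp add: pos_divide_le_eq)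
    then have "(c j - c' j)\<^sup>2 * (cmod (?F j))\<^sup>2 \<le> (c j - c' j)\<^sup>2 * (d * \<alpha> j)"
      by (rule mult_left_mono) simp
    then show "(norm (a j))\<^sup>2 \<le> (c j - c' j)\<^sup>2 * (d * \<alpha> j)"
      unfolding a_def norm_mult norm_of_real power_mult_distrib power2_abs .
  qed
  finally show ?thesis unfolding diff .
qed

section \<open>The hypercube of hypotheses\<close>

text \<open>A vertex is the set of those absolute values |j| that carry the sign +1, so j and -j
  share a sign and the intensity is real; \<open>flip l\<close> walks along the edge of coordinate
  \<open>l\<close>.\<close>

definition flip :: "nat \<Rightarrow> nat set \<Rightarrow> nat set" where
  "flip l S = (if l \<in> S then S - {l} else insert l S)"

lemma flip_subset: "l \<le> k \<Longrightarrow> S \<subseteq> {..k} \<Longrightarrow> flip l S \<subseteq> {..k}"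
  by (auto simp: flip_def)

lemma flip_flip [simp]: "flip l (flip l S) = S"
  by (auto simp: flip_def)

lemma mem_flip: "i \<in> flip l S \<longleftrightarrow> (if i = l then i \<notin> S else i \<in> S)"
  by (auto simp: flip_def)

text \<open>Assouad's argument: the maximal risk dominates the average over the hypercube, in which the
  vertices are paired along each coordinate.\<close>

lemma assouad_average:
  fixes e :: "nat set \<Rightarrow> int \<Rightarrow> ennreal" and w u :: "int \<Rightarrow> real"
  assumes w: "\<And>j. 0 \<le> w j" and u: "\<And>j. 0 \<le> u j"
    and upper: "\<And>S. S \<subseteq> {..k} \<Longrightarrow> (\<Sum>j\<in>{- int k..int k}. ennreal (w j) * e S j) \<le> B"
    and lower: "\<And>S j. S \<subseteq> {..k} \<Longrightarrow> j \<in> {- int k..int k} \<Longrightarrow> ennreal (u j) \<le> e S j + e (flip (nat \<bar>j\<bar>) S) j"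
  shows "ennreal ((\<Sum>j\<in>{- int k..int k}. w j * u j) / 2) \<le> B"
proof -
  let ?J = "{- int k..int k}" and ?P = "Pow {..k}"
  define N where "N = real (card ?P)"
  have N: "0 < N" by (simp add: N_def card_Pow)
  have each: "ennreal (N * u j) \<le> 2 * (\<Sum>S\<in>?P. e S j)" if j: "j \<in> ?J" for j
  proof -
    have l: "nat \<bar>j\<bar> \<le> k" using j by auto
    have "ennreal (N * u j) = (\<Sum>S\<in>?P. ennreal (u j))"
      using u by (simp add: N_def ennreal_mult ennreal_of_nat_eq_real_of_nat)
    also have "\<dots> \<le> (\<Sum>S\<in>?P. e S j + e (flip (nat \<bar>j\<bar>) S) j)"
      using j by (intro sum_mono lower) auto
    also have "\<dots> = (\<Sum>S\<in>?P. e S j) + (\<Sum>S\<in>?P. e (flip (nat \<bar>j\<bar>) S) j)" by (rule sum.distrib)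
    \<comment> \<open>Flipping is an involution of the cube, so the sum over all vertices counts
      each edge from both ends; hence the factor 2 here and the division by 2 in the
      conclusion.\<close>
    also have "(\<Sum>S\<in>?P. e (flip (nat \<bar>j\<bar>) S) j) = (\<Sum>S\<in>?P. e S j)"
      by (rule sum.reindex_bij_witness[of _ "flip (nat \<bar>j\<bar>)" "flip (nat \<bar>j\<bar>)"])
        (auto dest: subsetD[OF flip_subset[OF l]])
    finally show ?thesis by (simp add: mult_2)
  qed
  have "ennreal (N * (\<Sum>j\<in>?J. w j * u j)) = (\<Sum>j\<in>?J. ennreal (w j) * ennreal (N * u j))"
    using w u N by (subst sum_distrib_left) (simp add: ennreal_mult[symmetric] mult_ac flip: sum_ennreal)
  also have "\<dots> \<le> (\<Sum>j\<in>?J. ennreal (w j) * (2 * (\<Sum>S\<in>?P. e S j)))"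
    by (intro sum_mono mult_left_mono each) auto
  also have "\<dots> = 2 * (\<Sum>j\<in>?J. \<Sum>S\<in>?P. ennreal (w j) * e S j)"
    by (simp add: sum_distrib_left mult_ac)
  also have "(\<Sum>j\<in>?J. \<Sum>S\<in>?P. ennreal (w j) * e S j) = (\<Sum>S\<in>?P. \<Sum>j\<in>?J. ennreal (w j) * e S j)"
    by (rule sum.swap)
  also have "2 * \<dots> \<le> 2 * (\<Sum>S\<in>?P. B)"
    by (intro mult_left_mono sum_mono upper) auto
  finally have *: "ennreal (N * (\<Sum>j\<in>?J. w j * u j)) \<le> 2 * (\<Sum>S\<in>?P. B)" .
  show ?thesis
  proof (cases B)
    case (real b)
    have "2 * (\<Sum>S\<in>?P. B) = ennreal (N * (2 * b))"
      using real by (simp add: N_def ennreal_mult ennreal_of_nat_eq_real_of_nat mult_ac)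
    with * have "N * (\<Sum>j\<in>?J. w j * u j) \<le> N * (2 * b)"
      using real N by (simp add: ennreal_le_iff)
    then have "(\<Sum>j\<in>?J. w j * u j) \<le> 2 * b" using N by simp
    then show ?thesis unfolding real(2) by (intro ennreal_leI) simp
  qed simp
qed

section \<open>Comparison of the two terms of the rate\<close>

lemma rate_balance:
  assumes pos: "\<And>j. \<gamma> j > 0" "\<And>j. \<alpha> j > 0" "\<And>j. \<omega> j > 0"
    and kstar: "\<And>l. l \<ge> 1 \<Longrightarrow> is_arg_min (rate_objective \<omega> \<gamma> \<alpha> l) (\<lambda>_. True) (kstar l)"
    and eta_ge: "\<eta> \<ge> 1"
    and eta: "inverse \<eta> =
      (INF l\<in>{1..}. inverse (Psi \<omega> \<gamma> \<alpha> l) *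
         min (\<omega> (int (kstar l)) / \<gamma> (int (kstar l))) (variance_term \<omega> \<alpha> l (kstar l)))"
    and n: "n \<ge> 1"
  shows "variance_term \<omega> \<alpha> n (kstar n) \<le> \<eta> * (\<omega> (int (kstar n)) / \<gamma> (int (kstar n)))"
    and "Psi \<omega> \<gamma> \<alpha> n \<le> \<eta> * variance_term \<omega> \<alpha> n (kstar n)"
proof -
  let ?W = "\<lambda>l. \<omega> (int (kstar l)) / \<gamma> (int (kstar l))"
  let ?V = "\<lambda>l. variance_term \<omega> \<alpha> l (kstar l)"
  have V: "0 < variance_term \<omega> \<alpha> l k" if "l \<ge> 1" for l k
    unfolding variance_term_def using that pos by (intro sum_pos) auto
  have Psi: "Psi \<omega> \<gamma> \<alpha> l = max (?W l) (?V l)" if l: "l \<ge> 1" for l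
  proof -
    have least: "rate_objective \<omega> \<gamma> \<alpha> l (kstar l) \<le> rate_objective \<omega> \<gamma> \<alpha> l k" for k
      using kstar[OF l] by (auto simp: is_arg_min_def not_less)
    have "Psi \<omega> \<gamma> \<alpha> l = rate_objective \<omega> \<gamma> \<alpha> l (kstar l)"
      unfolding Psi_def using least
      by (intro antisym cINF_lower cINF_greatest bdd_belowI2[where m="rate_objective \<omega> \<gamma> \<alpha> l (kstar l)"]) auto
    then show ?thesis by (simp add: rate_objective_def)
  qed
  have Psi_pos: "0 < Psi \<omega> \<gamma> \<alpha> l" if "l \<ge> 1" for l
    using Psi[OF that] V[OF that, of "kstar l"] by simp
  \<comment> \<open>The infimum over all sample sizes is used at \<open>n\<close>; it is a lower
    bound in the reals because its terms are non-negative.\<close>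
  have "inverse \<eta> \<le> inverse (Psi \<omega> \<gamma> \<alpha> n) * min (?W n) (?V n)"
    unfolding eta
  proof (rule cINF_lower)
    show "bdd_below ((\<lambda>l. inverse (Psi \<omega> \<gamma> \<alpha> l) * min (?W l) (?V l)) ` {1..})"
      using Psi_pos V pos
      by (intro bdd_belowI2[where m=0] mult_nonneg_nonneg) (auto intro!: less_imp_le)
  qed (use n in auto)
  moreover have "P \<le> \<eta> * u" if "inverse \<eta> \<le> inverse P * u" "0 < P" for P u
    using that eta_ge by (simp add: field_simps)
  \<comment> \<open>\<open>Psi\<close> is the maximum of the two terms at the minimizer, so they
    agree up to the factor \<eta>.\<close>
  ultimately have *: "Psi \<omega> \<gamma> \<alpha> n \<le> \<eta> * min (?W n) (?V n)"
    using Psi_pos[OF n] by blast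
  have "\<eta> * min (?W n) (?V n) \<le> \<eta> * ?V n" "\<eta> * min (?W n) (?V n) \<le> \<eta> * ?W n"
    using eta_ge by (intro mult_left_mono min.cobounded1 min.cobounded2, simp)+
  moreover have "?V n \<le> Psi \<omega> \<gamma> \<alpha> n" using Psi[OF n] by simp
  ultimately show "?V n \<le> \<eta> * ?W n" "Psi \<omega> \<gamma> \<alpha> n \<le> \<eta> * ?V n" using * by linarith+
qed

text \<open>Cauchy-Schwarz after inserting \<gamma>. The left side controls the sup norm of a
  perturbation; the last factor stays bounded when 1/\<gamma> is summable.\<close>

lemma sum_inverse_sqrt_bound:
  fixes \<alpha> \<gamma> :: "'a \<Rightarrow> real"
  assumes "\<And>j. \<gamma> j > 0" "\<And>j. \<alpha> j > 0"
  shows "(\<Sum>j\<in>J. 1 / sqrt (\<alpha> j))\<^sup>2 \<le> (\<Sum>j\<in>J. \<gamma> j / \<alpha> j) * (\<Sum>j\<in>J. inverse (\<gamma> j))"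
proof -
  have "(\<Sum>j\<in>J. 1 / sqrt (\<alpha> j)) = (\<Sum>j\<in>J. sqrt (\<gamma> j / \<alpha> j) * sqrt (inverse (\<gamma> j)))"
    using assms less_imp_neq[OF assms(1)]
    by (intro sum.cong refl) (auto simp: real_sqrt_divide real_sqrt_inverse field_simps)
  then have "(\<Sum>j\<in>J. 1 / sqrt (\<alpha> j))\<^sup>2 = (\<Sum>j\<in>J. sqrt (\<gamma> j / \<alpha> j) * sqrt (inverse (\<gamma> j)))\<^sup>2" by simp
  also have "\<dots> \<le> (\<Sum>j\<in>J. (sqrt (\<gamma> j / \<alpha> j))\<^sup>2) * (\<Sum>j\<in>J. (sqrt (inverse (\<gamma> j)))\<^sup>2)"
    by (rule Cauchy_Schwarz_ineq_sum)
  also have "\<dots> = (\<Sum>j\<in>J. \<gamma> j / \<alpha> j) * (\<Sum>j\<in>J. inverse (\<gamma> j))"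
    using assms by (simp add: less_imp_le)
  finally show ?thesis .
qed

text \<open>Since \<omega>/\<gamma> is non-increasing in |j|, within the cutoff \<gamma> is at most
  \<omega> times the value of \<gamma>/\<omega> at \<open>k\<close>. Hence the variance term
  controls the sum, and the balance cancels the value at \<open>k\<close>.\<close>

lemma gamma_alpha_sum_bound:
  assumes pos: "\<And>j. \<gamma> j > 0" "\<And>j. \<alpha> j > 0" "\<And>j. \<omega> j > 0"
    and sym: "symmetric_seq \<gamma>" "symmetric_seq \<omega>"
    and decr: "decseq (\<lambda>k::nat. \<omega> (int k) / \<gamma> (int k))" and n: "n \<ge> 1"
    and bal: "variance_term \<omega> \<alpha> n k \<le> \<eta> * (\<omega> (int k) / \<gamma> (int k))"
  shows "(\<Sum>j\<in>{- int k..int k}. \<gamma> j / \<alpha> j) \<le> real n * \<eta>"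
proof -
  let ?W = "\<omega> (int k) / \<gamma> (int k)"
  have W: "0 < ?W" using pos by simp
  have "?W * (\<Sum>j\<in>{- int k..int k}. \<gamma> j / \<alpha> j) \<le> real n * variance_term \<omega> \<alpha> n k"
    unfolding variance_term_def sum_distrib_left
  proof (rule sum_mono)
    fix j assume j: "j \<in> {- int k..int k}"
    have abs: "\<omega> j = \<omega> (int (nat \<bar>j\<bar>))" "\<gamma> j = \<gamma> (int (nat \<bar>j\<bar>))"
      using sym by (auto simp: symmetric_seq_def abs_if)
    have "?W \<le> \<omega> j / \<gamma> j"
      unfolding abs using j by (intro decseqD[OF decr]) auto
    then have "?W * \<gamma> j \<le> \<omega> j" using pos(1)[of j] by (simp add: pos_le_divide_eq)
    then have "?W * \<gamma> j / \<alpha> j \<le> \<omega> j / \<alpha> j" using pos(2)[of j] by (intro divide_right_mono) auto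
    then show "?W * (\<gamma> j / \<alpha> j) \<le> real n * (\<omega> j / (real n * \<alpha> j))" using n by simp
  qed
  also have "\<dots> \<le> real n * (\<eta> * ?W)" using bal by (intro mult_left_mono) auto
  finally have "?W * (\<Sum>j\<in>{- int k..int k}. \<gamma> j / \<alpha> j) \<le> ?W * (real n * \<eta>)" by (simp add: mult_ac)
  then show ?thesis using W by (simp only: mult_le_cancel_left_pos)
qed

text \<open>\<open>b\<close> is a constant base intensity. The amplitude alpha^(-1/2) makes all
  flips equally visible after convolution, up to the constant of the density class; j = 0 is
  perturbed too, so that no term of the variance sum is lost.\<close>

definition vertex_coeff :: "real \<Rightarrow> real \<Rightarrow> (int \<Rightarrow> real) \<Rightarrow> nat set \<Rightarrow> int \<Rightarrow> real" where
  "vertex_coeff b s \<alpha> S j = (if j = 0 then b else 0) + s * (if nat \<bar>j\<bar> \<in> S then 1 else - 1) / sqrt (\<alpha> j)"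

lemma vertex_coeff_symmetric: "symmetric_seq \<alpha> \<Longrightarrow> vertex_coeff b s \<alpha> S (- j) = vertex_coeff b s \<alpha> S j"
  by (simp add: vertex_coeff_def symmetric_seq_def)

lemma vertex_coeff_flip:
  assumes "0 \<le> s" "0 < \<alpha> j"
  shows "\<bar>vertex_coeff b s \<alpha> S j - vertex_coeff b s \<alpha> (flip l S) j\<bar> = (if nat \<bar>j\<bar> = l then 2 * s / sqrt (\<alpha> j) else 0)"
  using assms by (auto simp: vertex_coeff_def mem_flip diff_divide_distrib[symmetric] simp del: diff_divide_distrib)

lemma vertex_bounds:
  assumes s: "0 \<le> s" and \<alpha>: "\<And>j. 0 < \<alpha> j"
  shows "\<bar>trig_poly (vertex_coeff b s \<alpha> S) k t - b\<bar> \<le> s * (\<Sum>j\<in>{- int k..int k}. 1 / sqrt (\<alpha> j))"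
proof -
  define c where "c j = s * (if nat \<bar>j\<bar> \<in> S then 1 else - 1) / sqrt (\<alpha> j)" for j
  have "(\<Sum>j\<in>{- int k..int k}. complex_of_real (vertex_coeff b s \<alpha> S j) * basis_fun j t)
      = (\<Sum>j\<in>{- int k..int k}. (if j = 0 then of_real b else 0) + of_real (c j) * basis_fun j t)"
    by (intro sum.cong refl) (auto simp: vertex_coeff_def c_def ring_distribs)
  also have "\<dots> = of_real b + (\<Sum>j\<in>{- int k..int k}. of_real (c j) * basis_fun j t)"
    by (simp add: sum.distrib)
  finally have "trig_poly (vertex_coeff b s \<alpha> S) k t = b + trig_poly c k t"
    by (simp add: trig_poly_def del: Re_sum)
  then have "\<bar>trig_poly (vertex_coeff b s \<alpha> S) k t - b\<bar> \<le> (\<Sum>j\<in>{- int k..int k}. \<bar>c j\<bar>)"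
    using trig_poly_bound[of c k t] by simp
  also have "\<dots> = (\<Sum>j\<in>{- int k..int k}. s * (1 / sqrt (\<alpha> j)))"
    using s \<alpha> by (intro sum.cong refl) (auto simp: c_def less_imp_le)
  finally show ?thesis by (simp add: sum_distrib_left)
qed

text \<open>The base contributes at j = 0 only, where \<gamma> is 1; the bound (x + y)^2 <= 2 x^2 +
  2 y^2 handles its overlap with the perturbation.\<close>

lemma vertex_weighted_norm:
  assumes \<gamma>0: "\<gamma> 0 = 1" and pos: "\<And>j. 0 < \<gamma> j" "\<And>j. 0 < \<alpha> j" and sym: "symmetric_seq \<alpha>"
  shows "wnorm2 \<gamma> (\<lambda>t. complex_of_real (trig_poly (vertex_coeff b s \<alpha> S) k t))
    \<le> ennreal (2 * b\<^sup>2 + 2 * (s\<^sup>2 * (\<Sum>j\<in>{- int k..int k}. \<gamma> j / \<alpha> j)))"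
proof -
  let ?c = "vertex_coeff b s \<alpha> S"
  note fc = fourier_coeff_trig_poly[of ?c, OF vertex_coeff_symmetric[OF sym]]
  have "wnorm2 \<gamma> (\<lambda>t. complex_of_real (trig_poly ?c k t))
      = (\<Sum>j\<in>{- int k..int k}. ennreal (\<gamma> j * (cmod (fourier_coeff (\<lambda>t. complex_of_real (trig_poly ?c k t)) j))\<^sup>2))"
    by (rule wnorm2_eq_sum) (auto simp: fc)
  also have "\<dots> = ennreal (\<Sum>j\<in>{- int k..int k}. \<gamma> j * (?c j)\<^sup>2)"
    using pos(1) by (subst sum_ennreal[symmetric]) (auto simp: fc less_imp_le)
  also have "\<dots> \<le> ennreal (\<Sum>j\<in>{- int k..int k}. (if j = 0 then 2 * b\<^sup>2 else 0) + 2 * (s\<^sup>2 * (\<gamma> j / \<alpha> j)))"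
  proof (intro ennreal_leI sum_mono)
    fix j
    let ?x = "if j = 0 then b else 0" and ?y = "s * (if nat \<bar>j\<bar> \<in> S then 1 else - 1) / sqrt (\<alpha> j)"
    have y2: "?y\<^sup>2 = s\<^sup>2 / \<alpha> j" using pos(2)[of j] by (simp add: power_divide power_mult_distrib)
    have "(x + y)\<^sup>2 + (x - y)\<^sup>2 = 2 * x\<^sup>2 + 2 * y\<^sup>2" for x y :: real
      by (simp add: power2_eq_square algebra_simps)
    from this[of ?x ?y] have "(?c j)\<^sup>2 \<le> 2 * ?x\<^sup>2 + 2 * ?y\<^sup>2"
      unfolding vertex_coeff_def using zero_le_power2[of "?x - ?y"] by linarith
    then have "\<gamma> j * (?c j)\<^sup>2 \<le> \<gamma> j * (2 * ?x\<^sup>2 + 2 * ?y\<^sup>2)"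
      using pos(1)[of j] by (intro mult_left_mono) auto
    also have "\<dots> = (if j = 0 then 2 * b\<^sup>2 else 0) + 2 * (s\<^sup>2 * (\<gamma> j / \<alpha> j))"
      unfolding y2 using \<gamma>0 by (auto simp: algebra_simps)
    finally show "\<gamma> j * (?c j)\<^sup>2 \<le> (if j = 0 then 2 * b\<^sup>2 else 0) + 2 * (s\<^sup>2 * (\<gamma> j / \<alpha> j))" .
  qed
  also have "(\<Sum>j\<in>{- int k..int k}. (if j = 0 then 2 * b\<^sup>2 else 0) + 2 * (s\<^sup>2 * (\<gamma> j / \<alpha> j)))
      = 2 * b\<^sup>2 + 2 * (s\<^sup>2 * (\<Sum>j\<in>{- int k..int k}. \<gamma> j / \<alpha> j))"
    by (simp add: sum.distrib sum_distrib_left)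
  finally show ?thesis .
qed

text \<open>Only j = l and j = -l contribute, each 4 s^2 d. They coincide when l = 0 and may lie
  beyond \<open>k\<close>, hence an inequality.\<close>

lemma vertex_distance:
  assumes s: "0 \<le> s" and \<alpha>: "\<And>j. 0 < \<alpha> j" and d: "0 \<le> d"
  shows "(\<Sum>j\<in>{- int k..int k}. (vertex_coeff b s \<alpha> S j - vertex_coeff b s \<alpha> (flip l S) j)\<^sup>2 * (d * \<alpha> j))
    \<le> 8 * s\<^sup>2 * d"
proof -
  have "(vertex_coeff b s \<alpha> S j - vertex_coeff b s \<alpha> (flip l S) j)\<^sup>2 * (d * \<alpha> j)
      = (if j \<in> {- int l, int l} then 4 * s\<^sup>2 * d else 0)" for j
  proof -
    have "\<bar>vertex_coeff b s \<alpha> S j - vertex_coeff b s \<alpha> (flip l S) j\<bar>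
        = (if nat \<bar>j\<bar> = l then 2 * s / sqrt (\<alpha> j) else 0)"
      by (rule vertex_coeff_flip[OF s \<alpha>])
    from arg_cong[where f="\<lambda>x. x\<^sup>2", OF this]
    have "(vertex_coeff b s \<alpha> S j - vertex_coeff b s \<alpha> (flip l S) j)\<^sup>2
        = (if nat \<bar>j\<bar> = l then 2 * s / sqrt (\<alpha> j) else 0)\<^sup>2"
      by (simp only: power2_abs)
    moreover have "nat \<bar>j\<bar> = l \<longleftrightarrow> j \<in> {- int l, int l}" by auto
    ultimately show ?thesis using \<alpha>[of j] by (simp add: power_divide power_mult_distrib)
  qed
  then have "(\<Sum>j\<in>{- int k..int k}. (vertex_coeff b s \<alpha> S j - vertex_coeff b s \<alpha> (flip l S) j)\<^sup>2 * (d * \<alpha> j))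
      = (\<Sum>j\<in>{- int k..int k} \<inter> {- int l, int l}. 4 * s\<^sup>2 * d)"
    by (simp only: sum.inter_restrict[OF finite_atLeastAtMost_int])
  also have "\<dots> \<le> (\<Sum>j\<in>{- int l, int l}. 4 * s\<^sup>2 * d)"
    using d by (intro sum_mono2) auto
  also have "\<dots> \<le> real 2 * (4 * s\<^sup>2 * d)"
    unfolding sum_constant using d by (intro mult_right_mono of_nat_mono) (auto simp: card_insert_if)
  finally show ?thesis by simp
qed

section \<open>Choice of the constants and assembly of the lower bound\<close>

theorem theorem3p2:
  fixes r d \<eta> \<Gamma> \<delta> \<zeta> :: real
    and \<gamma> \<alpha> \<omega> :: "int \<Rightarrow> real"
    and kstar :: "nat \<Rightarrow> nat"
    and n m :: nat
    and P :: "(real \<Rightarrow> real) \<Rightarrow> (real \<Rightarrow> real) \<Rightarrow> 'w measure"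
    and K :: "nat \<Rightarrow> 'w \<Rightarrow> nat"
    and x eps :: "nat \<Rightarrow> nat \<Rightarrow> 'w \<Rightarrow> real"
    and Y :: "nat \<Rightarrow> 'w \<Rightarrow> real"
  assumes r: "r > 0" and d: "d \<ge> 1"
    and pos: "\<And>j. \<gamma> j > 0" "\<And>j. \<alpha> j > 0" "\<And>j. \<omega> j > 0"
    and sym: "symmetric_seq \<gamma>" "symmetric_seq \<alpha>" "symmetric_seq \<omega>"
    and at0: "\<gamma> 0 = 1" "\<omega> 0 = 1" "\<alpha> 0 = 1"
    and gamma_ge: "\<And>j. \<gamma> j \<ge> 1"
    and decr: "decseq (\<lambda>k::nat. \<omega> (int k) / \<gamma> (int k))" "decseq (\<lambda>k::nat. \<alpha> (int k))"
    and alpha_summable: "\<alpha> summable_on UNIV"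
    and kstar: "\<And>l. l \<ge> 1 \<Longrightarrow> is_arg_min (rate_objective \<omega> \<gamma> \<alpha> l) (\<lambda>_. True) (kstar l)"
    and gamma_summable: "(\<lambda>j. inverse (\<gamma> j)) summable_on UNIV"
    and Gamma: "\<Gamma> = (\<Sum>\<^sub>\<infinity>j. inverse (\<gamma> j))"
    and eta_ge: "\<eta> \<ge> 1"
    and eta: "inverse \<eta> =
      (INF l\<in>{1..}. inverse (Psi \<omega> \<gamma> \<alpha> l) *
         min (\<omega> (int (kstar l)) / \<gamma> (int (kstar l))) (variance_term \<omega> \<alpha> l (kstar l)))"
    and delta: "\<delta> = 1 / 2 - 1 / (2 * sqrt 2)"
    and zeta: "\<zeta> = min (1 / (2 * \<Gamma> * d * \<eta>)) (2 * \<delta> / (d * sqrt r))"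
    and nonempty: "density_class \<alpha> d \<noteq> {}"
    and n: "n \<ge> 1" and m: "m \<ge> 1"
    and model: "\<And>lam f. lam \<in> intensity_class \<gamma> r \<Longrightarrow> f \<in> density_class \<alpha> d \<Longrightarrow>
      poisson_deconvolution (P lam f) lam f n m K x eps Y"
  shows "(INF T\<in>estimators n m. SUP lam\<in>intensity_class \<gamma> r. SUP f\<in>density_class \<alpha> d.
            \<integral>\<^sup>+ w. wnorm2 \<omega> (\<lambda>t. T (observation n m K x eps Y w) t - complex_of_real (lam t))
              \<partial>(P lam f))
         \<ge> ennreal (\<zeta> * r / (16 * \<eta>) * Psi \<omega> \<gamma> \<alpha> n)"
proof (rule INF_greatest)
  fix T assume T: "T \<in> estimators n m"
  let ?B = "SUP lam\<in>intensity_class \<gamma> r. SUP f\<in>density_class \<alpha> d.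
      \<integral>\<^sup>+ w. wnorm2 \<omega> (\<lambda>t. T (observation n m K x eps Y w) t - complex_of_real (lam t)) \<partial>(P lam f)"
  \<comment> \<open>One density serves all vertices: the inner supremum is at least the risk at this
    \<open>f\<close>.\<close>
  obtain f where f: "f \<in> density_class \<alpha> d" using nonempty by blast
  define k where "k = kstar n"
  define J where "J = {- int k..int k}"
  define A where "A = (\<Sum>j\<in>J. \<gamma> j / \<alpha> j)"
  define V where "V = variance_term \<omega> \<alpha> n k"
  note bal = rate_balance[OF pos kstar eta_ge eta n, folded k_def]
  have A: "A \<le> real n * \<eta>"
    unfolding A_def J_def by (rule gamma_alpha_sum_bound[OF pos sym(1,3) decr(1) n bal(1)])
  have Gamma_ge: "(\<Sum>j\<in>I. inverse (\<gamma> j)) \<le> \<Gamma>" if "finite I" for I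
    unfolding Gamma using pos that by (intro finite_sum_le_infsum gamma_summable) (auto intro: less_imp_le)
  have Gamma1: "1 \<le> \<Gamma>" using Gamma_ge[of "{0}"] at0 by simp
  have delta_pos: "0 < \<delta>" unfolding delta by (simp add: field_simps)
  have zeta_pos: "0 < \<zeta>" unfolding zeta using Gamma1 d eta_ge delta_pos r by simp
  have zeta1: "\<zeta> * (2 * \<Gamma> * d * \<eta>) \<le> 1" and zeta2: "\<zeta> * (d * sqrt r) \<le> 2 * \<delta>"
  proof -
    have "\<zeta> \<le> 1 / (2 * \<Gamma> * d * \<eta>)" "\<zeta> \<le> 2 * \<delta> / (d * sqrt r)" unfolding zeta by auto
    then show "\<zeta> * (2 * \<Gamma> * d * \<eta>) \<le> 1" "\<zeta> * (d * sqrt r) \<le> 2 * \<delta>"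
      using Gamma1 d eta_ge r by (simp_all only: pos_le_divide_eq mult_pos_pos zero_less_numeral real_sqrt_gt_zero
        less_le_trans[OF zero_less_one])
  qed
  \<comment> \<open>The two entries of \<zeta> are two constraints on this amplitude: the first
    gives \<open>s2A\<close>, the second gives \<open>close\<close>.\<close>
  define s where "s = sqrt (r * \<zeta> / (4 * real n))"
  have s: "0 \<le> s" and s2: "s\<^sup>2 = r * \<zeta> / (4 * real n)"
    using r zeta_pos by (auto simp: s_def)
  have s2A: "s\<^sup>2 * A * \<Gamma> \<le> r / 8"
  proof -
    have "s\<^sup>2 * A \<le> s\<^sup>2 * (real n * \<eta>)" using A by (rule mult_left_mono) simp
    also have "\<dots> = r * \<zeta> * \<eta> / 4" using n by (simp add: s2)
    finally have "s\<^sup>2 * A * \<Gamma> \<le> r * \<zeta> * \<eta> / 4 * \<Gamma>" using Gamma1 by (intro mult_right_mono) auto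
    also have "\<dots> = r / 8 * (\<zeta> * (2 * \<Gamma> * 1 * \<eta>))" by simp
    also have "\<dots> \<le> r / 8 * (\<zeta> * (2 * \<Gamma> * d * \<eta>))"
      using r zeta_pos Gamma1 d eta_ge by (intro mult_left_mono mult_right_mono) auto
    also have "\<dots> \<le> r / 8 * 1" using zeta1 r by (intro mult_left_mono) auto
    finally show ?thesis by simp
  qed
  have A_nonneg: "0 \<le> A" unfolding A_def using pos by (intro sum_nonneg) (auto intro: less_imp_le)
  \<comment> \<open>The base uses 2 b^2 = r/2 of the budget r, and the perturbation at most r/4. The
    bound \<open>h\<close> on the perturbation is the square root of r/8, so the gap
    \<open>b - h\<close> is \<delta> sqrt r; this is the origin of \<delta>.\<close>
  define b where "b = sqrt r / 2"
  define h where "h = sqrt r / (2 * sqrt 2)"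
  have h: "h\<^sup>2 = r / 8" "0 \<le> h" using r by (auto simp: h_def power_divide power_mult_distrib)
  have amp: "s * (\<Sum>j\<in>J. 1 / sqrt (\<alpha> j)) \<le> h"
  proof (rule power2_le_imp_le)
    have "(\<Sum>j\<in>J. 1 / sqrt (\<alpha> j))\<^sup>2 \<le> A * (\<Sum>j\<in>J. inverse (\<gamma> j))"
      unfolding A_def using pos by (intro sum_inverse_sqrt_bound)
    also have "\<dots> \<le> A * \<Gamma>" using A_nonneg by (intro mult_left_mono Gamma_ge) (auto simp: J_def)
    finally have "s\<^sup>2 * (\<Sum>j\<in>J. 1 / sqrt (\<alpha> j))\<^sup>2 \<le> s\<^sup>2 * (A * \<Gamma>)" by (rule mult_left_mono) simp
    then show "(s * (\<Sum>j\<in>J. 1 / sqrt (\<alpha> j)))\<^sup>2 \<le> h\<^sup>2"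
      using s2A by (simp add: h power_mult_distrib mult.assoc)
  qed (rule h)
  define c where "c = b - h"
  have c_eq: "c = \<delta> * sqrt r" by (simp add: c_def b_def h_def delta left_diff_distrib)
  have c: "0 < c" unfolding c_eq using delta_pos r by simp
  define vc where "vc S = vertex_coeff b s \<alpha> S" for S
  define lam where "lam S = trig_poly (vc S) k" for S
  have lam_bounds: "c \<le> lam S t" "lam S t \<le> b + h" for S t
  proof -
    have "\<bar>lam S t - b\<bar> \<le> s * (\<Sum>j\<in>J. 1 / sqrt (\<alpha> j))"
      unfolding lam_def vc_def J_def by (rule vertex_bounds[OF s pos(2)])
    then show "c \<le> lam S t" "lam S t \<le> b + h" using amp unfolding c_def by linarith+
  qed
  have lam_per: "lam S (t + 1) = lam S t" for S t unfolding lam_def by (rule trig_poly_periodic)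
  have [measurable]: "lam S \<in> borel_measurable borel" for S unfolding lam_def by measurable
  have vc_sym: "vc S (- j) = vc S j" for S j unfolding vc_def by (rule vertex_coeff_symmetric[OF sym(2)])
  have lam_in: "lam S \<in> intensity_class \<gamma> r" for S
    unfolding intensity_class_def
  proof (intro CollectI conjI)
    show "(\<lambda>t. complex_of_real (lam S t)) \<in> L2" unfolding lam_def by (rule trig_poly_in_L2)
    have "0 \<le> lam S t" for t using lam_bounds(1)[of S t] c by linarith
    then show "AE t\<in>{0..<1} in lborel. 0 \<le> lam S t" by simp
    have "wnorm2 \<gamma> (\<lambda>t. complex_of_real (lam S t)) \<le> ennreal (2 * b\<^sup>2 + 2 * (s\<^sup>2 * A))"
      unfolding lam_def vc_def A_def J_def using at0 pos sym by (intro vertex_weighted_norm) auto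
    also have "\<dots> \<le> ennreal r"
    proof (rule ennreal_leI)
      have "s\<^sup>2 * A * 1 \<le> s\<^sup>2 * A * \<Gamma>" using A_nonneg Gamma1 by (intro mult_left_mono) auto
      then have "s\<^sup>2 * A \<le> r / 8" using s2A by simp
      moreover have "b\<^sup>2 = r / 4" using r by (simp add: b_def power_divide)
      ultimately show "2 * b\<^sup>2 + 2 * (s\<^sup>2 * A) \<le> r" using r by simp
    qed
    finally show "wnorm2 \<gamma> (\<lambda>t. complex_of_real (lam S t)) \<le> ennreal r" .
  qed
  let ?conv = "real_density.convolved (density_version f)"
  have close: "real n * (LINT t:{0..<1}|lborel. (?conv (lam S) t - ?conv (lam (flip l S)) t)\<^sup>2) \<le> 4 * c" for S l
  proof -
    have "(LINT t:{0..<1}|lborel. (?conv (lam S) t - ?conv (lam (flip l S)) t)\<^sup>2) \<le> 8 * s\<^sup>2 * d"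
      unfolding lam_def vc_def using d
      by (intro order_trans[OF convolved_trig_poly_distance[OF f pos(2)] vertex_distance[OF s pos(2)]]) simp
    then have "real n * (LINT t:{0..<1}|lborel. (?conv (lam S) t - ?conv (lam (flip l S)) t)\<^sup>2) \<le> real n * (8 * s\<^sup>2 * d)"
      by (intro mult_left_mono) auto
    \<comment> \<open>Splitting r as sqrt r times sqrt r exposes the product bounded by
      \<open>zeta2\<close>; what remains is 4 \<delta> sqrt r, that is \<open>4 * c\<close>.\<close>
    also have "\<dots> = 2 * (sqrt r * sqrt r) * \<zeta> * d" using n r by (simp add: s2)
    also have "\<dots> = 2 * sqrt r * (\<zeta> * (d * sqrt r))" by (simp only: mult_ac)
    also have "\<dots> \<le> 2 * sqrt r * (2 * \<delta>)" using zeta2 r by (intro mult_left_mono) auto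
    finally show ?thesis by (simp add: c_eq mult_ac)
  qed
  \<comment> \<open>The error in one Fourier coordinate, measurable because estimators are
    measurable through their coefficients.\<close>
  define err where "err S j z = cmod (fourier_coeff (T z) j - of_real (vc S j))" for S j z
  have [measurable]: "(\<lambda>z. fourier_coeff (T z) j) \<in> borel_measurable (obs_space n m)" for j
    using T by (simp add: estimators_def)
  have [measurable]: "err S j \<in> borel_measurable (obs_space n m)" for S j
    unfolding err_def by measurable
  define e where "e S j = (\<integral>\<^sup>+w. ennreal ((err S j (observation n m K x eps Y w))\<^sup>2) \<partial>P (lam S) f)" for S j
  \<comment> \<open>The weighted norm is truncated to the coordinates of the cube, which only lowers
    the risk.\<close>
  have upper: "(\<Sum>j\<in>J. ennreal (\<omega> j) * e S j) \<le> ?B" for S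
  proof -
    interpret M: poisson_deconvolution "P (lam S) f" "lam S" f n m K x eps Y by (rule model[OF lam_in f])
    note M.observation_measurable [measurable]
    have "(\<Sum>j\<in>J. ennreal (\<omega> j) * e S j)
        = (\<integral>\<^sup>+w. (\<Sum>j\<in>J. ennreal (\<omega> j) * ennreal ((err S j (observation n m K x eps Y w))\<^sup>2)) \<partial>P (lam S) f)"
      unfolding e_def by (simp add: nn_integral_sum nn_integral_cmult)
    also have "\<dots> \<le> (\<integral>\<^sup>+w. wnorm2 \<omega> (\<lambda>t. T (observation n m K x eps Y w) t - complex_of_real (lam S t)) \<partial>P (lam S) f)"
    proof (rule nn_integral_mono)
      fix w assume "w \<in> space (P (lam S) f)"
      then have "observation n m K x eps Y w \<in> space (obs_space n m)"
        by (rule measurable_space[OF M.observation_measurable])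
      then have TL2: "T (observation n m K x eps Y w) \<in> L2" using T by (auto simp: estimators_def)
      have "(\<Sum>j\<in>J. ennreal (\<omega> j) * ennreal ((err S j (observation n m K x eps Y w))\<^sup>2))
          = (\<Sum>j\<in>J. ennreal (\<omega> j * (cmod (fourier_coeff (\<lambda>t. T (observation n m K x eps Y w) t - complex_of_real (lam S t)) j))\<^sup>2))"
      proof (rule sum.cong[OF refl])
        fix j assume "j \<in> J"
        then have "fourier_coeff (\<lambda>t. complex_of_real (lam S t)) j = of_real (vc S j)"
          unfolding lam_def fourier_coeff_trig_poly[of "vc S", OF vc_sym] by (simp add: J_def)
        then have "fourier_coeff (\<lambda>t. T (observation n m K x eps Y w) t - complex_of_real (lam S t)) j
            = fourier_coeff (T (observation n m K x eps Y w)) j - of_real (vc S j)"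
          using fourier_coeff_diff[OF TL2 trig_poly_in_L2[of "vc S" k]] by (simp add: lam_def)
        then show "ennreal (\<omega> j) * ennreal ((err S j (observation n m K x eps Y w))\<^sup>2)
            = ennreal (\<omega> j * (cmod (fourier_coeff (\<lambda>t. T (observation n m K x eps Y w) t - complex_of_real (lam S t)) j))\<^sup>2)"
          using pos(3)[of j] by (simp add: err_def ennreal_mult less_imp_le)
      qed
      also have "\<dots> \<le> wnorm2 \<omega> (\<lambda>t. T (observation n m K x eps Y w) t - complex_of_real (lam S t))"
        by (rule wnorm2_ge_sum) (simp add: J_def)
      finally show "(\<Sum>j\<in>J. ennreal (\<omega> j) * ennreal ((err S j (observation n m K x eps Y w))\<^sup>2))
          \<le> wnorm2 \<omega> (\<lambda>t. T (observation n m K x eps Y w) t - complex_of_real (lam S t))" .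
    qed
    also have "\<dots> \<le> ?B" by (rule SUP_upper2[OF lam_in]) (rule SUP_upper[OF f])
    finally show ?thesis .
  qed
  have lower: "ennreal (s\<^sup>2 / (2 * \<alpha> j)) \<le> e S j + e (flip (nat \<bar>j\<bar>) S) j" for S j
  proof -
    let ?S' = "flip (nat \<bar>j\<bar>) S"
    \<comment> \<open>The gap between the two vertices in coordinate \<open>j\<close>; by the
      triangle inequality the two errors of any estimate add up to at least this.\<close>
    let ?D = "2 * s / sqrt (\<alpha> j)"
    have "ennreal (?D\<^sup>2 / 8) \<le> e S j + e ?S' j"
      unfolding e_def
    proof (rule two_point_bound[OF model[OF lam_in f] model[OF lam_in f] m density_version(2)[OF f]
          density_version(1)[OF f] _ _ c lam_bounds lam_per lam_bounds lam_per close])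
      show "0 \<le> ?D" using s pos(2)[of j] by (intro divide_nonneg_nonneg) auto
      fix z
      have "?D = \<bar>vc S j - vc ?S' j\<bar>" unfolding vc_def vertex_coeff_flip[OF s pos(2)] by simp
      also have "\<dots> = cmod ((fourier_coeff (T z) j - of_real (vc ?S' j)) - (fourier_coeff (T z) j - of_real (vc S j)))"
        using norm_of_real[of "vc S j - vc ?S' j", where ?'a=complex] by simp
      also have "\<dots> \<le> err S j z + err ?S' j z"
        unfolding err_def by (subst add.commute) (rule norm_triangle_ineq4)
      finally show "?D \<le> err S j z + err ?S' j z" .
    qed measurable
    moreover have "?D\<^sup>2 / 8 = s\<^sup>2 / (2 * \<alpha> j)"
      using pos(2)[of j] by (simp add: power_divide power_mult_distrib)
    ultimately show ?thesis by simp
  qed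
  \<comment> \<open>The \<eta> cancels against the comparison of \<open>Psi\<close> with the
    variance term. The 1/16 is 1/4 from s^2, 1/2 from the two-point bound and 1/2 from counting each
    edge twice.\<close>
  have "\<zeta> * r / (16 * \<eta>) * Psi \<omega> \<gamma> \<alpha> n \<le> \<zeta> * r / (16 * \<eta>) * (\<eta> * V)"
    using bal(2) zeta_pos r eta_ge unfolding V_def by (intro mult_left_mono) auto
  also have "\<dots> = r * \<zeta> / 16 * V" using eta_ge by simp
  also have "\<dots> = (\<Sum>j\<in>J. \<omega> j * (s\<^sup>2 / (2 * \<alpha> j))) / 2"
    unfolding V_def variance_term_def J_def[symmetric] sum_distrib_left sum_divide_distrib s2
    using n by (intro sum.cong refl) (simp add: field_simps)
  finally have "ennreal (\<zeta> * r / (16 * \<eta>) * Psi \<omega> \<gamma> \<alpha> n) \<le> ennreal ((\<Sum>j\<in>J. \<omega> j * (s\<^sup>2 / (2 * \<alpha> j))) / 2)"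
    by (rule ennreal_leI)
  also have "\<dots> \<le> ?B"
    unfolding J_def
    by (rule assouad_average[where e=e and k=k])
      (use pos upper lower in \<open>auto simp: J_def less_imp_le\<close>)
  finally show "ennreal (\<zeta> * r / (16 * \<eta>) * Psi \<omega> \<gamma> \<alpha> n) \<le> ?B" .
qed

end
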